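(* For any graphs $G$ and $H$, where $G$ is given with a linear ordering of its vertices of width $k$, one can decide in time $\mathcal{O}(k^{2k\cdot\mathrm{mimsup}(H)}\cdot|V(H)|^4|V(G)|)$ whether $G$ admits a homomorphism to $H$.
   Context: Graphs are finite, simple and loopless. A homomorphism from $G$ to $H$ is a map $\varphi:V(G)\to V(H)$ such that $\varphi(u)\varphi(v)\in E(H)$ for every $uv\in E(G)$. The width of a linear ordering $v_1,\dots,v_n$ of $V(G)$ is the maximum over $i\in\{1,\dots,n-1\}$ of the number of edges with one endpoint in $\{v_1,\dots,v_i\}$ and the other in $\{v_{i+1},\dots,v_n\}$. For a $0/1$ matrix $M$, $\mathrm{mim}(M)$ is the largest $r$ such that some choice of $r$ distinct rows and $r$ distinct columns (in some order) gives the $r\times r$ identity matrix; $M^{\otimes k}$ is the $k$-fold Kronecker power; $\mathrm{mimsup}(M)=\limsup_{k\to\infty}\mathrm{mim}(M^{\otimes k})^{1/k}$. For a non-bipartite graph $H$, $\mathrm{mimsup}(H)=\mathrm{mimsup}(A_H)$ where $A_H$ is the adjacency matrix; for a bipartite graph $H$, $\mathrm{mimsup}(H)=\mathrm{mimsup}(B)$ where $B$ is a bi-adjacency matrix of $H$ (rows indexed by one bipartition class, columns by the other). *)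

theory Defs
  imports Complex_Main "HOL-Library.Extended_Real"
begin

section \<open>Graphs, homomorphisms, width\<close>

record 'a graph =
  verts :: "'a set"
  edges :: "'a set set"

definition simple_graph :: "'a graph \<Rightarrow> bool" where
  "simple_graph G \<longleftrightarrow> finite (verts G) \<and> (\<forall>e\<in>edges G. e \<subseteq> verts G \<and> card e = 2)"

definition graph_hom :: "'a graph \<Rightarrow> 'b graph \<Rightarrow> ('a \<Rightarrow> 'b) \<Rightarrow> bool" where
  "graph_hom G H \<phi> \<longleftrightarrow>
     \<phi> ` verts G \<subseteq> verts H \<and> (\<forall>u v. {u, v} \<in> edges G \<longrightarrow> {\<phi> u, \<phi> v} \<in> edges H)"

definition linear_ordering :: "'a graph \<Rightarrow> 'a list \<Rightarrow> bool" where
  "linear_ordering G vs \<longleftrightarrow> distinct vs \<and> set vs = verts G"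

definition cut_edges :: "'a graph \<Rightarrow> 'a list \<Rightarrow> nat \<Rightarrow> 'a set set" where
  "cut_edges G vs i = {e \<in> edges G. \<exists>u \<in> set (take i vs). \<exists>v \<in> set (drop i vs). e = {u, v}}"

text \<open>Inserting 0 only matters for at most one vertex, where there is no cut.\<close>

definition width :: "'a graph \<Rightarrow> 'a list \<Rightarrow> nat" where
  "width G vs = Max (insert 0 ((\<lambda>i. card (cut_edges G vs i)) ` {1..<length vs}))"


section \<open>The parameter mimsup\<close>

text \<open>Matrices whose rows and columns are labelled by finite sets of arbitrary objects.\<close>

record ('r, 'c) lmatrix =
  rows :: "'r set"
  cols :: "'c set"
  entry :: "'r \<Rightarrow> 'c \<Rightarrow> nat"

definition mim :: "('r, 'c) lmatrix \<Rightarrow> nat" where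
  "mim M = Max {r. \<exists>rs cs. length rs = r \<and> length cs = r \<and> distinct rs \<and> distinct cs \<and>
     set rs \<subseteq> rows M \<and> set cs \<subseteq> cols M \<and>
     (\<forall>i<r. \<forall>j<r. entry M (rs ! i) (cs ! j) = (if i = j then 1 else 0))}"

text \<open>
  The entry of a Kronecker product at row \<open>(x, x')\<close> and column \<open>(y, y')\<close> is the product of the
  entries at \<open>(x, y)\<close> and \<open>(x', y')\<close>. Hence rows and columns of the k-fold power are labelled by
  lists of length k.
\<close>

definition kronecker_power :: "('r, 'c) lmatrix \<Rightarrow> nat \<Rightarrow> ('r list, 'c list) lmatrix" where
  "kronecker_power M k =
     \<lparr>rows = {xs. length xs = k \<and> set xs \<subseteq> rows M},
      cols = {ys. length ys = k \<and> set ys \<subseteq> cols M},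
      entry = (\<lambda>xs ys. \<Prod>i<k. entry M (xs ! i) (ys ! i))\<rparr>"

text \<open>
  The limes superior is taken in the extended reals. For a finite 0/1 matrix it is finite, because
  \<open>mim (kronecker_power M k) \<le> card (rows M) ^ k\<close>.
\<close>

definition mimsup :: "('r, 'c) lmatrix \<Rightarrow> real" where
  "mimsup M = real_of_ereal (limsup (\<lambda>k. ereal (root k (real (mim (kronecker_power M k))))))"

definition adj_matrix :: "'a graph \<Rightarrow> ('a, 'a) lmatrix" where
  "adj_matrix H = \<lparr>rows = verts H, cols = verts H,
     entry = (\<lambda>u v. if {u, v} \<in> edges H then 1 else 0)\<rparr>"

definition bipartition :: "'a graph \<Rightarrow> 'a set \<Rightarrow> 'a set \<Rightarrow> bool" where
  "bipartition H X Y \<longleftrightarrow> X \<union> Y = verts H \<and> X \<inter> Y = {} \<and>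
     (\<forall>e\<in>edges H. \<exists>x\<in>X. \<exists>y\<in>Y. e = {x, y})"

definition bipartite :: "'a graph \<Rightarrow> bool" where
  "bipartite H \<longleftrightarrow> (\<exists>X Y. bipartition H X Y)"

definition biadj_matrix :: "'a graph \<Rightarrow> 'a set \<Rightarrow> 'a set \<Rightarrow> ('a, 'a) lmatrix" where
  "biadj_matrix H X Y = \<lparr>rows = X, cols = Y,
     entry = (\<lambda>u v. if {u, v} \<in> edges H then 1 else 0)\<rparr>"

text \<open>
  A disconnected bipartite graph has several bipartitions. Therefore mimsup of a graph is
  introduced as a relation that admits every choice of bi-adjacency matrix.
\<close>

definition mimsup_graph :: "'a graph \<Rightarrow> real \<Rightarrow> bool" where
  "mimsup_graph H \<mu> \<longleftrightarrow>
     (if bipartite H then \<exists>X Y. bipartition H X Y \<and> \<mu> = mimsup (biadj_matrix H X Y)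
      else \<mu> = mimsup (adj_matrix H))"


section \<open>Word RAM programs\<close>

text \<open>
  A program uses finitely many scalar variables and finitely many arrays (interleaved, these are
  the registers and the memory of a word RAM). Conditions and assignments take unit time: the
  number of arithmetic operations and memory accesses in an expression is a constant of the program.
\<close>

type_synonym vname = string

datatype exp =
    Const nat
  | Var vname
  | Elem vname exp
  | Add exp exp
  | Sub exp exp
  | Mul exp exp
  | Div exp exp
  | Mod exp exp

datatype bexp =
    Less exp exp
  | Eq exp exp
  | Not bexp
  | And bexp bexp

datatype com =
    Skip
  | Assign vname exp
  | Store vname exp exp
  | Seq com com
  | Cond bexp com com
  | While bexp com

record state =
  vars :: "vname \<Rightarrow> nat"
  arrs :: "vname \<Rightarrow> nat \<Rightarrow> nat"

fun eval :: "exp \<Rightarrow> state \<Rightarrow> nat" where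
  "eval (Const n) s = n"
| "eval (Var x) s = vars s x"
| "eval (Elem a e) s = arrs s a (eval e s)"
| "eval (Add e1 e2) s = eval e1 s + eval e2 s"
| "eval (Sub e1 e2) s = eval e1 s - eval e2 s"
| "eval (Mul e1 e2) s = eval e1 s * eval e2 s"
| "eval (Div e1 e2) s = eval e1 s div eval e2 s"
| "eval (Mod e1 e2) s = eval e1 s mod eval e2 s"

fun beval :: "bexp \<Rightarrow> state \<Rightarrow> bool" where
  "beval (Less e1 e2) s \<longleftrightarrow> eval e1 s < eval e2 s"
| "beval (Eq e1 e2) s \<longleftrightarrow> eval e1 s = eval e2 s"
| "beval (Not b) s \<longleftrightarrow> \<not> beval b s"
| "beval (And b1 b2) s \<longleftrightarrow> beval b1 s \<and> beval b2 s"

text \<open>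
  \<open>fits w e s\<close> says that evaluating \<open>e\<close> does not overflow a word of \<open>w\<close> bits. Only constants, sums
  and products need a test: truncated subtraction, quotient and remainder never exceed their first
  argument, and a memory whose words are initially below \<open>2 ^ w\<close> keeps this property.
\<close>

fun fits :: "nat \<Rightarrow> exp \<Rightarrow> state \<Rightarrow> bool" where
  "fits w (Const n) s \<longleftrightarrow> n < 2 ^ w"
| "fits w (Var x) s \<longleftrightarrow> True"
| "fits w (Elem a e) s \<longleftrightarrow> fits w e s"
| "fits w (Add e1 e2) s \<longleftrightarrow> fits w e1 s \<and> fits w e2 s \<and> eval e1 s + eval e2 s < 2 ^ w"
| "fits w (Sub e1 e2) s \<longleftrightarrow> fits w e1 s \<and> fits w e2 s"
| "fits w (Mul e1 e2) s \<longleftrightarrow> fits w e1 s \<and> fits w e2 s \<and> eval e1 s * eval e2 s < 2 ^ w"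
| "fits w (Div e1 e2) s \<longleftrightarrow> fits w e1 s \<and> fits w e2 s"
| "fits w (Mod e1 e2) s \<longleftrightarrow> fits w e1 s \<and> fits w e2 s"

fun bfits :: "nat \<Rightarrow> bexp \<Rightarrow> state \<Rightarrow> bool" where
  "bfits w (Less e1 e2) s \<longleftrightarrow> fits w e1 s \<and> fits w e2 s"
| "bfits w (Eq e1 e2) s \<longleftrightarrow> fits w e1 s \<and> fits w e2 s"
| "bfits w (Not b) s \<longleftrightarrow> bfits w b s"
| "bfits w (And b1 b2) s \<longleftrightarrow> bfits w b1 s \<and> bfits w b2 s"

text \<open>
  \<open>exec w P s t s'\<close>: on a machine with \<open>w\<close>-bit words, \<open>P\<close> started in \<open>s\<close> terminates in \<open>s'\<close> after
  exactly \<open>t\<close> steps. An overflow makes the execution stuck.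
\<close>

inductive exec :: "nat \<Rightarrow> com \<Rightarrow> state \<Rightarrow> nat \<Rightarrow> state \<Rightarrow> bool" for w :: nat where
  Skip: "exec w Skip s 1 s"
| Assign: "fits w e s \<Longrightarrow> exec w (Assign x e) s 1 (s\<lparr>vars := (vars s)(x := eval e s)\<rparr>)"
| Store: "fits w i s \<Longrightarrow> fits w e s \<Longrightarrow>
    exec w (Store a i e) s 1 (s\<lparr>arrs := (arrs s)(a := (arrs s a)(eval i s := eval e s))\<rparr>)"
| Seq: "exec w P s t s' \<Longrightarrow> exec w Q s' t' s'' \<Longrightarrow> exec w (Seq P Q) s (t + t') s''"
| CondTrue: "bfits w b s \<Longrightarrow> beval b s \<Longrightarrow> exec w P s t s' \<Longrightarrow> exec w (Cond b P Q) s (t + 1) s'"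
| CondFalse: "bfits w b s \<Longrightarrow> \<not> beval b s \<Longrightarrow> exec w Q s t s' \<Longrightarrow> exec w (Cond b P Q) s (t + 1) s'"
| WhileFalse: "bfits w b s \<Longrightarrow> \<not> beval b s \<Longrightarrow> exec w (While b P) s 1 s"
| WhileTrue: "bfits w b s \<Longrightarrow> beval b s \<Longrightarrow> exec w P s t s' \<Longrightarrow> exec w (While b P) s' t' s'' \<Longrightarrow>
    exec w (While b P) s (t + t' + 1) s''"


section \<open>Encoding of the input\<close>

text \<open>
  Inputs have vertex sets of the form \<open>{0..<n}\<close>. The graph \<open>G\<close> is stored by adjacency lists, with
  the neighbours of \<open>u\<close> in any order, since an adjacency matrix of \<open>G\<close> could not even be read in
  time linear in the number of vertices. The graph \<open>H\<close> is stored by its adjacency matrix.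
\<close>

definition adj_lists :: "nat graph \<Rightarrow> nat list list \<Rightarrow> bool" where
  "adj_lists G adj \<longleftrightarrow> verts G = {0..<length adj} \<and>
     (\<forall>u<length adj. distinct (adj ! u) \<and> set (adj ! u) = {v. {u, v} \<in> edges G})"

definition array_of :: "nat list \<Rightarrow> nat \<Rightarrow> nat" where
  "array_of xs i = (if i < length xs then xs ! i else 0)"

text \<open>
  The neighbours of \<open>u\<close> are the entries of the array \<open>nbr\<close> at the positions from \<open>off[u]\<close> up to,
  but excluding, \<open>off[u+1]\<close>. All memory that does not hold input is zero.
\<close>

definition input_state :: "nat list list \<Rightarrow> nat list \<Rightarrow> nat graph \<Rightarrow> state" where
  "input_state adj vs H =
    (let n = length adj; h = card (verts H) in
     \<lparr>vars = (\<lambda>_. 0)(''n'' := n, ''h'' := h),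
      arrs = (\<lambda>_ _. 0)(
        ''off'' := array_of (map (\<lambda>u. length (concat (take u adj))) [0..<n + 1]),
        ''nbr'' := array_of (concat adj),
        ''ord'' := array_of vs,
        ''H'' := (\<lambda>i. if i < h * h \<and> {i div h, i mod h} \<in> edges H then 1 else 0))\<rparr>)"

definition input_length :: "nat list list \<Rightarrow> nat graph \<Rightarrow> nat" where
  "input_length adj H = 2 + (length adj + 1) + length (concat adj) + length adj + card (verts H) ^ 2"

end

theory Submission
  imports Defs
begin

text \<open>
  If H is bipartite, then G maps to H iff G is edgeless or H has an edge and G is 2-colourable (up to
  empty graphs), which breadth-first search decides. Otherwise sweep over the ordering. A colouring
  of the vertices seen so far matters only through its row, the colours of the left ends of the cut
  edges. A column assigns colours to the right ends, and a set of rows may be replaced by a subset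
  that is compatible with the same columns.

  Such a subset is selected by a search tree. A node has a set \<open>Y\<^sub>j\<close> of available colours for each
  coordinate j of the columns. It is filled with the first row r such that \<open>r\<^sub>j\<close> has a neighbour in
  \<open>Y\<^sub>j\<close> for all j, and then gets one child for each coordinate l, where \<open>Y\<^sub>l\<close> loses the neighbours of
  \<open>r\<^sub>l\<close>: a column that is incompatible with r is so in some coordinate. On a path of the tree, the
  colours used at one coordinate form a half-induced matching of H. If d is the largest size of
  such a matching, then filled nodes have depth at most \<open>k (d - 1)\<close>, so that about \<open>k ^ (k (d - 1))\<close>
  rows remain, and trying all of them at all nodes takes about the square of this number.

  Finally \<open>d \<le> mimsup(H)\<close>: among the sequences of length K over the indices of a half-induced matching,
  those with the most frequent index sum give an induced matching in the K-fold Kronecker power, and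
  they are at least \<open>d ^ K / (K d + 1)\<close> many.
\<close>

section \<open>Reasoning about programs\<close>

text \<open>Bipartite \<open>H\<close> must be split off because its mimsup refers to a bi-adjacency
  matrix, while the sweep compares colours by full adjacency. For a single edge mimsup is 1, yet the
  adjacency matrix has a half-induced matching of size 2: a matching can be followed by its own
  reversal, so \<open>d\<close> may be twice as large as the bi-adjacency matrix allows. For
  non-bipartite \<open>H\<close> both sides speak of the same matrix. The exponent
  \<open>d - 1\<close> instead of \<open>d\<close> is essential. An accepted row adds one pair to
  the matching of every coordinate at once, so a coordinate can occur only \<open>d - 1\<close>
  times on the path to a filled node. The gap between \<open>2 * K * (d - 1)\<close> and
  \<open>2 * K * d\<close> is what pays for the polynomial factors in \<open>K\<close>. In the word
  RAM model an overflow makes the execution stuck, and storage of one phase is not reused for the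
  rows and cuts of the next. Hence every address needs a bound, and the size of the search tree must
  be known before it is enlarged, not only at the end.\<close>

definition wp :: "nat \<Rightarrow> com \<Rightarrow> (nat \<Rightarrow> state \<Rightarrow> bool) \<Rightarrow> state \<Rightarrow> bool" where
  "wp w P Q s \<longleftrightarrow> (\<exists>t s'. exec w P s t s' \<and> Q t s')"

inductive_cases exec_SkipE: "exec w Skip s t s'"
inductive_cases exec_AssignE: "exec w (Assign x e) s t s'"
inductive_cases exec_StoreE: "exec w (Store a i e) s t s'"
inductive_cases exec_SeqE: "exec w (Seq P R) s t s'"
inductive_cases exec_CondE: "exec w (Cond b P R) s t s'"

lemma wp_Skip: "wp w Skip Q s \<longleftrightarrow> Q 1 s"
  unfolding wp_def by (metis exec.Skip exec_SkipE)

lemma wpI: "exec w P s t s' \<Longrightarrow> Q t s' \<Longrightarrow> wp w P Q s"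
  unfolding wp_def by blast

lemma wp_Assign:
  "wp w (Assign x e) Q s \<longleftrightarrow> fits w e s \<and> Q 1 (s\<lparr>vars := (vars s)(x := eval e s)\<rparr>)"
  (is "?L \<longleftrightarrow> ?R")
proof
  show "?L \<Longrightarrow> ?R" unfolding wp_def by (elim exE conjE exec_AssignE) simp
  show "?R \<Longrightarrow> ?L" by (rule wpI, rule exec.Assign, erule conjunct1, erule conjunct2)
qed

lemma wp_Store:
  "wp w (Store a i e) Q s \<longleftrightarrow> fits w i s \<and> fits w e s \<and>
     Q 1 (s\<lparr>arrs := (arrs s)(a := (arrs s a)(eval i s := eval e s))\<rparr>)"
  (is "?L \<longleftrightarrow> ?R")
proof
  show "?L \<Longrightarrow> ?R" unfolding wp_def by (elim exE conjE exec_StoreE) simp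
  show "?R \<Longrightarrow> ?L" by (elim conjE, rule wpI, rule exec.Store)
qed

lemma wp_Seq: "wp w (Seq P R) Q s \<longleftrightarrow> wp w P (\<lambda>t. wp w R (\<lambda>t'. Q (t + t'))) s"
  (is "?L \<longleftrightarrow> ?R")
proof
  show "?L \<Longrightarrow> ?R" unfolding wp_def by (elim exE conjE exec_SeqE) (rule exI, rule exI, rule conjI, assumption, rule exI, rule exI, rule conjI, assumption, simp)
  show "?R \<Longrightarrow> ?L" unfolding wp_def by (elim exE conjE) (rule exI, rule exI, rule conjI, rule exec.Seq)
qed

lemma wp_Cond:
  "wp w (Cond b P R) Q s \<longleftrightarrow> bfits w b s \<and>
     (if beval b s then wp w P (\<lambda>t. Q (t + 1)) s else wp w R (\<lambda>t. Q (t + 1)) s)"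
  (is "?L \<longleftrightarrow> ?R")
proof
  show "?L \<Longrightarrow> ?R" unfolding wp_def by (elim exE conjE exec_CondE) auto
  show ?L if ?R
  proof (cases "beval b s")
    case True
    with that obtain t s' where "exec w P s t s'" "Q (t + 1) s'" unfolding wp_def by auto
    then show ?thesis using that True by (intro wpI[of w _ s "t + 1" s'] exec.CondTrue) simp_all
  next
    case False
    with that obtain t s' where "exec w R s t s'" "Q (t + 1) s'" unfolding wp_def by auto
    then show ?thesis using that False by (intro wpI[of w _ s "t + 1" s'] exec.CondFalse) simp_all
  qed
qed

lemmas wp_simps = wp_Skip wp_Assign wp_Store wp_Seq wp_Cond

section \<open>Syntactic frames: what a program can write\<close>

fun wvars :: "com \<Rightarrow> vname set" where
  "wvars Skip = {}"
| "wvars (Assign x e) = {x}"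
| "wvars (Store a i e) = {}"
| "wvars (Seq P R) = wvars P \<union> wvars R"
| "wvars (Cond b P R) = wvars P \<union> wvars R"
| "wvars (While b P) = wvars P"

fun warrs :: "com \<Rightarrow> vname set" where
  "warrs Skip = {}"
| "warrs (Assign x e) = {}"
| "warrs (Store a i e) = {a}"
| "warrs (Seq P R) = warrs P \<union> warrs R"
| "warrs (Cond b P R) = warrs P \<union> warrs R"
| "warrs (While b P) = warrs P"

definition same_off :: "vname set \<Rightarrow> vname set \<Rightarrow> state \<Rightarrow> state \<Rightarrow> bool" where
  "same_off X A s s' \<longleftrightarrow> (\<forall>x. x \<notin> X \<longrightarrow> vars s' x = vars s x) \<and> (\<forall>a. a \<notin> A \<longrightarrow> arrs s' a = arrs s a)"

lemma same_off_vars: "same_off X A s s' \<Longrightarrow> x \<notin> X \<Longrightarrow> vars s' x = vars s x"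
  by (auto simp: same_off_def)

lemma exec_same_off: "exec w P s t s' \<Longrightarrow> same_off (wvars P) (warrs P) s s'"
  by (induction rule: exec.induct) (auto simp: same_off_def)

abbreviation frame :: "com \<Rightarrow> state \<Rightarrow> state \<Rightarrow> bool" where
  "frame P \<equiv> same_off (wvars P) (warrs P)"

text \<open>Lets a specification mention only what changes: all other variables and arrays are
  recovered from the syntactic frame of \<open>P\<close>.\<close>

lemma wp_use:
  assumes "wp w P Q' s"
    and "\<And>t s'. Q' t s' \<Longrightarrow> same_off (wvars P) (warrs P) s s' \<Longrightarrow> Q t s'"
  shows "wp w P Q s"
  using assms exec_same_off unfolding wp_def by blast

lemma wp_mono:
  assumes "wp w P Q' s" and "\<And>t s'. Q' t s' \<Longrightarrow> Q t s'"
  shows "wp w P Q s"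
  using assms unfolding wp_def by blast

text \<open>The limit \<open>hi\<close> is evaluated anew at every test, so the rules for this loop
  ask that its value be stable under everything the body may write.\<close>

definition For :: "vname \<Rightarrow> exp \<Rightarrow> exp \<Rightarrow> com \<Rightarrow> com" where
  "For x lo hi P = Seq (Assign x lo) (While (Less (Var x) hi) (Seq P (Assign x (Add (Var x) (Const 1)))))"

lemma wvars_For [simp]: "wvars (For x lo hi P) = insert x (wvars P)"
  and warrs_For [simp]: "warrs (For x lo hi P) = warrs P"
  by (auto simp: For_def)

abbreviation set_var :: "vname \<Rightarrow> nat \<Rightarrow> state \<Rightarrow> state" where
  "set_var x v s \<equiv> s\<lparr>vars := (vars s)(x := v)\<rparr>"

abbreviation loop_frame :: "vname \<Rightarrow> com \<Rightarrow> state \<Rightarrow> state \<Rightarrow> bool" where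
  "loop_frame x P \<equiv> same_off (insert x (wvars P)) (warrs P)"

text \<open>Induction on the number \<open>N - i\<close> of remaining rounds. A round costs the body
  plus 2, for the test and the increment, and the failing test costs 1. The frame always refers to
  the same initial state \<open>s\<close>, so invariants need not repeat unchanged data.\<close>

lemma exec_count_up:
  assumes body: "\<And>i s'. lo \<le> i \<Longrightarrow> i < N \<Longrightarrow> I i s' \<Longrightarrow> vars s' x = i \<Longrightarrow> loop_frame x P s s' \<Longrightarrow>
      wp w P (\<lambda>t s''. t \<le> b \<and> I (Suc i) (set_var x (Suc i) s'')) s'"
    and x: "x \<notin> wvars P"
    and hi: "\<And>s'. loop_frame x P s s' \<Longrightarrow> fits w hi s' \<and> eval hi s' = N"
    and N: "N < 2 ^ w" and w: "w > 0"
  shows "lo \<le> i \<Longrightarrow> i \<le> N \<Longrightarrow> I i s' \<Longrightarrow> vars s' x = i \<Longrightarrow> loop_frame x P s s' \<Longrightarrow>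
    \<exists>t s''. exec w (While (Less (Var x) hi) (Seq P (Assign x (Add (Var x) (Const 1))))) s' t s'' \<and>
      t \<le> (N - i) * (b + 2) + 1 \<and> I N s'' \<and> vars s'' x = N"
proof (induction "N - i" arbitrary: i s')
  case 0
  then have "i = N" by simp
  have "exec w (While (Less (Var x) hi) (Seq P (Assign x (Add (Var x) (Const 1))))) s' 1 s'"
    using hi[OF 0(6)] 0 \<open>i = N\<close> by (intro exec.WhileFalse) auto
  then show ?case using 0 \<open>i = N\<close> by auto
next
  case (Suc n)
  then have lt: "i < N" by simp
  obtain t1 s1 where 1: "exec w P s' t1 s1" "t1 \<le> b" "I (Suc i) (set_var x (Suc i) s1)"
    using body[OF Suc(3) lt Suc(5-7)] unfolding wp_def by blast
  have x1: "vars s1 x = i" using exec_same_off[OF 1(1)] x Suc(6) by (auto simp: same_off_def)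
  have w1: "(1::nat) < 2 ^ w" using w one_less_power[of "2::nat" w] by simp
  have "exec w (Assign x (Add (Var x) (Const 1))) s1 1 (set_var x (eval (Add (Var x) (Const 1)) s1) s1)"
    using x1 lt N w1 by (intro exec.Assign) auto
  from exec.Seq[OF 1(1) this] have 2: "exec w (Seq P (Assign x (Add (Var x) (Const 1)))) s' (t1 + 1) (set_var x (Suc i) s1)"
    using x1 by simp
  have so: "loop_frame x P s (set_var x (Suc i) s1)"
    using exec_same_off[OF 1(1)] Suc(7) by (auto simp: same_off_def)
  have n: "n = N - Suc i" using Suc.hyps(2) by simp
  obtain t2 s2 where 3: "exec w (While (Less (Var x) hi) (Seq P (Assign x (Add (Var x) (Const 1))))) (set_var x (Suc i) s1) t2 s2"
      "t2 \<le> (N - Suc i) * (b + 2) + 1" "I N s2" "vars s2 x = N"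
    using Suc.hyps(1)[OF n _ _ 1(3) _ so] Suc.prems(1) lt by auto
  have "exec w (While (Less (Var x) hi) (Seq P (Assign x (Add (Var x) (Const 1))))) s' (t1 + 1 + t2 + 1) s2"
    using hi[OF Suc(7)] Suc(6) lt by (intro exec.WhileTrue[OF _ _ 2 3(1)]) auto
  moreover have "t1 + 1 + t2 + 1 \<le> (N - i) * (b + 2) + 1"
  proof -
    have "(N - i) * (b + 2) = (N - Suc i) * (b + 2) + (b + 2)"
      using lt by (metis Suc_diff_Suc add.commute mult_Suc)
    then show ?thesis using 1(2) 3(2) by linarith
  qed
  ultimately show ?case using 3 by blast
qed

text \<open>The additive 2 consists of the initial assignment and the failing test.\<close>

lemma wp_For:
  assumes body: "\<And>i s'. l \<le> i \<Longrightarrow> i < N \<Longrightarrow> I i s' \<Longrightarrow> vars s' x = i \<Longrightarrow> loop_frame x P s s' \<Longrightarrow>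
      wp w P (\<lambda>t s''. t \<le> b \<and> I (Suc i) (set_var x (Suc i) s'')) s'"
    and lo: "fits w lo s" "eval lo s = l" "l \<le> N"
    and init: "I l (set_var x l s)"
    and hi: "\<And>s'. loop_frame x P s s' \<Longrightarrow> fits w hi s' \<and> eval hi s' = N"
    and x: "x \<notin> wvars P"
    and N: "N < 2 ^ w" and w: "w > 0"
  shows "wp w (For x lo hi P) (\<lambda>t s'. t \<le> (N - l) * (b + 2) + 2 \<and> I N s' \<and> vars s' x = N) s"
proof -
  have so: "loop_frame x P s (set_var x l s)"
    by (auto simp: same_off_def)
  have "\<exists>t s''. exec w (While (Less (Var x) hi) (Seq P (Assign x (Add (Var x) (Const 1))))) (set_var x l s) t s'' \<and>
      t \<le> (N - l) * (b + 2) + 1 \<and> I N s'' \<and> vars s'' x = N"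
    by (rule exec_count_up[where I=I and s=s and lo=l]; (rule body x N w lo(3) init so | simp add: hi lo(3)); assumption)
  then obtain t s'' where *: "exec w (While (Less (Var x) hi) (Seq P (Assign x (Add (Var x) (Const 1))))) (set_var x l s) t s''"
     "t \<le> (N - l) * (b + 2) + 1" "I N s''" "vars s'' x = N"
    by blast
  from exec.Assign[OF lo(1), of x] have "exec w (Assign x lo) s 1 (set_var x l s)"
    using lo(2) by simp
  from exec.Seq[OF this *(1)] have "exec w (For x lo hi P) s (1 + t) s''"
    unfolding For_def .
  then show ?thesis by (rule wpI) (use * in simp)
qed

lemma wp_For_Var:
  assumes "\<And>i s'. l \<le> i \<Longrightarrow> i < N \<Longrightarrow> I i s' \<Longrightarrow> vars s' x = i \<Longrightarrow> loop_frame x P s s' \<Longrightarrow>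
      wp w P (\<lambda>t s''. t \<le> b \<and> I (Suc i) (set_var x (Suc i) s'')) s'"
    and "fits w lo s" "eval lo s = l" "l \<le> N" "I l (set_var x l s)"
    and y: "vars s y = N" "y \<notin> insert x (wvars P)" and "x \<notin> wvars P" "N < 2 ^ w" "w > 0"
  shows "wp w (For x lo (Var y) P) (\<lambda>t s'. t \<le> (N - l) * (b + 2) + 2 \<and> I N s' \<and> vars s' x = N) s"
proof (rule wp_For[where I = I])
  show "wp w P (\<lambda>t s''. t \<le> b \<and> I (Suc i) (set_var x (Suc i) s'')) s'"
    if "l \<le> i" "i < N" "I i s'" "vars s' x = i" "loop_frame x P s s'" for i s'
    by (rule assms(1)) (fact that)+
  show "fits w (Var y) s' \<and> eval (Var y) s' = N" if "loop_frame x P s s'" for s'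
    using same_off_vars[OF that y(2)] y(1) by simp
qed (fact assms)+

section \<open>A lower bound for mimsup\<close>

text \<open>Distinctness bounds the set and the empty selection belongs to it, so the
  \<open>Max\<close> in \<open>mim\<close> is attained.\<close>

lemma finite_mim_set:
  assumes "finite (rows M)"
  shows "finite {r. \<exists>rs cs. length rs = r \<and> length cs = r \<and> distinct rs \<and> distinct cs \<and>
     set rs \<subseteq> rows M \<and> set cs \<subseteq> cols M \<and>
     (\<forall>i<r. \<forall>j<r. entry M (rs ! i) (cs ! j) = (if i = j then 1 else 0))}" (is "finite ?S")
    and "mim M \<le> card (rows M)"
proof -
  have le: "r \<le> card (rows M)" if "r \<in> ?S" for r
    using that assms by (auto simp: distinct_card[symmetric] intro: card_mono)
  then show fin: "finite ?S" by (meson finite_nat_set_iff_bounded_le)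
  have "0 \<in> ?S" by auto
  then have "?S \<noteq> {}" by blast
  with fin have "mim M \<in> ?S" unfolding mim_def by (rule Max_in)
  then show "mim M \<le> card (rows M)" by (rule le)
qed

lemma mim_ge:
  assumes "finite (rows M)" "length cs = length rs" "distinct rs" "distinct cs"
    "set rs \<subseteq> rows M" "set cs \<subseteq> cols M"
    "\<And>i j. i < length rs \<Longrightarrow> j < length rs \<Longrightarrow> entry M (rs ! i) (cs ! j) = (if i = j then 1 else 0)"
  shows "length rs \<le> mim M"
  unfolding mim_def
  by (rule Max_ge[OF finite_mim_set(1)[OF assms(1)]], rule CollectI, rule exI[of _ rs], rule exI[of _ cs])
    (use assms in simp)

text \<open>
  Sequences over a half-induced matching that have the same index sum are compared pointwise by
  a triangular matrix, so two different ones never have a nonzero entry.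
\<close>

lemma mim_kronecker_power_ge:
  fixes a :: "nat \<Rightarrow> 'r" and b :: "nat \<Rightarrow> 'c"
  assumes fin: "finite (rows M)"
    and mem: "\<And>i. i < d \<Longrightarrow> a i \<in> rows M \<and> b i \<in> cols M \<and> entry M (a i) (b i) = 1"
    and tri: "\<And>i j. i < j \<Longrightarrow> j < d \<Longrightarrow> entry M (a i) (b j) = 0"
  shows "d ^ k \<le> mim (kronecker_power M k) * (k * d + 1)"
proof -
  define L where "L = {x. set x \<subseteq> {..<d} \<and> length x = k}"
  have finL: "finite L" unfolding L_def by (intro finite_lists_length_eq) simp
  have cardL: "card L = d ^ k" unfolding L_def by (subst card_lists_length_eq) auto
  define C where "C v = {x \<in> L. sum_list x = v}" for v
  have "card (C v) \<le> mim (kronecker_power M k)" for v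
  proof -
    have "finite (C v)" using finL by (simp add: C_def)
    then obtain xs where xs: "set xs = C v" "distinct xs" using finite_distinct_list by blast
    have inj: "inj_on a {..<d}" "inj_on b {..<d}"
    proof -
      \<comment> \<open>The entry at \<open>(a i, b j)\<close> is 0, whereas its row and its column
        each contain a diagonal entry 1.\<close>
      have "a i \<noteq> a j \<and> b i \<noteq> b j" if "i < j" "j < d" for i j
        using mem[of i] mem[of j] tri[OF that] that by auto
      then show "inj_on a {..<d}" "inj_on b {..<d}"
        by (auto intro!: linorder_inj_onI')
    qed
    have injm: "inj_on (map a) L" "inj_on (map b) L"
      unfolding L_def using inj by (auto intro!: inj_onI dest!: map_inj_on simp: inj_on_def subset_iff)
    have CL: "C v \<subseteq> L" by (auto simp: C_def)
    have "length (map (map a) xs) \<le> mim (kronecker_power M k)"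
    proof (rule mim_ge[where cs = "map (map b) xs"])
      have *: "rows (kronecker_power M k) = {xs. set xs \<subseteq> rows M \<and> length xs = k}"
        by (auto simp: kronecker_power_def)
      show "finite (rows (kronecker_power M k))"
        unfolding * using fin by (rule finite_lists_length_eq)
      show "distinct (map (map a) xs)" "distinct (map (map b) xs)"
        using xs CL injm by (auto simp: distinct_map intro: inj_on_subset)
      show "set (map (map a) xs) \<subseteq> rows (kronecker_power M k)"
        unfolding * using mem by (auto simp: xs(1) C_def L_def subset_iff)
      show "set (map (map b) xs) \<subseteq> cols (kronecker_power M k)"
        using mem by (auto simp: xs(1) C_def L_def kronecker_power_def subset_iff)
      fix i j assume ij: "i < length (map (map a) xs)" "j < length (map (map a) xs)"
      define x y where "x = xs ! i" and "y = xs ! j"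
      have xy: "x \<in> C v" "y \<in> C v" using ij nth_mem[of i xs] nth_mem[of j xs] xs(1) by (simp_all add: x_def y_def)
      then have len: "length x = k" "length y = k" and sub: "set x \<subseteq> {..<d}" "set y \<subseteq> {..<d}"
        by (simp_all add: C_def L_def)
      have lt: "x ! l < d \<and> y ! l < d" if "l < k" for l
        using that len subsetD[OF sub(1) nth_mem, of l] subsetD[OF sub(2) nth_mem, of l] by simp
      have sums: "(\<Sum>l<k. x ! l) = (\<Sum>l<k. y ! l)"
        using xy len by (simp add: C_def sum_list_sum_nth atLeast0LessThan)
      have "entry (kronecker_power M k) (map (map a) xs ! i) (map (map b) xs ! j) =
          (\<Prod>l<k. entry M (a (x ! l)) (b (y ! l)))"
        using ij len by (simp add: kronecker_power_def x_def y_def)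
      also have "\<dots> = (if i = j then 1 else 0)"
      proof (cases "i = j")
        case True
        then have "x = y" by (simp add: x_def y_def)
        then show ?thesis using True lt mem by simp
      next
        case False
        then have "x \<noteq> y" using xs ij by (simp add: x_def y_def nth_eq_iff_index_eq)
        then obtain l where l: "l < k" "x ! l \<noteq> y ! l" using len by (metis nth_equalityI)
        \<comment> \<open>If \<open>x\<close> were at least \<open>y\<close> everywhere, the strict
          inequality at \<open>l\<close> would contradict the equal sums. A position with
          \<open>x ! l < y ! l\<close> contributes a zero factor by \<open>tri\<close>.\<close>
        have "\<exists>l<k. x ! l < y ! l"
        proof (rule ccontr)
          assume "\<not> ?thesis"
          then have ge: "\<And>l. l < k \<Longrightarrow> y ! l \<le> x ! l" by force
          have "(\<Sum>l<k. y ! l) < (\<Sum>l<k. x ! l)"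
            by (rule sum_strict_mono_ex1) (use ge l in \<open>auto intro!: bexI[of _ l] le_neq_trans\<close>)
          then show False using sums by simp
        qed
        then show ?thesis using False tri lt by auto
      qed
      finally show "entry (kronecker_power M k) (map (map a) xs ! i) (map (map b) xs ! j) = (if i = j then 1 else 0)" .
    qed simp
    then show ?thesis using distinct_card[OF xs(2)] xs(1) by simp
  qed
  \<comment> \<open>Double counting: the index sum takes at most \<open>k * d + 1\<close> values,
    and each class is an induced matching.\<close>
  then have "(\<Sum>v\<le>k * d. card (C v)) \<le> of_nat (card {..k * d}) * mim (kronecker_power M k)"
    by (intro sum_bounded_above) simp
  moreover have "card L = (\<Sum>v\<le>k * d. card (C v))"
  proof -
    have "sum_list x \<le> k * d" if "x \<in> L" for x
    proof -
      have "sum_list x = (\<Sum>l<k. x ! l)"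
        using that by (simp add: L_def sum_list_sum_nth atLeast0LessThan)
      also have "\<dots> \<le> of_nat (card {..<k}) * d"
        by (rule sum_bounded_above) (use that in \<open>auto simp: L_def subset_iff intro!: less_imp_le\<close>)
      finally show ?thesis by simp
    qed
    then have "L = (\<Union>v\<in>{..k * d}. C v)" by (auto simp: C_def)
    then have "card L = card (\<Union>v\<in>{..k * d}. C v)" by simp
    also have "\<dots> = (\<Sum>v\<le>k * d. card (C v))"
      using finL by (intro card_UN_disjoint) (auto simp: C_def)
    finally show ?thesis .
  qed
  ultimately show ?thesis using cardL by (simp add: mult.commute)
qed

text \<open>The loss \<open>k * d + 1\<close> of the previous lemma is at most
  \<open>k * (d + 1)\<close>, and the k-th roots of both factors tend to 1.\<close>

lemma mimsup_ge:
  fixes a :: "nat \<Rightarrow> 'r" and b :: "nat \<Rightarrow> 'c"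
  assumes fin: "finite (rows M)"
    and mem: "\<And>i. i < d \<Longrightarrow> a i \<in> rows M \<and> b i \<in> cols M \<and> entry M (a i) (b i) = 1"
    and tri: "\<And>i j. i < j \<Longrightarrow> j < d \<Longrightarrow> entry M (a i) (b j) = 0"
  shows "real d \<le> mimsup M"
proof -
  define f where "f k = root k (real (mim (kronecker_power M k)))" for k
  define g where "g k = real d / (root k (real k) * root k (real (d + 1)))" for k
  have gf: "g k \<le> f k" if "k > 0" for k
  proof -
    have "d ^ k \<le> mim (kronecker_power M k) * (k * d + 1)"
      by (rule mim_kronecker_power_ge) (use assms in blast)+
    also have "\<dots> \<le> mim (kronecker_power M k) * (k * (d + 1))" using that by (intro mult_le_mono2) simp
    finally have "real d ^ k \<le> real (mim (kronecker_power M k)) * (real k * real (d + 1))"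
      by (metis of_nat_le_iff of_nat_mult of_nat_power)
    then have "root k (real d ^ k) \<le> root k (real (mim (kronecker_power M k)) * (real k * real (d + 1)))"
      using that by (simp add: real_root_le_mono)
    then have "real d \<le> f k * (root k (real k) * root k (real (d + 1)))"
      using that by (simp add: real_root_power_cancel real_root_mult f_def)
    moreover have "root k (real k) * root k (real (d + 1)) > 0"
      using that by simp
    ultimately show ?thesis by (simp add: g_def pos_divide_le_eq)
  qed
  have "(\<lambda>k. real d / (root k (real k) * root k (real (d + 1)))) \<longlonglongrightarrow> real d / (1 * 1)"
    by (intro tendsto_intros LIMSEQ_root LIMSEQ_root_const) auto
  then have "(\<lambda>k. ereal (g k)) \<longlonglongrightarrow> ereal (real d)"
    unfolding g_def by simp
  then have "limsup (\<lambda>k. ereal (g k)) = ereal (real d)"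
    by (rule lim_imp_Limsup[rotated]) simp
  moreover have "limsup (\<lambda>k. ereal (g k)) \<le> limsup (\<lambda>k. ereal (f k))"
    by (rule Limsup_mono, rule eventually_mono[OF eventually_gt_at_top[of 0]]) (use gf in simp)
  \<comment> \<open>A finite upper bound is needed because \<open>real_of_ereal\<close> would send
    an infinite limsup to 0.\<close>
  moreover have "limsup (\<lambda>k. ereal (f k)) \<le> ereal (real (card (rows M)))"
  proof (rule Limsup_bounded)
    have "f k \<le> real (card (rows M))" if "k > 0" for k
    proof -
      have *: "rows (kronecker_power M k) = {xs. set xs \<subseteq> rows M \<and> length xs = k}"
        by (auto simp: kronecker_power_def)
      have "mim (kronecker_power M k) \<le> card (rows M) ^ k"
        using finite_mim_set(2)[of "kronecker_power M k"] fin
        by (simp add: * finite_lists_length_eq card_lists_length_eq)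
      then have "real (mim (kronecker_power M k)) \<le> real (card (rows M)) ^ k"
        by (metis of_nat_le_iff of_nat_power)
      then have "f k \<le> root k (real (card (rows M)) ^ k)"
        unfolding f_def using that by (simp add: real_root_le_mono)
      then show ?thesis using that by (simp add: real_root_power_cancel)
    qed
    then show "\<forall>\<^sub>F k in sequentially. ereal (f k) \<le> ereal (real (card (rows M)))"
      by (intro eventually_mono[OF eventually_gt_at_top[of 0]]) simp
  qed
  ultimately have "ereal (real d) \<le> limsup (\<lambda>k. ereal (f k))" "limsup (\<lambda>k. ereal (f k)) \<le> ereal (real (card (rows M)))"
    by auto
  then show ?thesis unfolding mimsup_def f_def[symmetric]
    by (cases "limsup (\<lambda>k. ereal (f k))") auto
qed

section \<open>Representative sets of rows\<close>

definition compat :: "(nat \<Rightarrow> nat \<Rightarrow> bool) \<Rightarrow> nat list \<Rightarrow> nat list \<Rightarrow> bool" where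
  "compat A r y \<longleftrightarrow> list_all2 A r y"

text \<open>The third conjunct makes \<open>Y\<close> the pool for later columns: it avoids the
  neighbours of all rows chosen so far, so any edge into \<open>Y\<close> prolongs the matching.
  With \<open>Y = {}\<close> only the matching of size \<open>l\<close> remains.\<close>

definition half_induced :: "(nat \<Rightarrow> nat \<Rightarrow> bool) \<Rightarrow> nat \<Rightarrow> nat set \<Rightarrow> bool" where
  "half_induced A l Y \<longleftrightarrow> (\<exists>a b. (\<forall>i<l. A (a i) (b i)) \<and> (\<forall>i j. i < j \<longrightarrow> j < l \<longrightarrow> \<not> A (a i) (b j)) \<and>
     (\<forall>i<l. \<forall>y\<in>Y. \<not> A (a i) y))"

lemma half_induced_0: "half_induced A 0 Y"
  by (simp add: half_induced_def)

lemma half_induced_mono: "half_induced A l Y \<Longrightarrow> Y' \<subseteq> Y \<Longrightarrow> half_induced A l Y'"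
  unfolding half_induced_def by (elim exE, rule exI, rule exI) auto

text \<open>As a member of the pool, \<open>c\<close> is missed by all earlier rows; removing the
  neighbours of \<open>x\<close> from the pool restores the third conjunct.\<close>

lemma half_induced_Suc:
  assumes "half_induced A l Y" "c \<in> Y" "A x c"
  shows "half_induced A (Suc l) {y \<in> Y. \<not> A x y}"
proof -
  from assms(1) obtain a b where ab: "(\<forall>i<l. A (a i) (b i)) \<and>
      (\<forall>i j. i < j \<longrightarrow> j < l \<longrightarrow> \<not> A (a i) (b j)) \<and> (\<forall>i<l. \<forall>y\<in>Y. \<not> A (a i) y)"
    unfolding half_induced_def by (elim exE)
  show ?thesis unfolding half_induced_def
    by (rule exI[of _ "a(l := x)"], rule exI[of _ "b(l := c)"]) (use ab assms(2,3) in \<open>auto simp: less_Suc_eq\<close>)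
qed

text \<open>Equivalently, no column in the box with sides \<open>Y j\<close> is compatible with
  \<open>r\<close>, since its coordinates can be chosen independently.\<close>

definition blocked :: "(nat \<Rightarrow> nat \<Rightarrow> bool) \<Rightarrow> nat \<Rightarrow> (nat \<Rightarrow> nat set) \<Rightarrow> nat list \<Rightarrow> bool" where
  "blocked A m Y r \<longleftrightarrow> (\<exists>j<m. \<forall>b\<in>Y j. \<not> A (r ! j) b)"

text \<open>Boxes shrink along the tree, so a row rejected at a node stays rejected at all nodes
  below it.\<close>

lemma blocked_mono: "blocked A m Y r \<Longrightarrow> (\<And>j. j < m \<Longrightarrow> Y' j \<subseteq> Y j) \<Longrightarrow> blocked A m Y' r"
  unfolding blocked_def by blast

text \<open>
  The search tree has nodes \<open>0..<cnt\<close>. A filled node carries a row from \<open>R\<close> and has m children;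
  the columns of child \<open>l\<close> are those of the parent that the parent's row misses in coordinate \<open>l\<close>.
  The ghost function \<open>\<pi>\<close> gives the path from the root to a node.
\<close>

definition paths_inv ::
  "(nat \<Rightarrow> nat \<Rightarrow> bool) \<Rightarrow> nat \<Rightarrow> nat \<Rightarrow> (nat \<Rightarrow> bool) \<Rightarrow> (nat \<Rightarrow> nat \<Rightarrow> nat set) \<Rightarrow> (nat \<Rightarrow> nat list) \<Rightarrow> bool" where
  "paths_inv A m cnt fl Y \<pi> \<longleftrightarrow>
     inj_on \<pi> {..<cnt} \<and> (\<forall>p<cnt. set (\<pi> p) \<subseteq> {..<m}) \<and>
     (\<forall>p<cnt. \<forall>j<m. if fl p then half_induced A (Suc (count_list (\<pi> p) j)) {}
        else half_induced A (count_list (\<pi> p) j) (Y p j)) \<and>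
     (\<forall>p<cnt. \<forall>q l. \<pi> p = q @ [l] \<longrightarrow> (\<exists>p'<cnt. fl p' \<and> \<pi> p' = q))"

text \<open>The second conjunct guarantees sufficiency: a column not yet served by a stored row
  still lies in the box of an unfilled node. The last three conjuncts serve to bound the number of
  stored rows.\<close>

definition tree_inv ::
  "(nat \<Rightarrow> nat \<Rightarrow> bool) \<Rightarrow> nat \<Rightarrow> nat \<Rightarrow> nat list set \<Rightarrow> nat \<Rightarrow> (nat \<Rightarrow> bool) \<Rightarrow> (nat \<Rightarrow> nat \<Rightarrow> nat set) \<Rightarrow> nat list list \<Rightarrow> bool" where
  "tree_inv A h m S cnt fl Y R \<longleftrightarrow>
     set R \<subseteq> S \<and>
     (\<forall>y. length y = m \<longrightarrow> set y \<subseteq> {..<h} \<longrightarrow>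
        (\<exists>r\<in>set R. compat A r y) \<or> (\<exists>p<cnt. \<not> fl p \<and> (\<forall>j<m. y ! j \<in> Y p j))) \<and>
     cnt = 1 + m * length R \<and>
     length R = card {p. p < cnt \<and> fl p} \<and>
     (\<exists>\<pi>. paths_inv A m cnt fl Y \<pi>)"

lemma tree_invD:
  assumes "tree_inv A h m S cnt fl Y R"
  shows "set R \<subseteq> S"
    and "\<And>y. length y = m \<Longrightarrow> set y \<subseteq> {..<h} \<Longrightarrow>
        (\<exists>r\<in>set R. compat A r y) \<or> (\<exists>p<cnt. \<not> fl p \<and> (\<forall>j<m. y ! j \<in> Y p j))"
    and "cnt = 1 + m * length R"
    and "length R = card {p. p < cnt \<and> fl p}"
    and "\<exists>\<pi>. paths_inv A m cnt fl Y \<pi>"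
proof -
  note inv = assms[unfolded tree_inv_def]
  show "set R \<subseteq> S" by (rule inv[THEN conjunct1])
  show "(\<exists>r\<in>set R. compat A r y) \<or> (\<exists>p<cnt. \<not> fl p \<and> (\<forall>j<m. y ! j \<in> Y p j))"
    if "length y = m" "set y \<subseteq> {..<h}" for y
    by (rule inv[THEN conjunct2, THEN conjunct1, rule_format, OF that])
  show "cnt = 1 + m * length R"
    by (rule inv[THEN conjunct2, THEN conjunct2, THEN conjunct1])
  show "length R = card {p. p < cnt \<and> fl p}"
    by (rule inv[THEN conjunct2, THEN conjunct2, THEN conjunct2, THEN conjunct1])
  show "\<exists>\<pi>. paths_inv A m cnt fl Y \<pi>"
    by (rule inv[THEN conjunct2, THEN conjunct2, THEN conjunct2, THEN conjunct2])
qed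

lemma tree_inv_init:
  assumes "\<And>j. j < m \<Longrightarrow> Y 0 j = {..<h}" "\<not> fl 0"
  shows "tree_inv A h m {} 1 fl Y []"
proof -
  have "paths_inv A m 1 fl Y (\<lambda>_. [])"
    using assms by (simp add: paths_inv_def half_induced_0 inj_on_def)
  then have "\<exists>\<pi>. paths_inv A m 1 fl Y \<pi>" by (rule exI[of "paths_inv A m 1 fl Y"])
  then show ?thesis
    unfolding tree_inv_def using assms by (auto simp: subset_iff)
qed

lemma tree_inv_superset: "tree_inv A h m S cnt fl Y R \<Longrightarrow> S \<subseteq> S' \<Longrightarrow> tree_inv A h m S' cnt fl Y R"
  unfolding tree_inv_def by blast

text \<open>A column in the box of \<open>p\<close> is either compatible with \<open>r\<close> or
  fails in some coordinate \<open>l\<close>, and then it lies in the box of child \<open>l\<close>.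
  So filling \<open>p\<close> keeps all columns covered.\<close>

lemma tree_inv_fill:
  assumes inv: "tree_inv A h m S cnt fl Y R"
    and r: "r \<in> S" "length r = m"
    and p: "p < cnt" "\<not> fl p" "\<not> blocked A m (Y p) r"
    and fl': "\<And>q. q < cnt \<Longrightarrow> fl' q \<longleftrightarrow> fl q \<or> q = p" "\<And>l. l < m \<Longrightarrow> \<not> fl' (cnt + l)"
    and Y': "\<And>q j. q < cnt \<Longrightarrow> j < m \<Longrightarrow> Y' q j = Y q j"
      "\<And>l j. l < m \<Longrightarrow> j < m \<Longrightarrow> Y' (cnt + l) j = (if j = l then {b \<in> Y p j. \<not> A (r ! j) b} else Y p j)"
  shows "tree_inv A h m S (cnt + m) fl' Y' (R @ [r])"
proof -
  note RS = tree_invD(1)[OF inv] and cov = tree_invD(2)[OF inv] and cnt = tree_invD(3)[OF inv]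
    and cR = tree_invD(4)[OF inv]
  obtain \<pi> where "paths_inv A m cnt fl Y \<pi>"
    using tree_invD(5)[OF inv] by (elim exE)
  then have inj: "inj_on \<pi> {..<cnt}"
    and sub: "\<And>p. p < cnt \<Longrightarrow> set (\<pi> p) \<subseteq> {..<m}"
    and half: "\<And>p j. p < cnt \<Longrightarrow> j < m \<Longrightarrow> if fl p then half_induced A (Suc (count_list (\<pi> p) j)) {}
                  else half_induced A (count_list (\<pi> p) j) (Y p j)"
    and par: "\<And>p q l. p < cnt \<Longrightarrow> \<pi> p = q @ [l] \<Longrightarrow> \<exists>p'<cnt. fl p' \<and> \<pi> p' = q"
    by (simp_all add: paths_inv_def)
  define \<pi>' where "\<pi>' q = (if q < cnt then \<pi> q else \<pi> p @ [q - cnt])" for q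
  have split: "q < cnt \<or> (\<exists>l<m. q = cnt + l)" if "q < cnt + m" for q
    using that by (metis add_less_cancel_left le_Suc_ex not_less)
  \<comment> \<open>A node with this path would have a filled parent with path
    \<open>\<pi> p\<close>, which by injectivity is \<open>p\<close> itself; but \<open>p\<close> is
    unfilled.\<close>
  have new: "\<pi> q \<noteq> \<pi> p @ [l]" if "q < cnt" for q l
    using par[OF that, of "\<pi> p" l] inj p by (metis inj_onD lessThan_iff)
  have nb: "\<exists>b\<in>Y p j. A (r ! j) b" if "j < m" for j
    using p(3) that unfolding blocked_def by blast
  have halfp: "half_induced A (count_list (\<pi> p) j) (Y p j)" if "j < m" for j
    using half[OF p(1) that] p(2) by simp
  \<comment> \<open>Since \<open>r\<close> is not blocked, the matching grows in every coordinate.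
    The now filled node \<open>p\<close> records this growth everywhere; child \<open>l\<close> uses
    it only in coordinate \<open>l\<close>, the one appended to its path.\<close>
  have halfS: "half_induced A (Suc (count_list (\<pi> p) j)) {b \<in> Y p j. \<not> A (r ! j) b}" if "j < m" for j
    using nb[OF that] half_induced_Suc[OF halfp[OF that]] by blast
  have 1: "set (R @ [r]) \<subseteq> S" using RS r by simp
  have 2: "(\<exists>r'\<in>set (R @ [r]). compat A r' y) \<or> (\<exists>q<cnt + m. \<not> fl' q \<and> (\<forall>j<m. y ! j \<in> Y' q j))"
    if y: "length y = m" "set y \<subseteq> {..<h}" for y
  proof -
    consider "\<exists>r\<in>set R. compat A r y" | q where "q < cnt" "\<not> fl q" "\<forall>j<m. y ! j \<in> Y q j" "q \<noteq> p"
      | "\<forall>j<m. y ! j \<in> Y p j"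
      using cov[OF y] by blast
    then show ?thesis
    proof cases
      case 1
      then show ?thesis by auto
    next
      case 2
      then show ?thesis using fl'(1)[of q] Y'(1)[of q] by (auto intro!: exI[of _ q])
    next
      case 3
      show ?thesis
      proof (cases "compat A r y")
        case True
        then show ?thesis by auto
      next
        case False
        then obtain l where l: "l < m" "\<not> A (r ! l) (y ! l)"
          unfolding compat_def list_all2_conv_all_nth using r(2) y(1) by auto
        then have "\<forall>j<m. y ! j \<in> Y' (cnt + l) j" using 3 Y'(2)[OF l(1)] by auto
        then show ?thesis using l fl'(2) by (intro disjI2 exI[of _ "cnt + l"]) auto
      qed
    qed
  qed
  have 3: "cnt + m = 1 + m * length (R @ [r])" using cnt by simp
  have 4: "length (R @ [r]) = card {q. q < cnt + m \<and> fl' q}"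
  proof -
    have "{q. q < cnt + m \<and> fl' q} = insert p {q. q < cnt \<and> fl q}"
    proof (intro set_eqI iffI)
      fix q assume "q \<in> {q. q < cnt + m \<and> fl' q}"
      then show "q \<in> insert p {q. q < cnt \<and> fl q}" using split[of q] fl' by auto
    next
      fix q assume "q \<in> insert p {q. q < cnt \<and> fl q}"
      then show "q \<in> {q. q < cnt + m \<and> fl' q}" using fl'(1)[of q] p by auto
    qed
    then show ?thesis using cR p by simp
  qed
  have "inj_on \<pi>' {..<cnt + m}"
  proof (rule inj_onI)
    fix q q' assume q: "q \<in> {..<cnt + m}" "q' \<in> {..<cnt + m}" "\<pi>' q = \<pi>' q'"
    then show "q = q'"
      using inj_onD[OF inj, of q q'] new[of q "q' - cnt"] new[of q' "q - cnt"]
      by (auto simp: \<pi>'_def split: if_splits)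
  qed
  moreover have "set (\<pi>' q) \<subseteq> {..<m}" if "q < cnt + m" for q
    using split[OF that] sub[of q] sub[OF p(1)] by (auto simp: \<pi>'_def)
  moreover have "if fl' q then half_induced A (Suc (count_list (\<pi>' q) j)) {}
         else half_induced A (count_list (\<pi>' q) j) (Y' q j)" if "q < cnt + m" and j: "j < m" for q j
    using split[OF that(1)]
  proof (elim disjE exE conjE)
    assume q: "q < cnt"
    show ?thesis
      using half[OF q j] fl'(1)[OF q] Y'(1)[OF q j] q half_induced_mono[OF halfS[OF j], of "{}"]
      by (auto simp: \<pi>'_def split: if_splits)
  next
    fix l assume l: "l < m" "q = cnt + l"
    show ?thesis
      using halfS[OF j] halfp[OF j] Y'(2)[OF l(1) j] l fl'(2)[OF l(1)]
      by (cases "j = l") (simp_all add: \<pi>'_def)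
  qed
  moreover have "\<exists>p'<cnt + m. fl' p' \<and> \<pi>' p' = q'" if "q < cnt + m" and eq: "\<pi>' q = q' @ [l]" for q q' l
    using split[OF that(1)]
  proof (elim disjE exE conjE)
    assume q: "q < cnt"
    from eq q have "\<pi> q = q' @ [l]" by (simp add: \<pi>'_def)
    from par[OF q this] obtain p' where "p' < cnt" "fl p'" "\<pi> p' = q'" by blast
    then show ?thesis using fl'(1) by (intro exI[of _ p']) (simp add: \<pi>'_def)
  next
    fix l' assume l: "l' < m" "q = cnt + l'"
    then have "\<pi> p = q'" using eq by (simp add: \<pi>'_def)
    then show ?thesis using fl'(1)[OF p(1)] p(1) by (intro exI[of _ p]) (simp add: \<pi>'_def)
  qed
  ultimately have "paths_inv A m (cnt + m) fl' Y' \<pi>'"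
    unfolding paths_inv_def by simp
  then have "\<exists>\<pi>. paths_inv A m (cnt + m) fl' Y' \<pi>" by (rule exI[of "paths_inv A m (cnt + m) fl' Y'"])
  with 1 2 3 4 show ?thesis unfolding tree_inv_def by (intro conjI allI impI)
qed

text \<open>The column \<open>y\<close> cannot lie in the box of an unfilled node, because
  \<open>r\<close> is blocked there although it is compatible with \<open>y\<close>. So the coverage
  invariant leaves only a stored row.\<close>

lemma tree_inv_represents:
  assumes inv: "tree_inv A h m S cnt fl Y R"
    and bl: "\<And>p r. p < cnt \<Longrightarrow> \<not> fl p \<Longrightarrow> r \<in> S \<Longrightarrow> blocked A m (Y p) r"
    and r: "r \<in> S" "length r = m" "compat A r y"
    and A: "\<And>x y. A x y \<Longrightarrow> y < h"
  shows "\<exists>r'\<in>set R. compat A r' y"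
proof -
  from r(2,3) have len: "length y = m" and cy: "\<And>j. j < m \<Longrightarrow> A (r ! j) (y ! j)"
    unfolding compat_def list_all2_conv_all_nth by simp_all
  have "set y \<subseteq> {..<h}"
    using len A[OF cy] by (auto simp: set_conv_nth)
  from tree_invD(2)[OF inv len this] show ?thesis
  proof
    assume "\<exists>p<cnt. \<not> fl p \<and> (\<forall>j<m. y ! j \<in> Y p j)"
    then obtain p where p: "p < cnt" "\<not> fl p" "\<forall>j<m. y ! j \<in> Y p j" by (elim exE conjE)
    from bl[OF p(1,2) r(1)] obtain j where "j < m" "\<forall>b\<in>Y p j. \<not> A (r ! j) b"
      unfolding blocked_def by (elim exE conjE)
    then show ?thesis using p(3) cy by blast
  qed
qed

text \<open>At a filled node the matching of coordinate \<open>j\<close> is one larger than the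
  number of occurrences of \<open>j\<close> on the path, so \<open>j\<close> occurs at most
  \<open>d - 1\<close> times. Paths are distinct, hence filled nodes inject into the words of length
  at most \<open>K * (d - 1)\<close>.\<close>

lemma tree_inv_length_le:
  assumes inv: "tree_inv A h m S cnt fl Y R"
    and d: "\<And>l. half_induced A l {} \<Longrightarrow> l \<le> d"
    and m: "m \<le> K"
  shows "length R \<le> (\<Sum>t\<le>K * (d - 1). K ^ t)"
proof -
  obtain \<pi> where "paths_inv A m cnt fl Y \<pi>"
    using tree_invD(5)[OF inv] by (elim exE)
  then have inj: "inj_on \<pi> {..<cnt}"
    and sub: "\<And>p. p < cnt \<Longrightarrow> set (\<pi> p) \<subseteq> {..<m}"
    and half: "\<And>p j. p < cnt \<Longrightarrow> j < m \<Longrightarrow> fl p \<Longrightarrow> half_induced A (Suc (count_list (\<pi> p) j)) {}"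
    by (auto simp: paths_inv_def)
  let ?F = "{p. p < cnt \<and> fl p}"
  let ?L = "{xs. set xs \<subseteq> {..<K} \<and> length xs \<le> K * (d - 1)}"
  have "\<pi> p \<in> ?L" if p: "p < cnt" "fl p" for p
  proof -
    have "length (\<pi> p) = (\<Sum>j<m. count_list (\<pi> p) j)"
      using sub[OF p(1)] by (simp add: sum_count_set)
    also have "\<dots> \<le> of_nat (card {..<m}) * (d - 1)"
      by (rule sum_bounded_above) (use half[OF p(1) _ p(2)] d in \<open>fastforce\<close>)
    also have "\<dots> \<le> K * (d - 1)" using m by simp
    finally show ?thesis using sub[OF p(1)] m by auto
  qed
  then have "card ?F \<le> card ?L"
    by (intro card_inj_on_le[of \<pi>]) (auto intro: inj_on_subset[OF inj] finite_lists_length_le)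
  also have "\<dots> = (\<Sum>t\<le>K * (d - 1). K ^ t)"
    by (subst card_lists_length_le) auto
  finally show ?thesis using tree_invD(4)[OF inv] by simp
qed

text \<open>Two regimes share one bound: for \<open>K = 1\<close> there are \<open>d\<close> terms
  equal to 1, which accounts for the factor \<open>h\<close>; for larger \<open>K\<close> the sum is
  at most twice its last term.\<close>

lemma geometric_sum_le:
  fixes K d h :: nat
  assumes "K \<ge> 1" "1 \<le> d" "d \<le> h"
  shows "(\<Sum>t\<le>K * (d - 1). K ^ t) \<le> 2 * h * K ^ (K * (d - 1))"
proof (cases "K = 1")
  case True
  then show ?thesis using assms by simp
next
  case False
  have "(\<Sum>t\<le>n. K ^ t) \<le> 2 * K ^ n" for n
  proof (induction n)
    case (Suc n)
    have "(\<Sum>t\<le>Suc n. K ^ t) \<le> 2 * K ^ n + K ^ Suc n" using Suc by simp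
    also have "2 * K ^ n \<le> K ^ Suc n" using assms False by simp
    finally show ?case by simp
  qed simp
  also have "2 * K ^ (K * (d - 1)) \<le> 2 * h * K ^ (K * (d - 1))" using assms by simp
  finally show ?thesis .
qed

section \<open>Cuts of an ordered graph\<close>

locale ordered_graph =
  fixes G :: "nat graph" and vs :: "nat list" and adj :: "nat list list"
  assumes G: "simple_graph G" and ord: "linear_ordering G vs" and adj: "adj_lists G adj"
begin

definition adjG :: "nat \<Rightarrow> nat \<Rightarrow> bool" where
  "adjG u v \<longleftrightarrow> {u, v} \<in> edges G"

lemma adjG_sym: "adjG u v \<Longrightarrow> adjG v u"
  by (simp add: adjG_def insert_commute)

lemma adjG_irrefl: "\<not> adjG u u"
  using G by (auto simp: adjG_def simple_graph_def)

lemma set_vs: "set vs = {0..<length adj}" and distinct_vs: "distinct vs"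
  using ord adj by (auto simp: linear_ordering_def adj_lists_def)

lemma length_vs: "length vs = length adj"
  using distinct_card[OF distinct_vs] set_vs by simp

lemma adjG_lt: "adjG u v \<Longrightarrow> u < length adj \<and> v < length adj"
  using G adj by (auto simp: adjG_def simple_graph_def adj_lists_def)

lemma nth_vs_lt: "i < length adj \<Longrightarrow> vs ! i < length adj"
  using set_vs length_vs nth_mem[of i vs] by auto

lemma adj_nth: "u < length adj \<Longrightarrow> distinct (adj ! u) \<and> set (adj ! u) = {v. adjG u v}"
  using adj by (auto simp: adj_lists_def adjG_def)

abbreviation later :: "nat \<Rightarrow> nat list" where
  "later i \<equiv> filter (\<lambda>u. u \<notin> set (take (Suc i) vs)) (adj ! (vs ! i))"

text \<open>A list rather than a set, because the order of the edges fixes the coordinates of rows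
  and columns. It is the order that the program produces: surviving edges first, then the new ones
  in adjacency list order.\<close>

fun cut :: "nat \<Rightarrow> (nat \<times> nat) list" where
  "cut 0 = []"
| "cut (Suc i) = filter (\<lambda>e. snd e \<noteq> vs ! i) (cut i) @ map (Pair (vs ! i)) (later i)"

lemma nth_notin_take: "i < length vs \<Longrightarrow> vs ! i \<notin> set (take i vs)"
  using distinct_vs by (auto simp: in_set_conv_nth nth_eq_iff_index_eq)

lemma set_take_Suc: "i < length vs \<Longrightarrow> set (take (Suc i) vs) = insert (vs ! i) (set (take i vs))"
  by (simp add: take_Suc_conv_app_nth)

lemma cut_spec:
  "i \<le> length vs \<Longrightarrow> distinct (cut i) \<and>
     set (cut i) = {(u, v). u \<in> set (take i vs) \<and> v \<notin> set (take i vs) \<and> adjG u v}"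
proof (induction i)
  case (Suc i)
  then have i: "i < length vs" by simp
  have IH: "distinct (cut i)" "set (cut i) = {(u, v). u \<in> set (take i vs) \<and> v \<notin> set (take i vs) \<and> adjG u v}"
    using Suc by simp_all
  have av: "distinct (adj ! (vs ! i))" "set (adj ! (vs ! i)) = {v. adjG (vs ! i) v}"
    using adj_nth[OF nth_vs_lt] i length_vs by simp_all
  have s: "set (cut (Suc i)) = {e \<in> set (cut i). snd e \<noteq> vs ! i} \<union> Pair (vs ! i) ` {v. adjG (vs ! i) v \<and> v \<notin> set (take (Suc i) vs)}"
    by (auto simp: av)
  have "distinct (cut (Suc i))"
    using IH(1) av(1) nth_notin_take[OF i] by (auto simp: distinct_map inj_on_def IH(2))
  moreover have "set (cut (Suc i)) = {(u, v). u \<in> set (take (Suc i) vs) \<and> v \<notin> set (take (Suc i) vs) \<and> adjG u v}"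
    unfolding s IH(2) set_take_Suc[OF i] by auto
  ultimately show ?case by blast
qed simp

text \<open>Orienting cut edges from left to right loses nothing, so inside the ordering this is a
  count of \<open>cut_edges\<close>. The two outermost cuts, which \<open>width\<close> does not
  range over, are empty.\<close>

lemma length_cut_le:
  assumes "i \<le> length vs"
  shows "length (cut i) \<le> width G vs"
proof (cases "1 \<le> i \<and> i < length vs")
  case True
  let ?f = "\<lambda>e. {fst e, snd e}"
  have inj: "inj_on ?f (set (cut i))"
    using cut_spec[OF assms] by (auto simp: inj_on_def doubleton_eq_iff)
  have "?f ` set (cut i) \<subseteq> cut_edges G vs i"
  proof
    fix e assume "e \<in> ?f ` set (cut i)"
    then obtain u v where e: "e = {u, v}" "u \<in> set (take i vs)" "v \<notin> set (take i vs)" "adjG u v"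
      using cut_spec[OF assms] by auto
    have "v \<in> set vs" using adjG_lt[OF e(4)] set_vs by simp
    then have "v \<in> set (drop i vs)" using e(3) by (metis Un_iff append_take_drop_id set_append)
    then show "e \<in> cut_edges G vs i" using e by (auto simp: cut_edges_def adjG_def)
  qed
  moreover have "finite (cut_edges G vs i)"
  proof (rule finite_subset)
    show "cut_edges G vs i \<subseteq> Pow (verts G)" using G by (auto simp: cut_edges_def simple_graph_def)
    show "finite (Pow (verts G))" using G by (auto simp: simple_graph_def)
  qed
  ultimately have "card (?f ` set (cut i)) \<le> card (cut_edges G vs i)"
    by (intro card_mono)
  then have "card (set (cut i)) \<le> card (cut_edges G vs i)"
    by (simp only: card_image[OF inj])
  also have "\<dots> \<le> width G vs"
    unfolding width_def using True by (intro Max_ge) auto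
  finally show ?thesis using distinct_card[of "cut i"] cut_spec[OF assms] by metis
next
  case False
  then have "i = 0 \<or> i = length vs" using assms by auto
  then have "set (cut i) = {}"
  proof
    assume "i = length vs"
    then show ?thesis using cut_spec[OF assms] adjG_lt set_vs by auto
  qed simp
  then show ?thesis by simp
qed

text \<open>Every edge at \<open>u\<close> crosses the cut just before or just after
  \<open>u\<close>. Thus reading the adjacency list of a vertex costs no more than handling a
  cut.\<close>

lemma length_adj_le:
  assumes "u < length adj"
  shows "length (adj ! u) \<le> 2 * width G vs"
proof -
  obtain i where i: "i < length vs" "vs ! i = u"
    using assms set_vs by (metis atLeastLessThan_iff in_set_conv_nth le0)
  have "set (adj ! u) \<subseteq> fst ` set (cut i) \<union> snd ` set (cut (Suc i))"
  proof
    fix v assume "v \<in> set (adj ! u)"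
    then have a: "adjG u v" using adj_nth[OF assms] by simp
    show "v \<in> fst ` set (cut i) \<union> snd ` set (cut (Suc i))"
    proof (cases "v \<in> set (take i vs)")
      case True
      then have "(v, u) \<in> set (cut i)"
        using cut_spec[of i] i nth_notin_take adjG_sym[OF a] by auto
      then show ?thesis by force
    next
      case False
      then have "(u, v) \<in> set (cut (Suc i))"
        using cut_spec[of "Suc i"] i a adjG_irrefl set_take_Suc[OF i(1)] by auto
      then show ?thesis by force
    qed
  qed
  then have "card (set (adj ! u)) \<le> card (fst ` set (cut i) \<union> snd ` set (cut (Suc i)))"
    by (intro card_mono) auto
  also have "\<dots> \<le> card (fst ` set (cut i)) + card (snd ` set (cut (Suc i)))" by (rule card_Un_le)
  also have "\<dots> \<le> length (cut i) + length (cut (Suc i))"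
    by (intro add_mono order.trans[OF card_image_le card_length] finite_set)
  also have "\<dots> \<le> 2 * width G vs"
    using length_cut_le[of i] length_cut_le[of "Suc i"] i by simp
  finally show ?thesis using distinct_card[of "adj ! u"] adj_nth[OF assms] by metis
qed

end

section \<open>The dynamic programming step\<close>

lemma compat_map:
  "compat A (map f xs) (map g xs) \<longleftrightarrow> (\<forall>e\<in>set xs. A (f e) (g e))"
  by (simp add: compat_def list_all2_map1 list_all2_map2 list_all2_same)

lemma filter_zip_map:
  "map fst (filter (\<lambda>(a, e). P e) (zip (map f xs) xs)) = map f (filter P xs)"
  by (induction xs) auto

text \<open>Used to turn a column, given by positions, into a function on the cut edges.\<close>

lemma distinct_list_eq_map:
  assumes "distinct xs" "length ys = length xs"
  obtains g where "ys = map g xs"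
proof -
  have "ys = map (\<lambda>x. ys ! (THE i. i < length xs \<and> xs ! i = x)) xs"
  proof (rule nth_equalityI)
    fix i assume "i < length ys"
    moreover then have "(THE j. j < length xs \<and> xs ! j = xs ! i) = i"
      using assms by (intro the_equality) (auto simp: nth_eq_iff_index_eq)
    ultimately show "ys ! i = map (\<lambda>x. ys ! (THE i. i < length xs \<and> xs ! i = x)) xs ! i"
      using assms by simp
  qed (use assms in simp)
  then show thesis by (rule that)
qed

locale hom_problem = ordered_graph +
  fixes H :: "nat graph" and h :: nat
  assumes H: "simple_graph H" and verts_H: "verts H = {0..<h}"
begin

definition adjH :: "nat \<Rightarrow> nat \<Rightarrow> bool" where
  "adjH a b \<longleftrightarrow> {a, b} \<in> edges H"

lemma adjH_sym: "adjH a b \<Longrightarrow> adjH b a"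
  by (simp add: adjH_def insert_commute)

lemma adjH_lt: "adjH a b \<Longrightarrow> a < h \<and> b < h"
  using H verts_H by (auto simp: adjH_def simple_graph_def)

definition part_hom :: "nat \<Rightarrow> (nat \<Rightarrow> nat) \<Rightarrow> bool" where
  "part_hom i \<phi> \<longleftrightarrow> (\<forall>u\<in>set (take i vs). \<phi> u < h) \<and>
     (\<forall>u\<in>set (take i vs). \<forall>v\<in>set (take i vs). adjG u v \<longrightarrow> adjH (\<phi> u) (\<phi> v))"

lemma part_hom_full: "part_hom (length vs) \<phi> \<longleftrightarrow> graph_hom G H \<phi>"
proof -
  have "verts G = set vs" using ord by (simp add: linear_ordering_def)
  moreover have "u \<in> set vs \<and> v \<in> set vs" if "adjG u v" for u v
    using adjG_lt[OF that] set_vs by simp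
  ultimately show ?thesis
    unfolding part_hom_def graph_hom_def verts_H
    by (auto simp: adjG_def[symmetric] adjH_def[symmetric])
qed

definition row :: "nat \<Rightarrow> (nat \<Rightarrow> nat) \<Rightarrow> nat list" where
  "row i \<phi> = map (\<lambda>e. \<phi> (fst e)) (cut i)"

text \<open>The first conjunct keeps stored rows realizable, so that a nonempty final set yields a
  homomorphism. The second is exchangeability against every column, whether or not it comes from a
  colouring of the remaining vertices.\<close>

definition represents :: "nat \<Rightarrow> nat list list \<Rightarrow> bool" where
  "represents i R \<longleftrightarrow> (\<forall>r\<in>set R. \<exists>\<phi>. part_hom i \<phi> \<and> r = row i \<phi>) \<and>
     (\<forall>\<phi> y. part_hom i \<phi> \<longrightarrow> compat adjH (row i \<phi>) y \<longrightarrow> (\<exists>r\<in>set R. compat adjH r y))"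

definition extendable :: "nat \<Rightarrow> nat list \<Rightarrow> nat \<Rightarrow> bool" where
  "extendable i r c \<longleftrightarrow> (\<forall>j<length (cut i). snd (cut i ! j) = vs ! i \<longrightarrow> adjH (r ! j) c)"

definition next_row :: "nat \<Rightarrow> nat list \<Rightarrow> nat \<Rightarrow> nat list" where
  "next_row i r c = map fst (filter (\<lambda>(a, e). snd e \<noteq> vs ! i) (zip r (cut i))) @ replicate (length (later i)) c"

definition candidates :: "nat \<Rightarrow> nat list list \<Rightarrow> nat list set" where
  "candidates i R = {next_row i r c |r c. r \<in> set R \<and> c < h \<and> extendable i r c}"

text \<open>Left ends of the current cut are earlier than \<open>vs ! i\<close>, so recolouring
  \<open>vs ! i\<close> does not affect the surviving entries.\<close>

lemma next_row_row:
  assumes "i < length vs"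
  shows "next_row i (row i \<phi>) c = row (Suc i) (\<phi>(vs ! i := c))"
proof -
  have ne: "fst e \<noteq> vs ! i" if "e \<in> set (cut i)" for e
    using that cut_spec[of i] assms nth_notin_take[OF assms] by auto
  have "map fst (filter (\<lambda>(a, e). snd e \<noteq> vs ! i) (zip (row i \<phi>) (cut i))) =
      map (\<lambda>e. \<phi> (fst e)) (filter (\<lambda>e. snd e \<noteq> vs ! i) (cut i))"
    unfolding row_def by (rule filter_zip_map)
  also have "\<dots> = map (\<lambda>e. (\<phi>(vs ! i := c)) (fst e)) (filter (\<lambda>e. snd e \<noteq> vs ! i) (cut i))"
    using ne by (intro map_cong) auto
  finally show ?thesis
    unfolding next_row_def by (simp add: row_def o_def map_replicate_const)
qed

lemma extendable_row:
  "extendable i (row i \<phi>) c \<longleftrightarrow> (\<forall>e\<in>set (cut i). snd e = vs ! i \<longrightarrow> adjH (\<phi> (fst e)) c)"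
  unfolding extendable_def row_def by (simp add: all_set_conv_all_nth)

lemma part_hom_extend:
  assumes i: "i < length vs" and \<phi>: "part_hom i \<phi>" and c: "c < h" and ext: "extendable i (row i \<phi>) c"
  shows "part_hom (Suc i) (\<phi>(vs ! i := c))"
proof -
  have v: "vs ! i \<notin> set (take i vs)" by (rule nth_notin_take[OF i])
  have e: "adjH (\<phi> u) c" if "u \<in> set (take i vs)" "adjG u (vs ! i)" for u
  proof -
    have "(u, vs ! i) \<in> set (cut i)" using that v cut_spec[of i] i by simp
    then show ?thesis using ext unfolding extendable_row by fastforce
  qed
  then have e': "adjH c (\<phi> u)" if "u \<in> set (take i vs)" "adjG (vs ! i) u" for u
    using that adjG_sym adjH_sym by blast
  show ?thesis
    unfolding part_hom_def set_take_Suc[OF i]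
    using \<phi> c e e' v adjG_irrefl unfolding part_hom_def by auto
qed

text \<open>A column \<open>y\<close> of the next cut is pulled back to the current one: surviving
  edges keep their entry, edges ending at the new vertex get its colour. A stored row compatible
  with the pulled-back column extends by the same colour to a candidate compatible with
  \<open>y\<close>, and \<open>cov\<close> exchanges this candidate for a member of
  \<open>R'\<close>.\<close>

lemma represents_Suc:
  assumes i: "i < length vs" and R: "represents i R" and R': "set R' \<subseteq> candidates i R"
    and cov: "\<And>r y. r \<in> candidates i R \<Longrightarrow> compat adjH r y \<Longrightarrow> \<exists>r'\<in>set R'. compat adjH r' y"
  shows "represents (Suc i) R'"
  unfolding represents_def
proof (intro conjI ballI allI impI)
  fix r' assume "r' \<in> set R'"
  then obtain r c where r: "r \<in> set R" "c < h" "extendable i r c" "r' = next_row i r c"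
    using R' unfolding candidates_def by blast
  then obtain \<phi> where "part_hom i \<phi>" "r = row i \<phi>" using R unfolding represents_def by blast
  then have "part_hom (Suc i) (\<phi>(vs ! i := c))" "r' = row (Suc i) (\<phi>(vs ! i := c))"
    using r part_hom_extend[OF i] next_row_row[OF i] by simp_all
  then show "\<exists>\<phi>. part_hom (Suc i) \<phi> \<and> r' = row (Suc i) \<phi>" by (intro exI conjI)
next
  fix \<phi> y assume \<phi>: "part_hom (Suc i) \<phi>" and y: "compat adjH (row (Suc i) \<phi>) y"
  let ?v = "vs ! i"
  have "length y = length (cut (Suc i))"
    using y list_all2_lengthD[of adjH "row (Suc i) \<phi>" y] by (simp add: compat_def row_def del: cut.simps)
  moreover have "distinct (cut (Suc i))" using cut_spec[of "Suc i"] i by simp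
  ultimately obtain g where g: "y = map g (cut (Suc i))"
    using distinct_list_eq_map by blast
  have yg: "adjH (\<phi> (fst e)) (g e)" if "e \<in> set (cut (Suc i))" for e
    using y that unfolding g row_def compat_map by blast
  define y0 where "y0 = map (\<lambda>e. if snd e = ?v then \<phi> ?v else g e) (cut i)"
  have ph: "part_hom i \<phi>" and c: "\<phi> ?v < h"
    using \<phi> unfolding part_hom_def set_take_Suc[OF i] by blast+
  have "compat adjH (row i \<phi>) y0"
    unfolding row_def y0_def compat_map
  proof
    fix e assume e: "e \<in> set (cut i)"
    then have *: "fst e \<in> set (take i vs)" "adjG (fst e) (snd e)" using cut_spec[of i] i by auto
    show "adjH (\<phi> (fst e)) (if snd e = ?v then \<phi> ?v else g e)"
    proof (cases "snd e = ?v")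
      case True
      then show ?thesis using * \<phi> unfolding part_hom_def set_take_Suc[OF i] by auto
    next
      case False
      then show ?thesis using yg[of e] e by simp
    qed
  qed
  then obtain r where r: "r \<in> set R" "compat adjH r y0" using R ph unfolding represents_def by blast
  then obtain \<rho> where \<rho>: "part_hom i \<rho>" "r = row i \<rho>" using R unfolding represents_def by blast
  have \<rho>y: "adjH (\<rho> (fst e)) (if snd e = ?v then \<phi> ?v else g e)" if "e \<in> set (cut i)" for e
    using r(2) that unfolding \<rho>(2) row_def y0_def compat_map by blast
  have ext: "extendable i r (\<phi> ?v)"
    unfolding \<rho>(2) extendable_row using \<rho>y by fastforce
  have "next_row i r (\<phi> ?v) \<in> candidates i R"
    unfolding candidates_def using r(1) c ext by blast
  moreover have "compat adjH (next_row i r (\<phi> ?v)) y"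
    unfolding \<rho>(2) next_row_row[OF i] unfolding g row_def compat_map
  proof
    fix e assume e: "e \<in> set (cut (Suc i))"
    then consider "e \<in> set (cut i)" "snd e \<noteq> ?v" | "fst e = ?v" by auto
    then show "adjH ((\<rho>(?v := \<phi> ?v)) (fst e)) (g e)"
    proof cases
      case 1
      then have "fst e \<noteq> ?v" using cut_spec[of i] i nth_notin_take[OF i] by auto
      then show ?thesis using \<rho>y[OF 1(1)] 1(2) by simp
    next
      case 2
      then show ?thesis using yg[OF e] by simp
    qed
  qed
  ultimately show "\<exists>r\<in>set R'. compat adjH r y" by (rule cov)
qed

lemma represents_0: "represents 0 [[]]"
  unfolding represents_def row_def part_hom_def by simp

text \<open>Nothing crosses the last cut, so every homomorphism has the empty row, which is
  compatible with the empty column.\<close>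

lemma represents_full:
  assumes "represents (length vs) R"
  shows "R \<noteq> [] \<longleftrightarrow> (\<exists>\<phi>. graph_hom G H \<phi>)"
proof
  assume "R \<noteq> []"
  then obtain r where "r \<in> set R" by (cases R) auto
  then show "\<exists>\<phi>. graph_hom G H \<phi>"
    using assms unfolding represents_def part_hom_full by blast
next
  assume "\<exists>\<phi>. graph_hom G H \<phi>"
  then obtain \<phi> where \<phi>: "part_hom (length vs) \<phi>" unfolding part_hom_full by blast
  have "set (cut (length vs)) = {}"
    using cut_spec[of "length vs"] adjG_lt set_vs by auto
  then have "compat adjH (row (length vs) \<phi>) []" by (simp add: row_def compat_def)
  then have "\<exists>r\<in>set R. compat adjH r []" using \<phi> assms unfolding represents_def by blast
  then show "R \<noteq> []" by auto
qed

lemma length_next_row: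
  assumes i: "i < length vs" and R: "represents i R" and r: "r \<in> set R"
  shows "length r = length (cut i)" "length (next_row i r c) = length (cut (Suc i))"
proof -
  obtain \<phi> where \<phi>: "r = row i \<phi>" using R r unfolding represents_def by blast
  then show "length r = length (cut i)" by (simp add: row_def)
  show "length (next_row i r c) = length (cut (Suc i))"
    unfolding \<phi> next_row_row[OF i] by (simp add: row_def)
qed

end

section \<open>Testing bipartiteness by breadth-first search\<close>

definition proper :: "(nat \<Rightarrow> nat \<Rightarrow> bool) \<Rightarrow> (nat \<Rightarrow> nat) \<Rightarrow> bool" where
  "proper E f \<longleftrightarrow> (\<forall>v. f v = 1 \<or> f v = 2) \<and> (\<forall>u v. E u v \<longrightarrow> f u \<noteq> f v)"

definition colourable :: "(nat \<Rightarrow> nat \<Rightarrow> bool) \<Rightarrow> bool" where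
  "colourable E \<longleftrightarrow> (\<exists>f. proper E f)"

text \<open>
  \<open>q\<close> lists the coloured vertices and \<open>P\<close> is the set of edges checked so far; colour 0 means uncoloured.
\<close>

definition bfs_inv ::
  "(nat \<Rightarrow> nat \<Rightarrow> bool) \<Rightarrow> nat \<Rightarrow> (nat \<times> nat) set \<Rightarrow> nat \<Rightarrow> (nat \<Rightarrow> nat) \<Rightarrow> (nat \<Rightarrow> nat) \<Rightarrow> nat \<Rightarrow> bool" where
  "bfs_inv E n P qt q col ok \<longleftrightarrow>
     inj_on q {..<qt} \<and> q ` {..<qt} = {v. v < n \<and> col v \<noteq> 0} \<and> (\<forall>v. col v \<le> 2) \<and>
     (\<forall>u v. (u, v) \<in> P \<longrightarrow> E u v \<and> col u \<noteq> 0 \<and> col v \<noteq> 0 \<and> (ok = 1 \<longrightarrow> col u \<noteq> col v)) \<and>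
     ok \<le> 1 \<and> (ok = 0 \<longrightarrow> \<not> colourable E) \<and>
     (colourable E \<longrightarrow> (\<exists>f. proper E f \<and> (\<forall>v<n. col v \<noteq> 0 \<longrightarrow> f v = col v)))"

lemma bfs_invD:
  assumes "bfs_inv E n P qt q col ok"
  shows "inj_on q {..<qt}" "q ` {..<qt} = {v. v < n \<and> col v \<noteq> 0}" "col v \<le> 2"
    "(u, v) \<in> P \<Longrightarrow> E u v \<and> col u \<noteq> 0 \<and> col v \<noteq> 0 \<and> (ok = 1 \<longrightarrow> col u \<noteq> col v)"
    "ok \<le> 1" "ok = 0 \<Longrightarrow> \<not> colourable E"
    "colourable E \<Longrightarrow> \<exists>f. proper E f \<and> (\<forall>v<n. col v \<noteq> 0 \<longrightarrow> f v = col v)"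
  using assms unfolding bfs_inv_def by blast+

lemma bfs_inv_qt: "bfs_inv E n P qt q col ok \<Longrightarrow> qt \<le> n"
proof -
  assume a: "bfs_inv E n P qt q col ok"
  have "card (q ` {..<qt}) \<le> card {..<n}"
    unfolding bfs_invD(2)[OF a] by (intro card_mono) auto
  then show ?thesis using card_image[OF bfs_invD(1)[OF a]] by simp
qed

lemma bfs_inv_init: "bfs_inv E n {} 0 q (\<lambda>_. 0) 1"
  unfolding bfs_inv_def colourable_def by simp

text \<open>The hypothesis \<open>ext\<close> isolates why colour \<open>c\<close> may be chosen
  without loss: it is forced for a neighbour of a coloured vertex, and obtained by swapping colours
  for a new root.\<close>

lemma bfs_inv_enqueue:
  assumes inv: "bfs_inv E n P qt q col ok" and v: "v < n" "col v = 0" and c: "c = 1 \<or> c = 2"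
    and ext: "\<And>f. proper E f \<Longrightarrow> \<forall>v<n. col v \<noteq> 0 \<longrightarrow> f v = col v \<Longrightarrow>
      \<exists>f. proper E f \<and> (\<forall>v<n. col v \<noteq> 0 \<longrightarrow> f v = col v) \<and> f v = c"
  shows "bfs_inv E n P (Suc qt) (q(qt := v)) (col(v := c)) ok"
proof -
  note D = bfs_invD[OF inv]
  have qv: "v \<notin> q ` {..<qt}" using D(2) v by simp
  have im: "(q(qt := v)) ` {..<Suc qt} = insert v (q ` {..<qt})"
    by (auto simp: lessThan_Suc)
  have "inj_on (q(qt := v)) {..<Suc qt}"
    using D(1) qv unfolding lessThan_Suc by (auto simp: inj_on_def)
  moreover have "(q(qt := v)) ` {..<Suc qt} = {x. x < n \<and> (col(v := c)) x \<noteq> 0}"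
    unfolding im D(2) using v c by auto
  moreover have "(col(v := c)) x \<le> 2" for x
    using D(3)[of x] c by auto
  moreover have "E a b \<and> (col(v := c)) a \<noteq> 0 \<and> (col(v := c)) b \<noteq> 0 \<and> (ok = 1 \<longrightarrow> (col(v := c)) a \<noteq> (col(v := c)) b)"
    if "(a, b) \<in> P" for a b
    using D(4)[OF that] v by auto
  moreover have "\<exists>f. proper E f \<and> (\<forall>x<n. (col(v := c)) x \<noteq> 0 \<longrightarrow> f x = (col(v := c)) x)" if ce: "colourable E"
  proof -
    obtain f where f: "proper E f" "\<forall>x<n. col x \<noteq> 0 \<longrightarrow> f x = col x" using D(7)[OF ce] by (elim exE conjE)
    obtain f' where "proper E f'" "\<forall>x<n. col x \<noteq> 0 \<longrightarrow> f' x = col x" "f' v = c"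
      using ext[OF f] by (elim exE conjE)
    then show ?thesis by (intro exI[of _ f']) auto
  qed
  ultimately show ?thesis using D(5,6) unfolding bfs_inv_def by blast
qed

text \<open>If \<open>E\<close> were colourable, some proper colouring would agree with
  \<open>col\<close>; equal colours at the ends of an edge therefore refute colourability.\<close>

lemma bfs_inv_check:
  assumes inv: "bfs_inv E n P qt q col ok" and uv: "E u v" "u < n" "v < n" "col u \<noteq> 0" "col v \<noteq> 0"
  shows "bfs_inv E n (insert (u, v) P) qt q col (if col u = col v then 0 else ok)"
proof -
  note D = bfs_invD[OF inv]
  have "\<not> colourable E" if "col u = col v"
  proof
    assume ce: "colourable E"
    obtain f where f: "proper E f" "\<forall>x<n. col x \<noteq> 0 \<longrightarrow> f x = col x" using D(7)[OF ce] by (elim exE conjE)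
    have "f u = col u" "f v = col v" using f(2) uv by simp_all
    moreover have "f u \<noteq> f v" using f(1) uv(1) unfolding proper_def by blast
    ultimately show False using that by simp
  qed
  then show ?thesis using D uv unfolding bfs_inv_def by (auto split: if_splits)
qed

text \<open>The map \<open>3 - c\<close> exchanges the colours 1 and 2, so the new colour is the
  only possible one.\<close>

lemma bfs_inv_neighbour:
  assumes inv: "bfs_inv E n P qt q col ok" and uv: "E u v" "u < n" "v < n" "col u \<noteq> 0" "col v = 0"
  shows "bfs_inv E n (insert (u, v) P) (Suc qt) (q(qt := v)) (col(v := 3 - col u)) ok"
proof -
  note D = bfs_invD[OF inv]
  have cu: "col u = 1 \<or> col u = 2" using D(3)[of u] uv by linarith
  have ne: "u \<noteq> v" using uv by auto
  have "bfs_inv E n P (Suc qt) (q(qt := v)) (col(v := 3 - col u)) ok"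
  proof (rule bfs_inv_enqueue[OF inv uv(3,5)])
    show "3 - col u = 1 \<or> 3 - col u = 2" using cu by auto
    fix f assume f: "proper E f" "\<forall>v<n. col v \<noteq> 0 \<longrightarrow> f v = col v"
    have "f u = col u" "f u \<noteq> f v" "f v = 1 \<or> f v = 2" using f uv unfolding proper_def by auto
    then have "f v = 3 - col u" using cu by auto
    then show "\<exists>f. proper E f \<and> (\<forall>v<n. col v \<noteq> 0 \<longrightarrow> f v = col v) \<and> f v = 3 - col u"
      using f by (intro exI[of _ f]) simp
  qed
  from bfs_inv_check[OF this uv(1-3)] show ?thesis using cu ne uv by auto
qed

text \<open>When the queue is empty, the coloured vertices are closed under neighbours, so that the
  colours of all other vertices can be swapped.\<close>

lemma bfs_inv_root:
  assumes inv: "bfs_inv E n P qt q col ok" and r: "r < n" "col r = 0"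
    and E: "\<And>u v. E u v \<Longrightarrow> E v u \<and> u < n"
    and closed: "\<And>u v. E u v \<Longrightarrow> col u \<noteq> 0 \<Longrightarrow> col v \<noteq> 0"
  shows "bfs_inv E n P (Suc qt) (q(qt := r)) (col(r := 1)) ok"
proof (rule bfs_inv_enqueue[OF inv r])
  fix f assume f: "proper E f" "\<forall>v<n. col v \<noteq> 0 \<longrightarrow> f v = col v"
  show "\<exists>f. proper E f \<and> (\<forall>v<n. col v \<noteq> 0 \<longrightarrow> f v = col v) \<and> f r = 1"
  proof (cases "f r = 1")
    case True
    then show ?thesis using f by (intro exI[of _ f]) simp
  next
    case False
    define g where "g v = (if col v = 0 then 3 - f v else f v)" for v
    have f12: "f v = 1 \<or> f v = 2" for v using f unfolding proper_def by blast
    have "proper E g"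
      unfolding proper_def
    proof (intro conjI allI impI)
      show "g v = 1 \<or> g v = 2" for v using f12[of v] by (auto simp: g_def)
      fix u v assume e: "E u v"
      then have "f u \<noteq> f v" using f unfolding proper_def by blast
      moreover have "col u = 0 \<longleftrightarrow> col v = 0" using closed[OF e] closed[OF E[OF e, THEN conjunct1]] by blast
      ultimately show "g u \<noteq> g v" using f12[of u] f12[of v] by (auto simp: g_def)
    qed
    moreover have "g r = 1" using False f12[of r] r by (simp add: g_def)
    ultimately show ?thesis using f by (intro exI[of _ g]) (simp add: g_def)
  qed
qed simp

lemma bfs_inv_end:
  assumes inv: "bfs_inv E n P qt q col ok" and P: "\<And>u v. E u v \<Longrightarrow> (u, v) \<in> P"
  shows "ok = 1 \<longleftrightarrow> colourable E"
proof
  note D = bfs_invD[OF inv]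
  assume ok: "ok = 1"
  \<comment> \<open>All edges have been checked and checked edges have coloured ends, so uncoloured
    vertices lie on no edge and colour 1 is an arbitrary default.\<close>
  have "proper E (\<lambda>v. if col v = 0 then 1 else col v)"
    unfolding proper_def
  proof (intro conjI allI impI)
    show "(if col v = 0 then 1 else col v) = 1 \<or> (if col v = 0 then 1 else col v) = 2" for v
      using D(3)[of v] by auto
    show "(if col u = 0 then 1 else col u) \<noteq> (if col v = 0 then 1 else col v)" if "E u v" for u v
      using D(4)[OF P[OF that]] ok by auto
  qed
  then show "colourable E" unfolding colourable_def by blast
next
  assume "colourable E"
  then show "ok = 1" using bfs_invD(5,6)[OF inv] by linarith
qed

section \<open>Breadth-first search as a program\<close>

abbreviation bfs_scan_body :: "bexp \<Rightarrow> exp \<Rightarrow> vname \<Rightarrow> vname \<Rightarrow> com" where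
  "bfs_scan_body cd nb col q \<equiv>
     Cond cd
       (Seq (Assign ''v'' nb)
         (Cond (Eq (Elem col (Var ''v'')) (Const 0))
           (Seq (Store col (Var ''v'') (Sub (Const 3) (Elem col (Var ''u''))))
           (Seq (Store q (Var ''qt'') (Var ''v''))
             (Assign ''qt'' (Add (Var ''qt'') (Const 1)))))
           (Cond (Eq (Elem col (Var ''u'')) (Elem col (Var ''v''))) (Assign ''ok'' (Const 0)) Skip)))
       Skip"

definition bfs_scan :: "exp \<Rightarrow> exp \<Rightarrow> bexp \<Rightarrow> exp \<Rightarrow> vname \<Rightarrow> vname \<Rightarrow> com" where
  "bfs_scan lo hi cd nb col q =
     For ''j'' lo hi (bfs_scan_body cd nb col q)"

text \<open>A round either takes one vertex from the queue or advances the root pointer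
  \<open>rt\<close>, until neither is possible. Each happens at most once per vertex, so a plain
  loop of twice the number of vertices replaces nested loops.\<close>

definition bfs_step :: "vname \<Rightarrow> exp \<Rightarrow> exp \<Rightarrow> bexp \<Rightarrow> exp \<Rightarrow> vname \<Rightarrow> vname \<Rightarrow> com" where
  "bfs_step nv lo hi cd nb col q =
     Cond (Eq (Var ''qh'') (Var ''qt''))
       (Cond (Less (Var ''rt'') (Var nv))
         (Seq (Cond (Eq (Elem col (Var ''rt'')) (Const 0))
                (Seq (Store col (Var ''rt'') (Const 1))
                (Seq (Store q (Var ''qt'') (Var ''rt''))
                  (Assign ''qt'' (Add (Var ''qt'') (Const 1)))))
                Skip)
           (Assign ''rt'' (Add (Var ''rt'') (Const 1))))
         Skip)
       (Seq (Assign ''u'' (Elem q (Var ''qh'')))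
       (Seq (Assign ''qh'' (Add (Var ''qh'') (Const 1)))
         (bfs_scan lo hi cd nb col q)))"

definition bfs :: "vname \<Rightarrow> exp \<Rightarrow> exp \<Rightarrow> bexp \<Rightarrow> exp \<Rightarrow> vname \<Rightarrow> vname \<Rightarrow> com" where
  "bfs nv lo hi cd nb col q =
     Seq (Assign ''ok'' (Const 1)) (Seq (Assign ''qh'' (Const 0)) (Seq (Assign ''qt'' (Const 0))
     (Seq (Assign ''rt'' (Const 0))
       (For ''x'' (Const 0) (Add (Var nv) (Var nv)) (bfs_step nv lo hi cd nb col q)))))"

abbreviation bfs_vars :: "vname set" where
  "bfs_vars \<equiv> {''ok'', ''qh'', ''qt'', ''rt'', ''x'', ''u'', ''v'', ''j''}"

lemma wvars_bfs [simp]: "wvars (bfs nv lo hi cd nb col q) = bfs_vars"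
  and warrs_bfs [simp]: "warrs (bfs nv lo hi cd nb col q) = {col, q}"
  and wvars_bfs_step [simp]: "wvars (bfs_step nv lo hi cd nb col q) = {''ok'', ''qh'', ''qt'', ''rt'', ''u'', ''v'', ''j''}"
  and warrs_bfs_step [simp]: "warrs (bfs_step nv lo hi cd nb col q) = {col, q}"
  and wvars_bfs_scan [simp]: "wvars (bfs_scan lo hi cd nb col q) = {''ok'', ''qt'', ''v'', ''j''}"
  and warrs_bfs_scan [simp]: "warrs (bfs_scan lo hi cd nb col q) = {col, q}"
  by (auto simp: bfs_def bfs_step_def bfs_scan_def)

text \<open>Covers both encodings of a graph: the neighbours of \<open>u\<close> are the
  \<open>M u j\<close> for those positions \<open>j\<close> from \<open>L u\<close> up to
  \<open>U u\<close> that pass the test \<open>C u j\<close>. For \<open>H\<close> the test reads a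
  matrix entry; for \<open>G\<close> it is always true and \<open>M\<close> reads the adjacency
  list.\<close>

locale bfs_program =
  fixes E :: "nat \<Rightarrow> nat \<Rightarrow> bool" and n deg w :: nat and nv col q :: vname
    and lo hi nb :: exp and cd :: bexp and L U :: "nat \<Rightarrow> nat" and C :: "nat \<Rightarrow> nat \<Rightarrow> bool" and M :: "nat \<Rightarrow> nat \<Rightarrow> nat"
    and s0 :: state
  assumes sym: "\<And>u v. E u v \<Longrightarrow> E v u \<and> u < n \<and> v < n"
    and nbrs: "\<And>u v. u < n \<Longrightarrow> E u v \<longleftrightarrow> (\<exists>j. L u \<le> j \<and> j < U u \<and> C u j \<and> v = M u j)"
    and deg: "\<And>u. u < n \<Longrightarrow> L u \<le> U u \<and> U u - L u \<le> deg \<and> U u < 2 ^ w"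
    and n0: "vars s0 nv = n" "nv \<notin> bfs_vars" "col \<noteq> q"
    and w: "n + n + 4 < 2 ^ w"
    and bounds: "\<And>s u. same_off bfs_vars {col, q} s0 s \<Longrightarrow> vars s ''u'' = u \<Longrightarrow> u < n \<Longrightarrow>
        fits w lo s \<and> eval lo s = L u \<and> fits w hi s \<and> eval hi s = U u"
    and test: "\<And>s u j. same_off bfs_vars {col, q} s0 s \<Longrightarrow> vars s ''u'' = u \<Longrightarrow> u < n \<Longrightarrow>
        vars s ''j'' = j \<Longrightarrow> L u \<le> j \<Longrightarrow> j < U u \<Longrightarrow>
        bfits w cd s \<and> beval cd s = C u j \<and> fits w nb s \<and> eval nb s = M u j"
begin

lemma w0: "w > 0"
  using w by (cases w) auto

text \<open>The number \<open>k\<close> protects the dequeued prefix of the queue: new vertices are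
  written at \<open>qt\<close> or later, so a description of checked edges through that prefix
  remains valid.\<close>

lemma wp_scan:
  assumes so: "same_off bfs_vars {col, q} s0 s" and u: "vars s ''u'' = u" "u < n" "arrs s col u \<noteq> 0"
    and inv: "bfs_inv E n P (vars s ''qt'') (arrs s q) (arrs s col) (vars s ''ok'')"
    and qh: "k \<le> vars s ''qt''"
  shows "wp w (bfs_scan lo hi cd nb col q)
    (\<lambda>t s'. t \<le> deg * 8 + 2 \<and>
      bfs_inv E n (P \<union> {(u, v) |v. E u v}) (vars s' ''qt'') (arrs s' q) (arrs s' col) (vars s' ''ok'') \<and>
      k \<le> vars s' ''qt'' \<and> (\<forall>i<k. arrs s' q i = arrs s q i) \<and>
      (\<forall>v. arrs s col v \<noteq> 0 \<longrightarrow> arrs s' col v \<noteq> 0)) s"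
proof -
  define I where "I j (s' :: state) \<longleftrightarrow>
      bfs_inv E n (P \<union> {(u, M u i) |i. L u \<le> i \<and> i < j \<and> C u i}) (vars s' ''qt'') (arrs s' q) (arrs s' col) (vars s' ''ok'') \<and>
      k \<le> vars s' ''qt'' \<and> (\<forall>i<k. arrs s' q i = arrs s q i) \<and>
      (\<forall>v. arrs s col v \<noteq> 0 \<longrightarrow> arrs s' col v \<noteq> 0)" for j s'
  let ?B = "bfs_scan_body cd nb col q"
  have "wp w (For ''j'' lo hi ?B) (\<lambda>t s'. t \<le> (U u - L u) * (6 + 2) + 2 \<and> I (U u) s' \<and> vars s' ''j'' = U u) s"
  proof (rule wp_For)
    fix i and s' :: state assume i: "L u \<le> i" "i < U u" and I: "I i s'" and j: "vars s' ''j'' = i"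
      and so': "loop_frame ''j'' ?B s s'"
    have so1: "same_off bfs_vars {col, q} s0 s'" using so so' by (auto simp: same_off_def)
    have u': "vars s' ''u'' = u" using so' u by (auto simp: same_off_def)
    have colu: "arrs s' col u \<noteq> 0" using I u by (simp add: I_def)
    have set: "P \<union> {(u, M u i') |i'. L u \<le> i' \<and> i' < Suc i \<and> C u i'} =
        (if C u i then insert (u, M u i) (P \<union> {(u, M u i') |i'. L u \<le> i' \<and> i' < i \<and> C u i'})
         else P \<union> {(u, M u i') |i'. L u \<le> i' \<and> i' < i \<and> C u i'})"
      using i by (auto simp: less_Suc_eq)
    have qt: "vars s' ''qt'' \<le> n" using I bfs_inv_qt unfolding I_def by blast
    note T = test[OF so1 u' u(2) j i]
    show "wp w ?B (\<lambda>t s''. t \<le> 6 \<and> I (Suc i) (set_var ''j'' (Suc i) s'')) s'"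
    proof (cases "C u i")
      case False
      then show ?thesis using T I unfolding I_def set by (simp add: wp_simps)
    next
      case True
      define v where "v = M u i"
      have Ev: "E u v" using nbrs[OF u(2)] i True v_def by blast
      then have vn: "v < n" using sym by blast
      have inv': "bfs_inv E n (P \<union> {(u, M u i') |i'. L u \<le> i' \<and> i' < i \<and> C u i'}) (vars s' ''qt'') (arrs s' q) (arrs s' col) (vars s' ''ok'')"
        using I unfolding I_def by blast
      show ?thesis
      proof (cases "arrs s' col v = 0")
        case v0: True
        have "arrs s' col u < 3" using bfs_invD(3)[OF inv', of u] by linarith
        then show ?thesis
          using T True I v0 bfs_inv_neighbour[OF inv' Ev u(2) vn colu v0] n0(3) w qt u' n0
          unfolding I_def set by (simp add: wp_simps v_def[symmetric])
      next
        case v0: False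
        show ?thesis
          using T True I v0 bfs_inv_check[OF inv' Ev u(2) vn colu v0] n0(3) w qt u' n0
          unfolding I_def set by (auto simp add: wp_simps v_def[symmetric])
      qed
    qed
  next
    show "fits w lo s" "eval lo s = L u" using bounds[OF so u(1,2)] by simp_all
    show "L u \<le> U u" "U u < 2 ^ w" using deg[OF u(2)] by simp_all
    have e: "{(u, M u i) |i. L u \<le> i \<and> i < L u \<and> C u i} = {}" by auto
    show "I (L u) (set_var ''j'' (L u) s)" unfolding I_def e using inv qh by simp
    fix s' assume "loop_frame ''j'' ?B s s'"
    then have "same_off bfs_vars {col, q} s0 s'" "vars s' ''u'' = u"
      using so u by (auto simp: same_off_def)
    then show "fits w hi s' \<and> eval hi s' = U u" using bounds u(2) by blast
  qed (simp_all add: w0)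
  then show ?thesis
    unfolding bfs_scan_def
  proof (rule wp_mono)
    fix t s' assume a: "t \<le> (U u - L u) * (6 + 2) + 2 \<and> I (U u) s' \<and> vars s' ''j'' = U u"
    have e: "{(u, M u i) |i. L u \<le> i \<and> i < U u \<and> C u i} = {(u, v) |v. E u v}"
      using nbrs[OF u(2)] by blast
    have "(U u - L u) * (6 + 2) + 2 \<le> deg * 8 + 2" using deg[OF u(2)] by simp
    then show "t \<le> deg * 8 + 2 \<and>
      bfs_inv E n (P \<union> {(u, v) |v. E u v}) (vars s' ''qt'') (arrs s' q) (arrs s' col) (vars s' ''ok'') \<and>
      k \<le> vars s' ''qt'' \<and> (\<forall>i<k. arrs s' q i = arrs s q i) \<and>
      (\<forall>v. arrs s col v \<noteq> 0 \<longrightarrow> arrs s' col v \<noteq> 0)"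
      using a unfolding I_def e by (elim conjE) (intro conjI; (assumption | linarith))
  qed
qed

text \<open>Checked edges are described by the dequeued prefix, without ghost state. The last
  conjunct measures progress: every round increases \<open>qh + rt\<close> by one unless the search
  is complete.\<close>

definition bfs_outer :: "nat \<Rightarrow> state \<Rightarrow> bool" where
  "bfs_outer x s \<longleftrightarrow>
     bfs_inv E n {(u, v). E u v \<and> u \<in> arrs s q ` {..<vars s ''qh''}} (vars s ''qt'') (arrs s q) (arrs s col) (vars s ''ok'') \<and>
     vars s ''qh'' \<le> vars s ''qt'' \<and> vars s ''rt'' \<le> n \<and> (\<forall>v<vars s ''rt''. arrs s col v \<noteq> 0) \<and>
     (x \<le> vars s ''qh'' + vars s ''rt'' \<or> vars s ''qh'' = vars s ''qt'' \<and> vars s ''rt'' = n)"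

lemma wp_step:
  assumes so: "same_off bfs_vars {col, q} s0 s" and I: "bfs_outer x s"
  shows "wp w (bfs_step nv lo hi cd nb col q) (\<lambda>t s'. t \<le> deg * 8 + 10 \<and> bfs_outer (Suc x) s') s"
proof -
  let ?qh = "vars s ''qh''" and ?qt = "vars s ''qt''" and ?rt = "vars s ''rt''"
  from I have inv: "bfs_inv E n {(u, v). E u v \<and> u \<in> arrs s q ` {..<?qh}} ?qt (arrs s q) (arrs s col) (vars s ''ok'')"
    and le: "?qh \<le> ?qt" "?rt \<le> n" and rt: "\<And>v. v < ?rt \<Longrightarrow> arrs s col v \<noteq> 0"
    and x: "x \<le> ?qh + ?rt \<or> ?qh = ?qt \<and> ?rt = n"
    unfolding bfs_outer_def by blast+
  note D = bfs_invD[OF inv]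
  have qtn: "?qt \<le> n" using bfs_inv_qt[OF inv] .
  have nv: "vars s nv = n" using so n0 by (auto simp: same_off_def)
  show ?thesis
  proof (cases "?qh = ?qt")
    case e: True
    show ?thesis
    proof (cases "?rt < n \<and> arrs s col ?rt = 0")
      case True
      have closed: "arrs s col v \<noteq> 0" if "E u v" "arrs s col u \<noteq> 0" for u v
      proof -
        have "u \<in> arrs s q ` {..<?qh}" using D(2) sym[OF that(1)] that(2) e by auto
        then show ?thesis using D(4)[of u v] that by auto
      qed
      have inv': "bfs_inv E n {(u, v). E u v \<and> u \<in> arrs s q ` {..<?qh}} (Suc ?qt) ((arrs s q)(?qt := ?rt))
          ((arrs s col)(?rt := 1)) (vars s ''ok'')"
        by (rule bfs_inv_root[OF inv]) (use True sym closed in auto)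
      have "((arrs s q)(?qt := ?rt)) ` {..<?qh} = arrs s q ` {..<?qh}" using e by auto
      then show ?thesis
        unfolding bfs_step_def using True e nv inv' rt x qtn w n0(3) le
        by (auto simp: wp_simps bfs_outer_def less_Suc_eq)
    next
      case False
      then show ?thesis
        unfolding bfs_step_def using e nv I w n0(3) le
        by (auto simp: wp_simps bfs_outer_def less_Suc_eq)
    qed
  next
    case False
    define u where "u = arrs s q ?qh"
    have "u \<in> arrs s q ` {..<?qt}" using False le unfolding u_def by auto
    then have u: "u < n" "arrs s col u \<noteq> 0" unfolding D(2) by auto
    define s1 where "s1 = set_var ''qh'' (Suc ?qh) (set_var ''u'' u s)"
    have so1: "same_off bfs_vars {col, q} s0 s1" using so by (auto simp: same_off_def s1_def)
    have vs1: "vars s1 ''u'' = u" "vars s1 ''qh'' = Suc ?qh" "vars s1 ''qt'' = ?qt" "vars s1 ''ok'' = vars s ''ok''"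
        "vars s1 ''rt'' = ?rt" "arrs s1 = arrs s"
      by (simp_all add: s1_def)
    have *: "wp w (bfs_scan lo hi cd nb col q) (\<lambda>t s'. t \<le> deg * 8 + 2 \<and> bfs_outer (Suc x) s') s1"
    proof (rule wp_use[OF wp_scan[OF so1 vs1(1) u(1), where P = "{(u, v). E u v \<and> u \<in> arrs s q ` {..<?qh}}" and k = "Suc ?qh"]])
      show "arrs s1 col u \<noteq> 0" using u vs1 by simp
      show "bfs_inv E n {(u, v). E u v \<and> u \<in> arrs s q ` {..<?qh}} (vars s1 ''qt'') (arrs s1 q) (arrs s1 col) (vars s1 ''ok'')"
        unfolding vs1 by (rule inv)
      show "Suc ?qh \<le> vars s1 ''qt''" using False le vs1 by simp
      fix t s'
      assume *: "t \<le> deg * 8 + 2 \<and>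
          bfs_inv E n ({(u, v). E u v \<and> u \<in> arrs s q ` {..<?qh}} \<union> {(u, v) |v. E u v}) (vars s' ''qt'') (arrs s' q) (arrs s' col) (vars s' ''ok'') \<and>
          Suc ?qh \<le> vars s' ''qt'' \<and> (\<forall>i<Suc ?qh. arrs s' q i = arrs s1 q i) \<and>
          (\<forall>v. arrs s1 col v \<noteq> 0 \<longrightarrow> arrs s' col v \<noteq> 0)"
        and so': "frame (bfs_scan lo hi cd nb col q) s1 s'"
      have v': "vars s' ''qh'' = Suc ?qh" "vars s' ''rt'' = ?rt" using so' vs1 by (auto simp: same_off_def)
      have "arrs s' q ` {..<Suc ?qh} = arrs s q ` {..<Suc ?qh}"
        using * vs1 by (intro image_cong) auto
      also have "\<dots> = insert u (arrs s q ` {..<?qh})" by (simp add: u_def lessThan_Suc)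
      finally have "{(a, v). E a v \<and> a \<in> arrs s' q ` {..<Suc ?qh}} =
          {(u, v). E u v \<and> u \<in> arrs s q ` {..<?qh}} \<union> {(u, v) |v. E u v}" by auto
      then show "t \<le> deg * 8 + 2 \<and> bfs_outer (Suc x) s'"
        unfolding bfs_outer_def v' using * rt x False vs1 le by auto
    qed
    show ?thesis
      unfolding bfs_step_def using False w qtn le
      by (simp add: wp_simps u_def[symmetric]) (rule wp_mono[OF *[unfolded s1_def, simplified]], simp)
  qed
qed

lemma wp_bfs:
  assumes col: "arrs s0 col = (\<lambda>_. 0)"
  shows "wp w (bfs nv lo hi cd nb col q)
    (\<lambda>t s'. t \<le> 2 * n * (deg * 8 + 12) + 6 \<and> (vars s' ''ok'' = 1 \<longleftrightarrow> colourable E)) s0"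
proof -
  let ?L = "For ''x'' (Const 0) (Add (Var nv) (Var nv)) (bfs_step nv lo hi cd nb col q)"
  define s1 where "s1 = set_var ''rt'' 0 (set_var ''qt'' 0 (set_var ''qh'' 0 (set_var ''ok'' 1 s0)))"
  have so1: "same_off bfs_vars {col, q} s0 s1" by (auto simp: same_off_def s1_def)
  have nv: "nv \<noteq> ''x''" "nv \<notin> insert ''x'' (wvars (bfs_step nv lo hi cd nb col q))" using n0 by auto
  have "wp w ?L (\<lambda>t s'. t \<le> (n + n - 0) * (deg * 8 + 10 + 2) + 2 \<and> bfs_outer (n + n) s' \<and> vars s' ''x'' = n + n) s1"
  proof (rule wp_For)
    fix i and s' :: state assume "bfs_outer i s'"
      and so': "loop_frame ''x'' (bfs_step nv lo hi cd nb col q) s1 s'"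
    moreover have "same_off bfs_vars {col, q} s0 s'" using so1 so' by (auto simp: same_off_def)
    ultimately have "wp w (bfs_step nv lo hi cd nb col q) (\<lambda>t s'. t \<le> deg * 8 + 10 \<and> bfs_outer (Suc i) s') s'"
      using wp_step by blast
    then show "wp w (bfs_step nv lo hi cd nb col q)
        (\<lambda>t s''. t \<le> deg * 8 + 10 \<and> bfs_outer (Suc i) (set_var ''x'' (Suc i) s'')) s'"
      by (rule wp_mono) (simp add: bfs_outer_def)
  next
    show "bfs_outer 0 (set_var ''x'' 0 s1)"
      using bfs_inv_init[of E n "arrs s0 q"] by (simp add: bfs_outer_def s1_def col)
    show "fits w (Add (Var nv) (Var nv)) s' \<and> eval (Add (Var nv) (Var nv)) s' = n + n"
      if "loop_frame ''x'' (bfs_step nv lo hi cd nb col q) s1 s'" for s'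
    proof -
      have "vars s' nv = n" using same_off_vars[OF that nv(2)] n0 by (simp add: s1_def)
      then show ?thesis using w by simp
    qed
  qed (use w w0 in simp_all)
  then have *: "wp w ?L (\<lambda>t s'. t \<le> 2 * n * (deg * 8 + 12) + 2 \<and> (vars s' ''ok'' = 1 \<longleftrightarrow> colourable E)) s1"
  proof (rule wp_mono)
    fix t s' assume a: "t \<le> (n + n - 0) * (deg * 8 + 10 + 2) + 2 \<and> bfs_outer (n + n) s' \<and> vars s' ''x'' = n + n"
    then have inv: "bfs_inv E n {(u, v). E u v \<and> u \<in> arrs s' q ` {..<vars s' ''qh''}} (vars s' ''qt'') (arrs s' q) (arrs s' col) (vars s' ''ok'')"
      and le: "vars s' ''qh'' \<le> vars s' ''qt''" "vars s' ''rt'' \<le> n" and rt: "\<And>v. v < vars s' ''rt'' \<Longrightarrow> arrs s' col v \<noteq> 0"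
      and x: "n + n \<le> vars s' ''qh'' + vars s' ''rt'' \<or> vars s' ''qh'' = vars s' ''qt'' \<and> vars s' ''rt'' = n"
      unfolding bfs_outer_def by blast+
    \<comment> \<open>Both \<open>qt\<close> and \<open>rt\<close> are at most \<open>n\<close> and
      \<open>qh\<close> is at most \<open>qt\<close>, so a sum of at least \<open>2 * n\<close>
      leaves only equality.\<close>
    have eq: "vars s' ''qh'' = vars s' ''qt''" "vars s' ''rt'' = n" using x le bfs_inv_qt[OF inv] by linarith+
    have "(vars s' ''ok'' = 1) = colourable E"
    proof (rule bfs_inv_end[OF inv])
      fix u v assume "E u v"
      then have "u < n" using sym by blast
      then have "u \<in> arrs s' q ` {..<vars s' ''qh''}"
        unfolding eq(1) bfs_invD(2)[OF inv] using rt eq(2) by simp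
      then show "(u, v) \<in> {(u, v). E u v \<and> u \<in> arrs s' q ` {..<vars s' ''qh''}}" using \<open>E u v\<close> by simp
    qed
    moreover have "(n + n - 0) * (deg * 8 + 10 + 2) + 2 = 2 * n * (deg * 8 + 12) + 2"
      by (simp add: algebra_simps)
    ultimately show "t \<le> 2 * n * (deg * 8 + 12) + 2 \<and> (vars s' ''ok'' = 1 \<longleftrightarrow> colourable E)"
      using a by linarith
  qed
  show ?thesis
    unfolding bfs_def using w
    by (simp add: wp_simps) (rule wp_mono[OF *[unfolded s1_def, simplified]], simp)
qed

end

section \<open>The dynamic programming algorithm\<close>

text \<open>
  Rows of the current cut are stored consecutively in \<open>rw\<close> from position \<open>lb\<close> on, right endpoints
  of the cut edges in \<open>ce\<close> from position \<open>cb\<close> on; the data of the next cut follow immediately.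
  Node p of the search tree is filled in phase i iff \<open>fl[p] = i + 1\<close>, so that \<open>fl\<close> need not be
  cleared. Column b is available at node p in coordinate j iff \<open>av[p * g + j * h + b] = 1\<close>,
  where \<open>g = M * h\<close> and M is the size of the next cut.
\<close>

abbreviation viable_test :: com where
  "viable_test \<equiv>
     Cond (And (Eq (Elem ''H'' (Add (Mul (Elem ''cd'' (Var ''j'')) (Var ''h'')) (Var ''a''))) (Const 1))
               (Eq (Elem ''av'' (Add (Mul (Var ''p'') (Var ''g'')) (Add (Mul (Var ''j'') (Var ''h'')) (Var ''a'')))) (Const 1)))
       (Assign ''ex'' (Const 1)) Skip"

abbreviation viable_body :: com where
  "viable_body \<equiv>
     Seq (Assign ''ex'' (Const 0))
     (Seq (For ''a'' (Const 0) (Var ''h'') viable_test)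
       (Cond (Eq (Var ''ex'') (Const 0)) (Assign ''vb'' (Const 0)) Skip))"

definition viable_prog :: com where
  "viable_prog = Seq (Assign ''vb'' (Const 1)) (For ''j'' (Const 0) (Var ''M'') viable_body)"

abbreviation copy_row_body :: "com" where
  "copy_row_body \<equiv>
     Store ''rw'' (Add (Var ''l2'') (Add (Mul (Var ''rc'') (Var ''M'')) (Var ''j''))) (Elem ''cd'' (Var ''j''))"

definition copy_row_prog :: com where
  "copy_row_prog =
     For ''j'' (Const 0) (Var ''M'')
       copy_row_body"

text \<open>The single index \<open>x\<close> enumerates all cells of all children:
  \<open>x div g\<close> is the child, and \<open>x mod g\<close> splits into coordinate (quotient
  by \<open>h\<close>) and colour (remainder). Where child and coordinate agree, neighbours of the
  row's colour are erased; all else is copied from the parent.\<close>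

abbreviation children_body :: "com" where
  "children_body \<equiv>
     Cond (And (Eq (Div (Mod (Var ''x'') (Var ''g'')) (Var ''h'')) (Div (Var ''x'') (Var ''g'')))
                  (Eq (Elem ''H'' (Add (Mul (Elem ''cd'' (Div (Var ''x'') (Var ''g''))) (Var ''h''))
                                       (Mod (Mod (Var ''x'') (Var ''g'')) (Var ''h'')))) (Const 1)))
         (Store ''av'' (Add (Mul (Var ''ct'') (Var ''g'')) (Var ''x'')) (Const 0))
         (Store ''av'' (Add (Mul (Var ''ct'') (Var ''g'')) (Var ''x''))
            (Elem ''av'' (Add (Mul (Var ''p'') (Var ''g'')) (Mod (Var ''x'') (Var ''g'')))))"

definition children_prog :: com where
  "children_prog =
     For ''x'' (Const 0) (Mul (Var ''M'') (Var ''g''))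
       children_body"

definition fill_prog :: com where
  "fill_prog =
     Seq (Store ''fl'' (Var ''p'') (Add (Var ''i'') (Const 1)))
     (Seq copy_row_prog
     (Seq (Assign ''rc'' (Add (Var ''rc'') (Const 1)))
     (Seq children_prog
       (Assign ''ct'' (Add (Var ''ct'') (Var ''M''))))))"

definition node_prog :: com where
  "node_prog =
     Cond (Eq (Elem ''fl'' (Var ''p'')) (Add (Var ''i'') (Const 1))) Skip
       (Seq viable_prog (Cond (Eq (Var ''vb'') (Const 1)) fill_prog Skip))"

text \<open>The snapshot \<open>cn\<close> restricts the loop to nodes that existed before. Children
  created meanwhile need no visit: each has lost all neighbours of the row in its own
  coordinate.\<close>

definition insert_prog :: com where
  "insert_prog = Seq (Assign ''cn'' (Var ''ct'')) (For ''p'' (Const 0) (Var ''cn'') node_prog)"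

lemma written_by_insert [simp]:
  "wvars viable_prog = {''vb'', ''j'', ''ex'', ''a''}" "warrs viable_prog = {}"
  "wvars copy_row_prog = {''j''}" "warrs copy_row_prog = {''rw''}"
  "wvars children_prog = {''x''}" "warrs children_prog = {''av''}"
  "wvars fill_prog = {''j'', ''rc'', ''x'', ''ct''}" "warrs fill_prog = {''fl'', ''rw'', ''av''}"
  "wvars node_prog = {''vb'', ''j'', ''ex'', ''a'', ''rc'', ''x'', ''ct''}" "warrs node_prog = {''fl'', ''rw'', ''av''}"
  "wvars insert_prog = {''cn'', ''p'', ''vb'', ''j'', ''ex'', ''a'', ''rc'', ''x'', ''ct''}"
  "warrs insert_prog = {''fl'', ''rw'', ''av''}"
  by (auto simp: viable_prog_def copy_row_prog_def children_prog_def fill_prog_def node_prog_def insert_prog_def)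

lemma mult_add_div_mod:
  fixes y g l :: nat
  assumes "y < g"
  shows "(l * g + y) mod g = y" "(l * g + y) div g = l"
  using assms by simp_all

section \<open>One phase: inserting a row into the search tree\<close>

abbreviation phase_vars :: "vname set" where
  "phase_vars \<equiv> {''q1'', ''c'', ''ok'', ''z'', ''cn'', ''p'', ''vb'', ''j'', ''ex'', ''a'', ''rc'', ''x'', ''ct''}"

abbreviation phase_arrs :: "vname set" where
  "phase_arrs \<equiv> {''cd'', ''fl'', ''rw'', ''av''}"

text \<open>The word-size conditions come from addresses and loop limits. Rows and cuts of
  successive phases are stored one behind the other, whence the factor \<open>length vs + 2\<close>;
  \<open>(1 + K * Rm) * (K * h)\<close> bounds the availability table of one tree.\<close>

locale dp_problem = hom_problem +
  fixes w K d Rm :: nat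
  assumes K: "width G vs \<le> K" "1 \<le> K"
    and d: "\<And>l. half_induced adjH l {} \<Longrightarrow> l \<le> d"
    and Rm: "Rm = (\<Sum>t\<le>K * (d - 1). K ^ t)"
    and w: "length vs + 4 < 2 ^ w" "(length vs + 2) * (Rm * K) < 2 ^ w" "(length vs + 2) * K < 2 ^ w"
      "(1 + K * Rm) * (K * h) < 2 ^ w" "h * h < 2 ^ w" "1 + K * Rm < 2 ^ w" "K * (K * h) < 2 ^ w"
      "Rm + 1 < 2 ^ w" "K * h < 2 ^ w" "h < 2 ^ w" "K < 2 ^ w"

locale dp_phase = dp_problem +
  fixes i lb cb :: nat and R :: "nat list list" and s0 :: state
  assumes i: "i < length vs"
    and R: "represents i R" "length R \<le> Rm"
    and lb: "lb \<le> i * (Rm * K)" and cb: "cb \<le> i * K"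
    and vars0: "vars s0 ''h'' = h" "vars s0 ''i'' = i" "vars s0 ''v'' = vs ! i"
      "vars s0 ''m'' = length (cut i)" "vars s0 ''M'' = length (cut (Suc i))"
      "vars s0 ''g'' = length (cut (Suc i)) * h" "vars s0 ''nr'' = length R"
      "vars s0 ''lb'' = lb" "vars s0 ''l2'' = lb + length R * length (cut i)" "vars s0 ''cb'' = cb"
    and H0: "\<And>a b. a < h \<Longrightarrow> b < h \<Longrightarrow> arrs s0 ''H'' (a * h + b) = (if adjH a b then 1 else 0)"
    and ce0: "\<And>j. j < length (cut i) \<Longrightarrow> arrs s0 ''ce'' (cb + j) = snd (cut i ! j)"
begin

declare cut.simps [simp del]

abbreviation in_phase :: "state \<Rightarrow> bool" where
  "in_phase \<equiv> same_off phase_vars phase_arrs s0"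

abbreviation "m \<equiv> length (cut i)"
abbreviation "m2 \<equiv> length (cut (Suc i))"
abbreviation "l2 \<equiv> lb + length R * length (cut i)"

lemma w0: "w > 0"
  using w(1) by (cases w) auto

lemma w1: "4 < (2::nat) ^ w"
  using w(1) by linarith

lemma m_le: "m \<le> K" "m2 \<le> K"
  using length_cut_le[of i] length_cut_le[of "Suc i"] i K by simp_all

lemma phase_const:
  assumes "in_phase s"
  shows "vars s ''h'' = h" "vars s ''i'' = i" "vars s ''v'' = vs ! i"
    "vars s ''m'' = m" "vars s ''M'' = m2" "vars s ''g'' = m2 * h" "vars s ''nr'' = length R"
    "vars s ''lb'' = lb" "vars s ''l2'' = l2" "vars s ''cb'' = cb"
    "arrs s ''H'' = arrs s0 ''H''" "arrs s ''ce'' = arrs s0 ''ce''"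
  using assms vars0 by (simp_all add: same_off_def)

definition avail :: "(nat \<Rightarrow> nat) \<Rightarrow> nat \<Rightarrow> nat \<Rightarrow> nat set" where
  "avail f p j = {b. b < h \<and> f (p * (m2 * h) + (j * h + b)) = 1}"

lemma index_lt: "j < k \<Longrightarrow> b < h \<Longrightarrow> j * h + b < k * h" for j k b :: nat
proof -
  assume "j < k" "b < h"
  then have "j * h + b < Suc j * h" by simp
  also have "\<dots> \<le> k * h" using \<open>j < k\<close> by (intro mult_le_mono1) simp
  finally show ?thesis .
qed

lemma address_lt:
  assumes "p < N" "y < m2 * h"
  shows "p * (m2 * h) + y < N * (m2 * h)"
proof -
  have "p * (m2 * h) + y < Suc p * (m2 * h)" using assms by simp
  also have "\<dots> \<le> N * (m2 * h)" using assms by (intro mult_le_mono1) simp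
  finally show ?thesis .
qed

lemma address_fits:
  assumes "N \<le> 1 + K * Rm"
  shows "N * (m2 * h) < 2 ^ w"
proof -
  have "N * (m2 * h) \<le> (1 + K * Rm) * (K * h)"
    using assms m_le by (intro mult_le_mono) auto
  then show ?thesis using w(4) by linarith
qed

lemma wp_viable:
  assumes so: "in_phase s"
    and r: "length r = m2" "\<And>j. j < m2 \<Longrightarrow> arrs s ''cd'' j = r ! j" "\<And>j. j < m2 \<Longrightarrow> r ! j < h"
    and p: "vars s ''p'' = p" "p < 1 + K * Rm"
  shows "wp w viable_prog
    (\<lambda>t s'. t \<le> m2 * (4 * h + 7) + 3 \<and>
       vars s' ''vb'' = (if blocked adjH m2 (avail (arrs s ''av'') p) r then 0 else 1)) s"
proof -
  let ?av = "arrs s ''av''"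
  let ?A = "viable_test" and ?B = "viable_body"
  define s1 where "s1 = set_var ''vb'' 1 s"
  define J where "J j (s' :: state) \<longleftrightarrow> vars s' ''vb'' = (if \<exists>j'<j. \<forall>b\<in>avail ?av p j'. \<not> adjH (r ! j') b then 0 else 1)" for j s'
  define ok where "ok j a \<longleftrightarrow> (\<exists>b<a. adjH (r ! j) b \<and> b \<in> avail ?av p j)" for j a
  have so1: "in_phase s1" using so by (auto simp: s1_def same_off_def)
  have gw: "(p + 1) * (m2 * h) < 2 ^ w" by (rule address_fits) (use p in simp)
  have A: "wp w (For ''a'' (Const 0) (Var ''h'') ?A)
      (\<lambda>t s''. t \<le> (h - 0) * (2 + 2) + 2 \<and> vars s'' ''ex'' = (if ok j h then 1 else 0) \<and> vars s'' ''a'' = h) s'"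
    if j: "j < m2" "vars s' ''j'' = j" "vars s' ''ex'' = 0"
      and so': "same_off {''j'', ''ex'', ''a'', ''vb''} {} s1 s'" for s' :: state and j
  proof (rule wp_For_Var[where I = "\<lambda>a s''. vars s'' ''ex'' = (if ok j a then 1 else 0)"])
    fix a and s'' :: state
    assume a: "a < h" and I: "vars s'' ''ex'' = (if ok j a then 1 else 0)"
      and va: "vars s'' ''a'' = a" and so'': "loop_frame ''a'' ?A s' s''"
    have so2: "in_phase s''" using so1 so' so'' by (auto simp: same_off_def)
    have so3: "same_off {''j'', ''ex'', ''a'', ''vb''} {} s s''" using so' so'' by (auto simp: same_off_def s1_def)
    note c = phase_const[OF so2]
    have v: "vars s'' ''j'' = j" "vars s'' ''p'' = p" "arrs s'' = arrs s"
      using so'' so3 j p by (auto simp: same_off_def)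
    have Hj: "arrs s'' ''H'' (r ! j * h + a) = (if adjH (r ! j) a then 1 else 0)"
      unfolding c by (rule H0[OF r(3)[OF j(1)] a])
    have l1: "r ! j * h + a < h * h" by (rule index_lt[OF r(3)[OF j(1)] a])
    have l2: "p * (m2 * h) + (j * h + a) < (p + 1) * (m2 * h)" by (rule address_lt) (use index_lt[OF j(1) a] in auto)
    have ex: "ok j (Suc a) \<longleftrightarrow> ok j a \<or> adjH (r ! j) a \<and> ?av (p * (m2 * h) + (j * h + a)) = 1"
      using a by (auto simp: ok_def less_Suc_eq avail_def)
    show "wp w ?A (\<lambda>t s'''. t \<le> 2 \<and> vars (set_var ''a'' (Suc a) s''') ''ex'' =
        (if ok j (Suc a) then 1 else 0)) s''"
      unfolding ex using I va c(1,5,6) v Hj l1 l2 gw w(5) w1 r(2)[OF j(1)]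
      by (simp add: wp_simps)
  next
    show "vars s' ''h'' = h"
      using so' so1 vars0 by (simp add: same_off_def)
  qed (use w0 w(10) j in \<open>simp_all add: ok_def\<close>)
  have "wp w (For ''j'' (Const 0) (Var ''M'') ?B)
      (\<lambda>t s'. t \<le> (m2 - 0) * (4 * h + 5 + 2) + 2 \<and> J m2 s' \<and> vars s' ''j'' = m2) s1"
  proof (rule wp_For_Var)
    fix j and s' :: state assume j: "j < m2" and J: "J j s'" and vj: "vars s' ''j'' = j"
      and so': "loop_frame ''j'' ?B s1 s'"
    have E: "(\<forall>b\<in>avail ?av p j. \<not> adjH (r ! j) b) \<longleftrightarrow> \<not> ok j h"
      by (auto simp: ok_def avail_def)
    have S: "(\<exists>j'<Suc j. \<forall>b\<in>avail ?av p j'. \<not> adjH (r ! j') b) \<longleftrightarrow>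
        (\<exists>j'<j. \<forall>b\<in>avail ?av p j'. \<not> adjH (r ! j') b) \<or> \<not> ok j h"
      unfolding E[symmetric] by (auto simp: less_Suc_eq)
    have so2: "same_off {''j'', ''ex'', ''a'', ''vb''} {} s1 (set_var ''ex'' 0 s')"
      using so' by (auto simp: same_off_def)
    show "wp w ?B (\<lambda>t s''. t \<le> 4 * h + 5 \<and> J (Suc j) (set_var ''j'' (Suc j) s'')) s'"
      unfolding wp_Seq wp_Assign
    proof (intro conjI)
      show "fits w (Const 0) s'" by simp
      show "wp w (For ''a'' (Const 0) (Var ''h'') ?A)
        (\<lambda>t. wp w (Cond (Eq (Var ''ex'') (Const 0)) (Assign ''vb'' (Const 0)) Skip)
           (\<lambda>t' s''. 1 + (t + t') \<le> 4 * h + 5 \<and> J (Suc j) (set_var ''j'' (Suc j) s'')))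
        (set_var ''ex'' (eval (Const 0) s') s')"
      proof (rule wp_use[OF A[OF j]])
        fix t s'' assume "t \<le> (h - 0) * (2 + 2) + 2 \<and> vars s'' ''ex'' = (if ok j h then 1 else 0) \<and> vars s'' ''a'' = h"
          and so3: "same_off (wvars (For ''a'' (Const 0) (Var ''h'') ?A)) (warrs (For ''a'' (Const 0) (Var ''h'') ?A)) (set_var ''ex'' (eval (Const 0) s') s') s''"
        moreover have "vars s'' ''vb'' = vars s' ''vb''" using so3 by (simp add: same_off_def)
        ultimately show "wp w (Cond (Eq (Var ''ex'') (Const 0)) (Assign ''vb'' (Const 0)) Skip)
           (\<lambda>t' s''. 1 + (t + t') \<le> 4 * h + 5 \<and> J (Suc j) (set_var ''j'' (Suc j) s'')) s''"
          using J unfolding J_def S by (simp add: wp_simps)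
      qed (use vj so2 in simp_all)
    qed
  next
    show "vars s1 ''M'' = m2"
      using so1 vars0 by (simp add: same_off_def)
  qed (use w0 w(11) m_le in \<open>simp_all add: J_def s1_def\<close>)
  then have *: "wp w (For ''j'' (Const 0) (Var ''M'') ?B)
      (\<lambda>t s'. t \<le> m2 * (4 * h + 7) + 2 \<and>
         vars s' ''vb'' = (if blocked adjH m2 (avail ?av p) r then 0 else 1)) s1"
    by (rule wp_mono) (auto simp: J_def blocked_def algebra_simps)
  show ?thesis
    unfolding viable_prog_def wp_Seq wp_Assign
    using w1 wp_mono[OF *] by (simp add: s1_def)
qed

lemma wp_copy_row:
  assumes so: "in_phase s"
    and rc: "vars s ''rc'' = k" "k < Rm"
  shows "wp w copy_row_prog
    (\<lambda>t s'. t \<le> m2 * 3 + 2 \<and> (\<forall>j<m2. arrs s' ''rw'' (l2 + (k * m2 + j)) = arrs s ''cd'' j) \<and>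
       (\<forall>x<l2 + k * m2. arrs s' ''rw'' x = arrs s ''rw'' x)) s"
proof -
  let ?B = "copy_row_body"
  define J where "J j (s' :: state) \<longleftrightarrow> (\<forall>j'<j. arrs s' ''rw'' (l2 + (k * m2 + j')) = arrs s ''cd'' j') \<and>
       (\<forall>x<l2 + k * m2. arrs s' ''rw'' x = arrs s ''rw'' x)" for j s'
  \<comment> \<open>Three blocks precede the end of the new row: the storage of at most
    \<open>i\<close> earlier phases, the current rows, and the new rows. Together these are at most
    \<open>i + 2\<close> times \<open>Rm * K\<close>.\<close>
  have fit: "l2 + (k * m2 + m2) < 2 ^ w"
  proof -
    have "k * m2 + m2 = Suc k * m2" by simp
    also have "\<dots> \<le> Rm * K" using rc m_le by (intro mult_le_mono) auto
    finally have "k * m2 + m2 \<le> Rm * K" .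
    moreover have "length R * m \<le> Rm * K" using R(2) m_le by (intro mult_le_mono) auto
    moreover have "i * (Rm * K) + Rm * K + Rm * K \<le> (length vs + 2) * (Rm * K)"
      using i by (simp add: algebra_simps)
    ultimately show ?thesis using lb w(2) by linarith
  qed
  have "wp w (For ''j'' (Const 0) (Var ''M'') ?B)
      (\<lambda>t s'. t \<le> (m2 - 0) * (1 + 2) + 2 \<and> J m2 s' \<and> vars s' ''j'' = m2) s"
  proof (rule wp_For_Var)
    fix j and s' :: state assume j: "j < m2" "vars s' ''j'' = j" and J: "J j s'"
      and so': "loop_frame ''j'' ?B s s'"
    have so1: "in_phase s'" using so so' by (auto simp: same_off_def)
    have "vars s' ''rc'' = k" "arrs s' ''cd'' = arrs s ''cd''" using so' rc by (auto simp: same_off_def)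
    then show "wp w ?B (\<lambda>t s''. t \<le> 1 \<and> J (Suc j) (set_var ''j'' (Suc j) s'')) s'"
      using phase_const[OF so1] J j fit by (auto simp: wp_simps J_def less_Suc_eq)
  next
    show "vars s ''M'' = m2"
      using so vars0 by (simp add: same_off_def)
  qed (use w0 w(11) m_le in \<open>simp_all add: J_def\<close>)
  then show ?thesis
    unfolding copy_row_prog_def by (rule wp_mono) (simp add: J_def)
qed

lemma wp_children:
  assumes so: "in_phase s"
    and r: "length r = m2" "\<And>j. j < m2 \<Longrightarrow> arrs s ''cd'' j = r ! j" "\<And>j. j < m2 \<Longrightarrow> r ! j < h"
    and p: "vars s ''p'' = p" "p < ct" and ct: "vars s ''ct'' = ct" "ct + m2 \<le> 1 + K * Rm"
  shows "wp w children_prog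
    (\<lambda>t s'. t \<le> m2 * (m2 * h) * 4 + 2 \<and>
       (\<forall>q<ct. \<forall>j<m2. avail (arrs s' ''av'') q j = avail (arrs s ''av'') q j) \<and>
       (\<forall>l<m2. \<forall>j<m2. avail (arrs s' ''av'') (ct + l) j =
          (if j = l then {b \<in> avail (arrs s ''av'') p j. \<not> adjH (r ! j) b} else avail (arrs s ''av'') p j))) s"
proof -
  let ?g = "m2 * h"
  let ?av = "arrs s ''av''"
  let ?B = "children_body"
  define new where "new x = (if x mod ?g div h = x div ?g \<and> adjH (r ! (x div ?g)) (x mod ?g mod h) then 0
      else ?av (p * ?g + x mod ?g))" for x
  define J where "J x (s' :: state) \<longleftrightarrow> (\<forall>y<x. arrs s' ''av'' (ct * ?g + y) = new y) \<and>
      (\<forall>y<ct * ?g. arrs s' ''av'' y = ?av y)" for x s'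
  have fit: "(ct + m2) * ?g < 2 ^ w" by (rule address_fits[OF ct(2)])
  have fit': "m2 * ?g < 2 ^ w" "h < 2 ^ w"
  proof -
    have "m2 * ?g \<le> K * (K * h)" using m_le by (intro mult_le_mono) auto
    then show "m2 * ?g < 2 ^ w" using w(7) by linarith
  qed (rule w(10))
  have "wp w (For ''x'' (Const 0) (Mul (Var ''M'') (Var ''g'')) ?B)
      (\<lambda>t s'. t \<le> (m2 * ?g - 0) * (2 + 2) + 2 \<and> J (m2 * ?g) s' \<and> vars s' ''x'' = m2 * ?g) s"
  proof (rule wp_For)
    fix x and s' :: state assume x: "x < m2 * ?g" "vars s' ''x'' = x" and J: "J x s'"
      and so': "loop_frame ''x'' ?B s s'"
    have so1: "in_phase s'" using so so' by (auto simp: same_off_def)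
    have v: "vars s' ''ct'' = ct" "vars s' ''p'' = p" "arrs s' ''cd'' = arrs s ''cd''"
      using so' p ct by (auto simp: same_off_def)
    have h0: "0 < h" "0 < ?g" using x by (auto intro!: Nat.gr0I)
    have xd: "x div ?g < m2" using x(1) by (rule less_mult_imp_div_less)
    have xm: "x mod ?g mod h < h" "x mod ?g < ?g" using h0 by simp_all
    have Hx: "arrs s' ''H'' (r ! (x div ?g) * h + x mod ?g mod h) = (if adjH (r ! (x div ?g)) (x mod ?g mod h) then 1 else 0)"
      unfolding phase_const[OF so1] by (rule H0[OF r(3)[OF xd] xm(1)])
    have l1: "r ! (x div ?g) * h + x mod ?g mod h < h * h" by (rule index_lt[OF r(3)[OF xd] xm(1)])
    have l2: "p * ?g + x mod ?g < ct * ?g" by (rule address_lt[OF p(2) xm(2)])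
    have l3: "ct * ?g + x < (ct + m2) * ?g" using x by (simp add: algebra_simps)
    have avp: "arrs s' ''av'' (p * ?g + x mod ?g) = ?av (p * ?g + x mod ?g)" using J l2 unfolding J_def by blast
    have J': "J (Suc x) (set_var ''x'' (Suc x) (s'\<lparr>arrs := (arrs s')(''av'' := (arrs s' ''av'')(ct * ?g + x := new x))\<rparr>))"
      using J unfolding J_def by (auto simp: less_Suc_eq)
    have "ct * ?g < 2 ^ w" "p * ?g + x mod ?g < 2 ^ w" "p * ?g < 2 ^ w" "ct * ?g + x < 2 ^ w"
      "r ! (x div ?g) * h + x mod ?g mod h < 2 ^ w" "r ! (x div ?g) * h < 2 ^ w" "(0::nat) < 2 ^ w" "(1::nat) < 2 ^ w"
      using fit l3 l2 l1 w(5) w1 by linarith+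
    note fits' = this
    show "wp w ?B (\<lambda>t s''. t \<le> 2 \<and> J (Suc x) (set_var ''x'' (Suc x) s'')) s'"
    proof (cases "x mod ?g div h = x div ?g \<and> adjH (r ! (x div ?g)) (x mod ?g mod h)")
      case True
      then have "new x = 0" by (simp add: new_def)
      then show ?thesis
        using True fits' J' Hx v phase_const(1,6)[OF so1] r(2)[OF xd] x(2) by (simp add: wp_simps)
    next
      case False
      have "new x = ?av (p * ?g + x mod ?g)" unfolding new_def by (rule if_not_P[OF False])
      then show ?thesis
        using False fits' J' Hx v phase_const(1,6)[OF so1] r(2)[OF xd] x(2) avp by (auto simp: wp_simps)
    qed
  next
    show "fits w (Mul (Var ''M'') (Var ''g'')) s' \<and> eval (Mul (Var ''M'') (Var ''g'')) s' = m2 * ?g"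
      if "loop_frame ''x'' ?B s s'" for s'
      using that so vars0 fit' by (simp add: same_off_def)
  qed (use w0 fit' in \<open>simp_all add: J_def\<close>)
  then show ?thesis
    unfolding children_prog_def
  proof (rule wp_mono)
    fix t s' assume a: "t \<le> (m2 * ?g - 0) * (2 + 2) + 2 \<and> J (m2 * ?g) s' \<and> vars s' ''x'' = m2 * ?g"
    then have J1: "\<And>y. y < m2 * ?g \<Longrightarrow> arrs s' ''av'' (ct * ?g + y) = new y"
      and J2: "\<And>y. y < ct * ?g \<Longrightarrow> arrs s' ''av'' y = ?av y"
      unfolding J_def by blast+
    have "avail (arrs s' ''av'') q j = avail ?av q j" if "q < ct" "j < m2" for q j
      unfolding avail_def using J2[OF address_lt[OF that(1) index_lt[OF that(2)]]] by auto
    moreover have "avail (arrs s' ''av'') (ct + l) j =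
          (if j = l then {b \<in> avail ?av p j. \<not> adjH (r ! j) b} else avail ?av p j)" if lj: "l < m2" "j < m2" for l j
    proof -
      have "arrs s' ''av'' ((ct + l) * ?g + (j * h + b)) =
          (if j = l \<and> adjH (r ! l) b then 0 else ?av (p * ?g + (j * h + b)))" if b: "b < h" for b
      proof -
        have jb: "j * h + b < ?g" by (rule index_lt[OF lj(2) b])
        have "l * ?g + (j * h + b) < m2 * ?g" by (rule address_lt[OF lj(1) jb])
        from J1[OF this] have "arrs s' ''av'' ((ct + l) * ?g + (j * h + b)) = new (l * ?g + (j * h + b))"
          by (simp add: add_mult_distrib add.assoc)
        moreover have "(l * ?g + (j * h + b)) mod ?g = j * h + b" "(l * ?g + (j * h + b)) div ?g = l"
          by (fact mult_add_div_mod[OF jb])+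
        moreover have "(j * h + b) div h = j" "(j * h + b) mod h = b" using b by simp_all
        ultimately show ?thesis unfolding new_def by simp
      qed
      then show ?thesis unfolding avail_def by (auto split: if_splits)
    qed
    ultimately show "t \<le> m2 * ?g * 4 + 2 \<and>
       (\<forall>q<ct. \<forall>j<m2. avail (arrs s' ''av'') q j = avail ?av q j) \<and>
       (\<forall>l<m2. \<forall>j<m2. avail (arrs s' ''av'') (ct + l) j =
          (if j = l then {b \<in> avail ?av p j. \<not> adjH (r ! j) b} else avail ?av p j))"
      using a by auto
  qed
qed

text \<open>The two bounds on \<open>fl\<close> replace clearing: flags of earlier phases are at
  most \<open>i\<close>, so fresh nodes count as unfilled. The fourth conjunct keeps the rows of the
  current cut intact, from which further candidates are still to be read.\<close>

definition tstate :: "nat list set \<Rightarrow> state \<Rightarrow> nat list list \<Rightarrow> bool" where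
  "tstate T s R' \<longleftrightarrow>
     tree_inv adjH h m2 T (vars s ''ct'') (\<lambda>p. arrs s ''fl'' p = Suc i) (avail (arrs s ''av'')) R' \<and>
     vars s ''rc'' = length R' \<and>
     (\<forall>q<length R'. \<forall>j<m2. arrs s ''rw'' (l2 + (q * m2 + j)) = R' ! q ! j) \<and>
     (\<forall>q<length R. \<forall>j<m. arrs s ''rw'' (lb + (q * m + j)) = R ! q ! j) \<and>
     (\<forall>r\<in>T. length r = m2) \<and>
     (\<forall>p. arrs s ''fl'' p \<le> Suc i) \<and> (\<forall>p\<ge>vars s ''ct''. arrs s ''fl'' p \<le> i)"

lemma tstateD:
  assumes "tstate T s R'"
  shows "tree_inv adjH h m2 T (vars s ''ct'') (\<lambda>p. arrs s ''fl'' p = Suc i) (avail (arrs s ''av'')) R'"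
    "vars s ''rc'' = length R'"
    "q < length R' \<Longrightarrow> j < m2 \<Longrightarrow> arrs s ''rw'' (l2 + (q * m2 + j)) = R' ! q ! j"
    "q < length R \<Longrightarrow> j < m \<Longrightarrow> arrs s ''rw'' (lb + (q * m + j)) = R ! q ! j"
    "r \<in> T \<Longrightarrow> length r = m2"
    "arrs s ''fl'' p \<le> Suc i" "p \<ge> vars s ''ct'' \<Longrightarrow> arrs s ''fl'' p \<le> i"
  using assms unfolding tstate_def by blast+

lemma length_le_Rm: "tree_inv adjH h m2 T ct f Y R' \<Longrightarrow> length R' \<le> Rm"
  unfolding Rm by (rule tree_inv_length_le[OF _ d m_le(2)])

lemma tstate_bounds:
  assumes "tstate T s R'"
  shows "length R' \<le> Rm" "vars s ''ct'' \<le> 1 + K * Rm"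
proof -
  note t = tstateD(1)[OF assms]
  show le: "length R' \<le> Rm" by (rule length_le_Rm[OF t])
  have "m2 * length R' \<le> K * Rm" by (rule mult_le_mono[OF m_le(2) le])
  then show "vars s ''ct'' \<le> 1 + K * Rm" using tree_invD(3)[OF t] by linarith
qed

lemma tstate_cong:
  assumes "tstate T s R'" "vars s' ''ct'' = vars s ''ct''" "vars s' ''rc'' = vars s ''rc''"
    "arrs s' ''fl'' = arrs s ''fl''" "arrs s' ''av'' = arrs s ''av''" "arrs s' ''rw'' = arrs s ''rw''"
  shows "tstate T s' R'"
  using assms unfolding tstate_def by simp

definition filled :: "nat \<Rightarrow> nat list \<Rightarrow> state \<Rightarrow> state \<Rightarrow> bool" where
  "filled p r s s' \<longleftrightarrow>
     vars s' ''ct'' = vars s ''ct'' + m2 \<and> arrs s' ''fl'' = (arrs s ''fl'')(p := Suc i) \<and>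
     (\<forall>q<vars s ''ct''. \<forall>j<m2. avail (arrs s' ''av'') q j = avail (arrs s ''av'') q j) \<and>
     (\<forall>l<m2. \<forall>j<m2. avail (arrs s' ''av'') (vars s ''ct'' + l) j =
        (if j = l then {b \<in> avail (arrs s ''av'') p j. \<not> adjH (r ! j) b} else avail (arrs s ''av'') p j))"

lemma wp_fill:
  assumes so: "in_phase s" and t: "tstate T s R'"
    and rT: "r \<in> T" and r: "\<And>j. j < m2 \<Longrightarrow> arrs s ''cd'' j = r ! j" "\<And>j. j < m2 \<Longrightarrow> r ! j < h"
    and p: "vars s ''p'' = p" "p < vars s ''ct''" "arrs s ''fl'' p \<noteq> Suc i" "\<not> blocked adjH m2 (avail (arrs s ''av'') p) r"
  shows "wp w fill_prog (\<lambda>t s'. t \<le> m2 * (m2 * h) * 4 + m2 * 3 + 7 \<and> tstate T s' (R' @ [r]) \<and> filled p r s s') s"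
proof -
  define ct where "ct = vars s ''ct''"
  define k where "k = length R'"
  note T = tstateD[OF t]
  have len: "length r = m2" by (rule T(5)[OF rT])
  have rc: "vars s ''rc'' = k" using T(2) by (simp add: k_def)
  have inv: "tree_inv adjH h m2 T ct (\<lambda>p. arrs s ''fl'' p = Suc i) (avail (arrs s ''av'')) R'"
    using T(1) by (simp add: ct_def)
  have pct: "p < ct" using p by (simp add: ct_def)
  \<comment> \<open>Stated for any table \<open>Y\<close> with the right values, because it is used
    for an abstract tree before the arrays change and for the actual arrays afterwards.\<close>
  have new: "tree_inv adjH h m2 T (ct + m2) (\<lambda>q. ((arrs s ''fl'')(p := Suc i)) q = Suc i) Y (R' @ [r])"
    if Y: "\<And>q j. q < ct \<Longrightarrow> j < m2 \<Longrightarrow> Y q j = avail (arrs s ''av'') q j"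
      "\<And>l j. l < m2 \<Longrightarrow> j < m2 \<Longrightarrow> Y (ct + l) j =
          (if j = l then {b \<in> avail (arrs s ''av'') p j. \<not> adjH (r ! j) b} else avail (arrs s ''av'') p j)" for Y
  proof (rule tree_inv_fill[OF inv rT len pct p(3,4) _ _ Y])
    fix l assume "l < m2"
    have "arrs s ''fl'' (ct + l) \<le> i" by (rule T(7)) (simp add: ct_def)
    then show "((arrs s ''fl'')(p := Suc i)) (ct + l) \<noteq> Suc i" using pct by simp
  qed simp_all
  \<comment> \<open>The enlarged tree is exhibited abstractly first. Its size bound gives
    \<open>k < Rm\<close>, without which the addresses of the new row and of the children could not
    be shown to fit.\<close>
  have "tree_inv adjH h m2 T (ct + m2) (\<lambda>q. ((arrs s ''fl'')(p := Suc i)) q = Suc i)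
      (\<lambda>q j. if q < ct then avail (arrs s ''av'') q j else
         if j = q - ct then {b \<in> avail (arrs s ''av'') p j. \<not> adjH (r ! j) b} else avail (arrs s ''av'') p j) (R' @ [r])"
    by (rule new) auto
  from length_le_Rm[OF this] have kR: "k < Rm" by (simp add: k_def)
  have "m2 * Suc k \<le> K * Rm" using m_le kR by (intro mult_le_mono) auto
  then have ctb: "ct + m2 \<le> 1 + K * Rm" using tree_invD(3)[OF inv] by (simp add: k_def)
  note c = phase_const[OF so]
  define s1 where "s1 = s\<lparr>arrs := (arrs s)(''fl'' := (arrs s ''fl'')(p := Suc i))\<rparr>"
  have so1: "in_phase s1" using so by (auto simp: s1_def same_off_def)
  have s1: "vars s1 = vars s" "arrs s1 ''rw'' = arrs s ''rw''" "arrs s1 ''cd'' = arrs s ''cd''" "arrs s1 ''av'' = arrs s ''av''"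
      "arrs s1 ''fl'' = (arrs s ''fl'')(p := Suc i)"
    by (simp_all add: s1_def)
  let ?Q = "\<lambda>t s'. t \<le> m2 * (m2 * h) * 4 + m2 * 3 + 7 \<and> tstate T s' (R' @ [r]) \<and> filled p r s s'"
  have main: "wp w copy_row_prog (\<lambda>t1. wp w (Seq (Assign ''rc'' (Add (Var ''rc'') (Const 1)))
       (Seq children_prog (Assign ''ct'' (Add (Var ''ct'') (Var ''M''))))) (\<lambda>t2. ?Q (1 + (t1 + t2)))) s1"
  proof (rule wp_use[OF wp_copy_row[OF so1, of k]])
    show "vars s1 ''rc'' = k" "k < Rm" using rc kR s1 by simp_all
    fix t1 s2
    assume 2: "t1 \<le> m2 * 3 + 2 \<and> (\<forall>j<m2. arrs s2 ''rw'' (l2 + (k * m2 + j)) = arrs s1 ''cd'' j) \<and>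
       (\<forall>x<l2 + k * m2. arrs s2 ''rw'' x = arrs s1 ''rw'' x)"
      and so2: "frame copy_row_prog s1 s2"
    define s3 where "s3 = set_var ''rc'' (Suc k) s2"
    have so3: "in_phase s3" using so1 so2 by (auto simp: s3_def same_off_def)
    have s3: "vars s3 ''p'' = p" "vars s3 ''ct'' = ct" "arrs s3 ''cd'' = arrs s ''cd''" "arrs s3 ''av'' = arrs s ''av''"
        "arrs s3 ''fl'' = (arrs s ''fl'')(p := Suc i)" "arrs s3 ''rw'' = arrs s2 ''rw''" "vars s3 ''rc'' = Suc k"
      using so2 s1 p by (simp_all add: s3_def same_off_def ct_def)
    have ch: "wp w children_prog (\<lambda>t3. wp w (Assign ''ct'' (Add (Var ''ct'') (Var ''M''))) (\<lambda>t4. ?Q (1 + (t1 + (1 + (t3 + t4)))))) s3"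
    proof (rule wp_use[OF wp_children[OF so3 len _ r(2) s3(1) pct s3(2) ctb]])
      show "arrs s3 ''cd'' j = r ! j" if "j < m2" for j using r(1)[OF that] s3 by simp
      fix t3 s4
      assume 4: "t3 \<le> m2 * (m2 * h) * 4 + 2 \<and>
       (\<forall>q<ct. \<forall>j<m2. avail (arrs s4 ''av'') q j = avail (arrs s3 ''av'') q j) \<and>
       (\<forall>l<m2. \<forall>j<m2. avail (arrs s4 ''av'') (ct + l) j =
          (if j = l then {b \<in> avail (arrs s3 ''av'') p j. \<not> adjH (r ! j) b} else avail (arrs s3 ''av'') p j))"
        and so4: "frame children_prog s3 s4"
      define s5 where "s5 = set_var ''ct'' (ct + m2) s4"
      have s5: "vars s5 ''ct'' = ct + m2" "vars s5 ''rc'' = Suc k" "arrs s5 ''fl'' = (arrs s ''fl'')(p := Suc i)"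
          "arrs s5 ''rw'' = arrs s2 ''rw''" "arrs s5 ''av'' = arrs s4 ''av''"
        using so4 s3 by (simp_all add: s5_def same_off_def)
      have s4: "vars s4 ''ct'' = ct" "vars s4 ''M'' = m2"
        using so4 s3 phase_const[OF so3] by (simp_all add: same_off_def)
      have Y1: "avail (arrs s5 ''av'') q j = avail (arrs s ''av'') q j" if "q < ct" "j < m2" for q j
        using 4 that s3 s5 by simp
      have Y2: "avail (arrs s5 ''av'') (ct + l) j =
          (if j = l then {b \<in> avail (arrs s ''av'') p j. \<not> adjH (r ! j) b} else avail (arrs s ''av'') p j)"
        if "l < m2" "j < m2" for l j
        using 4 that s3 s5 by simp
      have "tstate T s5 (R' @ [r])"
        unfolding tstate_def
      proof (intro conjI allI ballI impI)
        show "tree_inv adjH h m2 T (vars s5 ''ct'') (\<lambda>p. arrs s5 ''fl'' p = Suc i) (avail (arrs s5 ''av'')) (R' @ [r])"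
          unfolding s5(1,3) by (rule new) (fact Y1, fact Y2)
        show "vars s5 ''rc'' = length (R' @ [r])" using s5 by (simp add: k_def)
        fix q j
        show "arrs s5 ''rw'' (l2 + (q * m2 + j)) = (R' @ [r]) ! q ! j" if q: "q < length (R' @ [r])" and j: "j < m2"
        proof (cases "q < k")
          case True
          have "q * m2 + j < Suc q * m2" using j by simp
          also have "\<dots> \<le> k * m2" using True by (intro mult_le_mono1) simp
          finally have "arrs s2 ''rw'' (l2 + (q * m2 + j)) = arrs s ''rw'' (l2 + (q * m2 + j))"
            using 2 s1 by simp
          then show ?thesis using T(3)[of q j] True j s5 by (simp add: k_def nth_append)
        next
          case False
          then have "q = k" using q by (simp add: k_def)
          then show ?thesis using 2 j s1 s5 r(1)[OF j] by (simp add: k_def)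
        qed
        show "arrs s5 ''rw'' (lb + (q * m + j)) = R ! q ! j" if q: "q < length R" and j: "j < m"
        proof -
          have "q * m + j < Suc q * m" using j by simp
          also have "\<dots> \<le> length R * m" using q by (intro mult_le_mono1) simp
          finally have "arrs s2 ''rw'' (lb + (q * m + j)) = arrs s ''rw'' (lb + (q * m + j))"
            using 2 s1 by simp
          then show ?thesis using T(4)[OF q j] s5 by simp
        qed
        show "length r = m2" if "r \<in> T" for r by (rule T(5)[OF that])
        show "arrs s5 ''fl'' p' \<le> Suc i" for p' using T(6)[of p'] s5 by simp
        show "arrs s5 ''fl'' p' \<le> i" if "p' \<ge> vars s5 ''ct''" for p'
          using that T(7)[of p'] s5 pct by (simp add: ct_def)
      qed
      moreover have "ct + m2 < 2 ^ w" using ctb w(6) by linarith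
      ultimately show "wp w (Assign ''ct'' (Add (Var ''ct'') (Var ''M''))) (\<lambda>t4. ?Q (1 + (t1 + (1 + (t3 + t4))))) s4"
        using Y1 Y2 2 4 s4 s5(1,3) by (simp add: wp_simps filled_def s5_def[symmetric] ct_def[symmetric])
    qed
    have "vars s2 ''rc'' = k" using so2 s1 rc by (simp add: same_off_def)
    then show "wp w (Seq (Assign ''rc'' (Add (Var ''rc'') (Const 1)))
       (Seq children_prog (Assign ''ct'' (Add (Var ''ct'') (Var ''M''))))) (\<lambda>t2. ?Q (1 + (t1 + t2))) s2"
      unfolding wp_Seq wp_Assign[of _ "''rc''"] using ch kR w(8) w1 by (simp add: s3_def)
  qed
  have "i + 1 < 2 ^ w" using i w(1) by linarith
  then show ?thesis
    unfolding fill_prog_def wp_Seq[of w "Store a b c" for a b c] wp_Seq[of w copy_row_prog] wp_Store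
    using main c p(1) w1 by (simp add: s1_def)
qed

definition node_time :: nat where
  "node_time = m2 * (m2 * h) * 4 + m2 * 3 + m2 * (4 * h + 7) + 12"

text \<open>The row \<open>r\<close> is settled at unfilled nodes already visited
  (\<open>q < p\<close>) and at those created by this insertion (\<open>cn \<le> q\<close>); all
  rows inserted earlier are settled everywhere.\<close>

definition insert_inv :: "nat list set \<Rightarrow> nat list \<Rightarrow> nat \<Rightarrow> nat \<Rightarrow> state \<Rightarrow> bool" where
  "insert_inv S r cn p s \<longleftrightarrow> (\<exists>R'. tstate (insert r S) s R') \<and> cn \<le> vars s ''ct'' \<and>
     (\<forall>q<vars s ''ct''. arrs s ''fl'' q \<noteq> Suc i \<longrightarrow>
        (\<forall>r'\<in>S. blocked adjH m2 (avail (arrs s ''av'') q) r') \<and>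
        (q < p \<or> cn \<le> q \<longrightarrow> blocked adjH m2 (avail (arrs s ''av'') q) r))"

lemma wp_node:
  assumes so: "in_phase s" and I: "insert_inv S r cn p s"
    and r: "\<And>j. j < m2 \<Longrightarrow> arrs s ''cd'' j = r ! j" "\<And>j. j < m2 \<Longrightarrow> r ! j < h"
    and p: "vars s ''p'' = p" "p < cn"
  shows "wp w node_prog (\<lambda>t s'. t \<le> node_time \<and> insert_inv S r cn (Suc p) s') s"
proof -
  from I obtain R' where t: "tstate (insert r S) s R'" unfolding insert_inv_def by blast
  from I have ct: "cn \<le> vars s ''ct''"
    and bS: "\<And>q r'. q < vars s ''ct'' \<Longrightarrow> arrs s ''fl'' q \<noteq> Suc i \<Longrightarrow> r' \<in> S \<Longrightarrow> blocked adjH m2 (avail (arrs s ''av'') q) r'"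
    and br: "\<And>q. q < vars s ''ct'' \<Longrightarrow> arrs s ''fl'' q \<noteq> Suc i \<Longrightarrow> q < p \<or> cn \<le> q \<Longrightarrow> blocked adjH m2 (avail (arrs s ''av'') q) r"
    unfolding insert_inv_def by blast+
  have len: "length r = m2" by (rule tstateD(5)[OF t]) simp
  have pct: "p < vars s ''ct''" using p ct by simp
  have pb: "p < 1 + K * Rm" using pct tstate_bounds(2)[OF t] by simp
  have iw: "i + 1 < 2 ^ w" using i w(1) by linarith
  note c = phase_const[OF so]
  show ?thesis
  proof (cases "arrs s ''fl'' p = Suc i")
    case True
    have "insert_inv S r cn (Suc p) s"
      using I True unfolding insert_inv_def by (auto simp: less_Suc_eq)
    then show ?thesis unfolding node_prog_def using True p c iw w1
      by (simp add: wp_simps node_time_def)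
  next
    case unf: False
    have main: "wp w viable_prog (\<lambda>t1. wp w (Cond (Eq (Var ''vb'') (Const 1)) fill_prog Skip)
        (\<lambda>t2 s'. t1 + t2 + 1 \<le> node_time \<and> insert_inv S r cn (Suc p) s')) s"
    proof (rule wp_use[OF wp_viable[OF so len r p(1) pb]])
      fix t1 s1
      assume 1: "t1 \<le> m2 * (4 * h + 7) + 3 \<and> vars s1 ''vb'' = (if blocked adjH m2 (avail (arrs s ''av'') p) r then 0 else 1)"
        and so1: "frame viable_prog s s1"
      have so2: "in_phase s1" using so so1 by (auto simp: same_off_def)
      have s1: "arrs s1 = arrs s" "vars s1 ''ct'' = vars s ''ct''" "vars s1 ''rc'' = vars s ''rc''" "vars s1 ''p'' = p"
        using so1 p by (auto simp: same_off_def)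
      have t1: "tstate (insert r S) s1 R'" by (rule tstate_cong[OF t]) (simp_all add: s1)
      show "wp w (Cond (Eq (Var ''vb'') (Const 1)) fill_prog Skip)
        (\<lambda>t2 s'. t1 + t2 + 1 \<le> node_time \<and> insert_inv S r cn (Suc p) s') s1"
      proof (cases "blocked adjH m2 (avail (arrs s ''av'') p) r")
        case True
        have "insert_inv S r cn (Suc p) s1"
          using I True t1 unfolding insert_inv_def s1 by (auto simp: less_Suc_eq)
        then show ?thesis using 1 True w1 by (simp add: wp_simps node_time_def)
      next
        case False
        have "wp w fill_prog (\<lambda>t2 s'. t1 + (t2 + 1) + 1 \<le> node_time \<and> insert_inv S r cn (Suc p) s') s1"
        proof (rule wp_mono[OF wp_fill[OF so2 t1, of r p]])
          fix t2 s2
          assume "t2 \<le> m2 * (m2 * h) * 4 + m2 * 3 + 7 \<and> tstate (insert r S) s2 (R' @ [r]) \<and> filled p r s1 s2"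
          note 2 = this[unfolded filled_def]
          have old: "avail (arrs s2 ''av'') q j = avail (arrs s ''av'') q j" if "q < vars s ''ct''" "j < m2" for q j
            using 2 that unfolding s1 by blast
          have child: "avail (arrs s2 ''av'') (vars s ''ct'' + l) j =
                (if j = l then {b \<in> avail (arrs s ''av'') p j. \<not> adjH (r ! j) b} else avail (arrs s ''av'') p j)"
            if "l < m2" "j < m2" for l j
            using 2 that unfolding s1 by blast
          have "insert_inv S r cn (Suc p) s2"
            unfolding insert_inv_def
          proof (intro conjI allI impI ballI)
            show "\<exists>R'. tstate (insert r S) s2 R'" using 2 by blast
            show "cn \<le> vars s2 ''ct''" using 2 ct s1 by simp
            fix q assume q: "q < vars s2 ''ct''" "arrs s2 ''fl'' q \<noteq> Suc i"
            have cases: thesis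
              if "q < vars s ''ct'' \<Longrightarrow> q \<noteq> p \<Longrightarrow> arrs s ''fl'' q \<noteq> Suc i \<Longrightarrow> thesis"
                "\<And>l. l < m2 \<Longrightarrow> q = vars s ''ct'' + l \<Longrightarrow> thesis" for thesis
            proof (cases "q < vars s ''ct''")
              case True
              then show ?thesis using that(1) q(2) 2 s1 by (auto split: if_splits)
            next
              case False
              then show ?thesis using that(2)[of "q - vars s ''ct''"] q(1) 2 s1 by simp
            qed
            show "blocked adjH m2 (avail (arrs s2 ''av'') q) r'" if "r' \<in> S" for r'
            proof (rule cases)
              assume 1: "q < vars s ''ct''" "q \<noteq> p" "arrs s ''fl'' q \<noteq> Suc i"
              show ?thesis by (rule blocked_mono[OF bS[OF 1(1,3) that]]) (simp add: old[OF 1(1)])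
            next
              fix l assume 2: "l < m2" "q = vars s ''ct'' + l"
              \<comment> \<open>Children inherit rejections from \<open>p\<close>, which was
                unfilled and hence blocked for every earlier row.\<close>
              show ?thesis by (rule blocked_mono[OF bS[OF pct unf that]]) (auto simp: child[OF 2(1)] 2(2) split: if_splits)
            qed
            show "blocked adjH m2 (avail (arrs s2 ''av'') q) r" if "q < Suc p \<or> cn \<le> q"
            proof (rule cases)
              assume 1: "q < vars s ''ct''" "q \<noteq> p" "arrs s ''fl'' q \<noteq> Suc i"
              show ?thesis by (rule blocked_mono[OF br[OF 1(1,3)]]) (use that 1(2) in \<open>auto simp: old[OF 1(1)]\<close>)
            next
              fix l assume 2: "l < m2" "q = vars s ''ct'' + l"
              \<comment> \<open>Coordinate \<open>l\<close> of child \<open>l\<close> contains no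
                neighbour of \<open>r ! l\<close> any more.\<close>
              show ?thesis unfolding blocked_def 2(2) using 2(1) child[OF 2(1,1)] by (intro exI[of _ l]) auto
            qed
          qed
          then show "t1 + (t2 + 1) + 1 \<le> node_time \<and> insert_inv S r cn (Suc p) s2"
            using 1 2 by (simp add: node_time_def)
        qed (use False unf r pct s1 in simp_all)
        then show ?thesis using 1 False w1 by (simp add: wp_Cond)
      qed
    qed
    then show ?thesis unfolding node_prog_def using unf p c iw w1 by (simp add: wp_Cond wp_Seq)
  qed
qed

text \<open>The second conjunct is the hypothesis under which \<open>tree_inv_represents\<close>
  lets the stored rows stand for all of \<open>S\<close>.\<close>

definition phase_inv :: "nat list set \<Rightarrow> state \<Rightarrow> bool" where
  "phase_inv S s \<longleftrightarrow> (\<exists>R'. tstate S s R') \<and>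
     (\<forall>q<vars s ''ct''. arrs s ''fl'' q \<noteq> Suc i \<longrightarrow> (\<forall>r\<in>S. blocked adjH m2 (avail (arrs s ''av'') q) r))"

lemma phase_inv_cong:
  assumes "phase_inv S s" "vars s' ''ct'' = vars s ''ct''" "vars s' ''rc'' = vars s ''rc''"
    "arrs s' ''fl'' = arrs s ''fl''" "arrs s' ''av'' = arrs s ''av''" "arrs s' ''rw'' = arrs s ''rw''"
  shows "phase_inv S s'"
  using assms(1) tstate_cong[OF _ assms(2-6)] unfolding phase_inv_def assms(2,4,5) by blast

definition insert_time :: nat where
  "insert_time = (1 + K * Rm) * (node_time + 2) + 3"

lemma wp_insert:
  assumes so: "in_phase s" and I: "phase_inv S s" and len: "length r = m2"
    and r: "\<And>j. j < m2 \<Longrightarrow> arrs s ''cd'' j = r ! j" "\<And>j. j < m2 \<Longrightarrow> r ! j < h"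
  shows "wp w insert_prog (\<lambda>t s'. t \<le> insert_time \<and> phase_inv (insert r S) s') s"
proof -
  obtain R' where t: "tstate S s R'" using I unfolding phase_inv_def by blast
  define cn where "cn = vars s ''ct''"
  define s1 where "s1 = set_var ''cn'' cn s"
  have so1: "in_phase s1" using so by (auto simp: s1_def same_off_def)
  have cnb: "cn \<le> 1 + K * Rm" using tstate_bounds[OF t] by (simp add: cn_def)
  have cong: "insert_inv S r cn p (set_var ''p'' v s') \<longleftrightarrow> insert_inv S r cn p s'" for p v s'
    unfolding insert_inv_def tstate_def by simp
  have "wp w (For ''p'' (Const 0) (Var ''cn'') node_prog)
      (\<lambda>t s'. t \<le> (cn - 0) * (node_time + 2) + 2 \<and> insert_inv S r cn cn s' \<and> vars s' ''p'' = cn) s1"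
  proof (rule wp_For_Var[where I = "\<lambda>p. insert_inv S r cn p"])
    fix p and s' :: state assume p: "p < cn" "insert_inv S r cn p s'" "vars s' ''p'' = p"
      and so': "loop_frame ''p'' node_prog s1 s'"
    have so2: "in_phase s'" using so1 so' by (auto simp: same_off_def)
    have cd: "arrs s' ''cd'' = arrs s ''cd''" using so' by (simp add: same_off_def s1_def)
    have "wp w node_prog (\<lambda>t s'. t \<le> node_time \<and> insert_inv S r cn (Suc p) s') s'"
      by (rule wp_node[OF so2 p(2) _ r(2) p(3,1)]) (simp_all add: cd r(1))
    then show "wp w node_prog (\<lambda>t s''. t \<le> node_time \<and> insert_inv S r cn (Suc p) (set_var ''p'' (Suc p) s'')) s'"
      unfolding cong .
  next
    have "tree_inv adjH h m2 (insert r S) (vars s ''ct'') (\<lambda>p. arrs s ''fl'' p = Suc i) (avail (arrs s ''av'')) R'"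
      by (rule tree_inv_superset[OF tstateD(1)[OF t]]) auto
    then have "tstate (insert r S) s R'" using t len unfolding tstate_def by blast
    then have "tstate (insert r S) s1 R'" by (rule tstate_cong) (simp_all add: s1_def)
    then show "insert_inv S r cn 0 (set_var ''p'' 0 s1)"
      unfolding cong unfolding insert_inv_def using I unfolding phase_inv_def by (auto simp: s1_def cn_def)
    show "vars s1 ''cn'' = cn"
      by (simp add: same_off_def s1_def)
    show "cn < 2 ^ w" using cnb w(6) by linarith
  qed (use w0 in simp_all)
  then have "wp w (For ''p'' (Const 0) (Var ''cn'') node_prog)
      (\<lambda>t s'. 1 + t \<le> insert_time \<and> phase_inv (insert r S) s') s1"
  proof (rule wp_mono)
    fix t s' assume a: "t \<le> (cn - 0) * (node_time + 2) + 2 \<and> insert_inv S r cn cn s' \<and> vars s' ''p'' = cn"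
    have "cn * (node_time + 2) \<le> (1 + K * Rm) * (node_time + 2)" using cnb by (rule mult_le_mono1)
    then have "1 + t \<le> insert_time" using a by (simp add: insert_time_def)
    moreover have "blocked adjH m2 (avail (arrs s' ''av'') q) r'"
      if "q < vars s' ''ct''" "arrs s' ''fl'' q \<noteq> Suc i" "r' \<in> insert r S" for q r'
      using a that unfolding insert_inv_def by (metis insertE not_less)
    moreover have "\<exists>R'. tstate (insert r S) s' R'" using a unfolding insert_inv_def by blast
    ultimately show "1 + t \<le> insert_time \<and> phase_inv (insert r S) s'"
      unfolding phase_inv_def by blast
  qed
  then show ?thesis
    unfolding insert_prog_def wp_Seq wp_Assign by (simp add: s1_def cn_def)
qed

end

section \<open>One phase: generating all candidate rows\<close>

abbreviation keep_body :: "com" where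
  "keep_body \<equiv>
     Cond (Eq (Elem ''ce'' (Add (Var ''cb'') (Var ''j''))) (Var ''v''))
         (Cond (Eq (Elem ''H'' (Add (Mul (Elem ''rw'' (Add (Var ''lb'') (Add (Mul (Var ''q1'') (Var ''m'')) (Var ''j'')))) (Var ''h'')) (Var ''c''))) (Const 1))
           Skip (Assign ''ok'' (Const 0)))
         (Seq (Store ''cd'' (Var ''z'') (Elem ''rw'' (Add (Var ''lb'') (Add (Mul (Var ''q1'') (Var ''m'')) (Var ''j'')))))
           (Assign ''z'' (Add (Var ''z'') (Const 1))))"

text \<open>One pass serves two purposes: entries of edges ending at the new vertex are tested
  against its colour, the other ones are collected as the beginning of the next row.\<close>

definition keep_prog :: com where
  "keep_prog =
     For ''j'' (Const 0) (Var ''m'')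
       keep_body"

abbreviation pad_body :: "com" where
  "pad_body \<equiv>
     Store ''cd'' (Var ''j'') (Var ''c'')"

definition pad_prog :: com where
  "pad_prog = For ''j'' (Var ''z'') (Var ''M'') pad_body"

definition cand_prog :: com where
  "cand_prog =
     Seq (Assign ''ok'' (Const 1)) (Seq (Assign ''z'' (Const 0)) (Seq keep_prog (Seq pad_prog
       (Cond (Eq (Var ''ok'') (Const 1)) insert_prog Skip))))"

definition phase_prog :: com where
  "phase_prog = For ''q1'' (Const 0) (Var ''nr'') (For ''c'' (Const 0) (Var ''h'') cand_prog)"

lemma written_by_phase [simp]:
  "wvars keep_prog = {''j'', ''ok'', ''z''}" "warrs keep_prog = {''cd''}"
  "wvars pad_prog = {''j''}" "warrs pad_prog = {''cd''}"
  "wvars cand_prog = {''ok'', ''z'', ''cn'', ''p'', ''vb'', ''j'', ''ex'', ''a'', ''rc'', ''x'', ''ct''}"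
  "warrs cand_prog = {''cd'', ''fl'', ''rw'', ''av''}"
  "wvars phase_prog = phase_vars" "warrs phase_prog = phase_arrs"
  by (auto simp: keep_prog_def pad_prog_def cand_prog_def phase_prog_def)

context dp_phase
begin

lemma row_entries:
  assumes "r \<in> set R"
  shows "length r = m" "a \<in> set r \<Longrightarrow> a < h"
proof -
  obtain \<phi> where \<phi>: "part_hom i \<phi>" "r = row i \<phi>" using R(1) assms unfolding represents_def by blast
  then show "length r = m" by (simp add: row_def)
  assume "a \<in> set r"
  then obtain e where e: "e \<in> set (cut i)" "a = \<phi> (fst e)" unfolding \<phi>(2) row_def by auto
  then have "fst e \<in> set (take i vs)" using cut_spec[of i] i by auto
  then show "a < h" using \<phi>(1) e(2) unfolding part_hom_def by blast
qed

lemma row_address: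
  assumes "q < length R" "j < m"
  shows "lb + (q * m + j) < 2 ^ w"
proof -
  have "q * m + j < Suc q * m" using assms by simp
  also have "\<dots> \<le> Rm * K" using assms R(2) m_le by (intro mult_le_mono) auto
  finally have "lb + (q * m + j) \<le> i * (Rm * K) + Rm * K" using lb by linarith
  also have "\<dots> = Suc i * (Rm * K)" by simp
  also have "\<dots> \<le> (length vs + 2) * (Rm * K)" using i by (intro mult_le_mono1) simp
  finally show ?thesis using w(2) by linarith
qed

definition kept :: "nat list \<Rightarrow> nat \<Rightarrow> nat list" where
  "kept r j = map fst (filter (\<lambda>(a, e). snd e \<noteq> vs ! i) (take j (zip r (cut i))))"

lemma kept_Suc:
  assumes "length r = m" "j < m"
  shows "kept r (Suc j) = kept r j @ (if snd (cut i ! j) = vs ! i then [] else [r ! j])"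
  using assms by (simp add: kept_def take_Suc_conv_app_nth)

lemma length_kept: "length (kept r j) \<le> j"
  unfolding kept_def by (simp, rule order.trans[OF length_filter_le]) simp

lemma next_row_kept: "length r = m \<Longrightarrow> next_row i r c = kept r m @ replicate (length (later i)) c"
  by (simp add: next_row_def kept_def)

lemma wp_keep:
  assumes so: "in_phase s"
    and rw: "\<And>j. j < m \<Longrightarrow> arrs s ''rw'' (lb + (q * m + j)) = r ! j" and q: "vars s ''q1'' = q" "q < length R"
    and r: "length r = m" "\<And>j. j < m \<Longrightarrow> r ! j < h" and c: "vars s ''c'' = c" "c < h"
    and s: "vars s ''ok'' = 1" "vars s ''z'' = 0"
  shows "wp w keep_prog
    (\<lambda>t s'. t \<le> m * 5 + 2 \<and> vars s' ''ok'' = (if extendable i r c then 1 else 0) \<and>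
       vars s' ''z'' = length (kept r m) \<and> (\<forall>y<length (kept r m). arrs s' ''cd'' y = kept r m ! y)) s"
proof -
  let ?B = "keep_body"
  define ok where "ok j \<longleftrightarrow> (\<forall>j'<j. snd (cut i ! j') = vs ! i \<longrightarrow> adjH (r ! j') c)" for j
  define J where "J j (s' :: state) \<longleftrightarrow> vars s' ''ok'' = (if ok j then 1 else 0) \<and>
       vars s' ''z'' = length (kept r j) \<and> (\<forall>y<length (kept r j). arrs s' ''cd'' y = kept r j ! y)" for j s'
  have "wp w (For ''j'' (Const 0) (Var ''m'') ?B)
      (\<lambda>t s'. t \<le> (m - 0) * (3 + 2) + 2 \<and> J m s' \<and> vars s' ''j'' = m) s"
  proof (rule wp_For_Var)
    fix j and s' :: state assume j: "j < m" "vars s' ''j'' = j" and J: "J j s'"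
      and so': "loop_frame ''j'' ?B s s'"
    have so1: "in_phase s'" using so so' by (auto simp: same_off_def)
    have v: "vars s' ''q1'' = q" "vars s' ''c'' = c" "arrs s' ''rw'' = arrs s ''rw''"
      using so' q c by (auto simp: same_off_def)
    have ad: "lb + (q * m + j) < 2 ^ w" by (rule row_address[OF q(2) j(1)])
    have cbj: "cb + j < 2 ^ w"
    proof -
      have "Suc i * K \<le> (length vs + 2) * K" using i by (intro mult_le_mono1) simp
      then have "i * K + K \<le> (length vs + 2) * K" by simp
      then show ?thesis using cb j m_le w(3) by linarith
    qed
    have ce: "arrs s' ''ce'' (cb + j) = snd (cut i ! j)" using phase_const[OF so1] ce0[OF j(1)] by simp
    have Hj: "arrs s' ''H'' (r ! j * h + c) = (if adjH (r ! j) c then 1 else 0)"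
      unfolding phase_const[OF so1] by (rule H0[OF r(2)[OF j(1)] c(2)])
    have l1: "r ! j * h + c < 2 ^ w" using index_lt[OF r(2)[OF j(1)] c(2)] w(5) by linarith
    have z: "length (kept r j) + 1 < 2 ^ w"
    proof -
      have "length (kept r j) + 1 \<le> K" using length_kept[of r j] j m_le by linarith
      then show ?thesis using w(11) by linarith
    qed
    show "wp w ?B (\<lambda>t s''. t \<le> 3 \<and> J (Suc j) (set_var ''j'' (Suc j) s'')) s'"
    proof (cases "snd (cut i ! j) = vs ! i")
      case True
      have "ok (Suc j) \<longleftrightarrow> ok j \<and> adjH (r ! j) c" using True by (auto simp: ok_def less_Suc_eq)
      then show ?thesis
        using True J v phase_const[OF so1] ce Hj l1 ad cbj j rw[OF j(1)] kept_Suc[OF r(1) j(1)] w1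
        by (auto simp: wp_simps J_def)
    next
      case False
      have "ok (Suc j) \<longleftrightarrow> ok j" using False by (auto simp: ok_def less_Suc_eq)
      then show ?thesis
        using False J v phase_const[OF so1] ce ad cbj j rw[OF j(1)] kept_Suc[OF r(1) j(1)] w1 z
        by (auto simp: wp_simps J_def nth_append less_Suc_eq)
    qed
  next
    show "vars s ''m'' = m"
      using so vars0 by (simp add: same_off_def)
    show "m < 2 ^ w" using m_le w(11) by linarith
    show "J 0 (set_var ''j'' 0 s)" using s by (simp add: J_def ok_def kept_def)
  qed (use w0 in simp_all)
  then show ?thesis
    unfolding keep_prog_def by (rule wp_mono) (simp add: J_def ok_def extendable_def)
qed

lemma wp_pad:
  assumes so: "in_phase s"
    and c: "vars s ''c'' = c" and z: "vars s ''z'' = length (kept r m)"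
    and cd: "\<forall>y<length (kept r m). arrs s ''cd'' y = kept r m ! y"
    and r: "length r = m" "length (next_row i r c) = m2"
  shows "wp w pad_prog (\<lambda>t s'. t \<le> m2 * 3 + 2 \<and> (\<forall>y<m2. arrs s' ''cd'' y = next_row i r c ! y)) s"
proof -
  let ?B = "pad_body"
  note nr = next_row_kept[OF r(1), of c]
  have zle: "length (kept r m) \<le> m2" using r(2) unfolding nr by simp
  have "wp w (For ''j'' (Var ''z'') (Var ''M'') ?B)
      (\<lambda>t s'. t \<le> (m2 - length (kept r m)) * (1 + 2) + 2 \<and> (\<forall>y<m2. arrs s' ''cd'' y = next_row i r c ! y) \<and> vars s' ''j'' = m2) s"
  proof (rule wp_For_Var[where I = "\<lambda>j s'. \<forall>y<j. arrs s' ''cd'' y = next_row i r c ! y"])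
    fix j and s' :: state assume j: "length (kept r m) \<le> j" "j < m2" "vars s' ''j'' = j"
      and J: "\<forall>y<j. arrs s' ''cd'' y = next_row i r c ! y"
      and so': "loop_frame ''j'' ?B s s'"
    have "next_row i r c ! j = c" using j r(2) unfolding nr by (simp add: nth_append)
    moreover have "vars s' ''c'' = c" using so' c by (simp add: same_off_def)
    ultimately show "wp w ?B (\<lambda>t s''. t \<le> 1 \<and> (\<forall>y<Suc j. arrs (set_var ''j'' (Suc j) s'') ''cd'' y = next_row i r c ! y)) s'"
      using J j by (auto simp: wp_simps less_Suc_eq)
  next
    show "vars s ''M'' = m2"
      using so vars0 by (simp add: same_off_def)
    show "m2 < 2 ^ w" using m_le w(11) by linarith
    show "\<forall>y<length (kept r m). arrs (set_var ''j'' (length (kept r m)) s) ''cd'' y = next_row i r c ! y"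
      using cd unfolding nr by (simp add: nth_append)
  qed (use w0 z zle in simp_all)
  then show ?thesis
    unfolding pad_prog_def by (rule wp_mono) auto
qed

definition cand_time :: nat where
  "cand_time = m * 5 + m2 * 3 + 7 + insert_time"

lemma wp_cand:
  assumes so: "in_phase s" and I: "phase_inv S s"
    and q: "vars s ''q1'' = q" "q < length R" and c: "vars s ''c'' = c" "c < h"
  shows "wp w cand_prog
    (\<lambda>t s'. t \<le> cand_time \<and>
       phase_inv (if extendable i (R ! q) c then insert (next_row i (R ! q) c) S else S) s') s"
proof -
  define r where "r = R ! q"
  have rR: "r \<in> set R" using q by (simp add: r_def)
  note r = row_entries[OF rR]
  have rh: "r ! j < h" if "j < m" for j using r(2)[of "r ! j"] that r(1) by simp
  have len: "length (next_row i r c) = m2" by (rule length_next_row(2)[OF i R(1) rR])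
  have nh: "next_row i r c ! j < h" if "j < m2" for j
  proof -
    have "set (next_row i r c) \<subseteq> set r \<union> {c}"
      unfolding next_row_def by (auto dest: set_zip_leftD)
    moreover have "next_row i r c ! j \<in> set (next_row i r c)" by (rule nth_mem) (simp add: that len)
    ultimately have "next_row i r c ! j \<in> set r \<union> {c}" by (rule subsetD)
    then show ?thesis using r(2) c(2) by auto
  qed
  obtain R' where t: "tstate S s R'" using I unfolding phase_inv_def by blast
  define s1 where "s1 = set_var ''z'' 0 (set_var ''ok'' 1 s)"
  have so1: "in_phase s1" using so by (auto simp: s1_def same_off_def)
  have I1: "phase_inv S s1" by (rule phase_inv_cong[OF I]) (simp_all add: s1_def)
  have main: "wp w (Seq keep_prog (Seq pad_prog (Cond (Eq (Var ''ok'') (Const 1)) insert_prog Skip)))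
     (\<lambda>t s'. t + 2 \<le> cand_time \<and> phase_inv (if extendable i r c then insert (next_row i r c) S else S) s') s1"
    unfolding wp_Seq
  proof (rule wp_use[OF wp_keep[OF so1, of q r c]])
    show "arrs s1 ''rw'' (lb + (q * m + j)) = r ! j" if "j < m" for j
      using tstateD(4)[OF t q(2) that] by (simp add: s1_def r_def)
    fix t1 s2
    assume 2: "t1 \<le> m * 5 + 2 \<and> vars s2 ''ok'' = (if extendable i r c then 1 else 0) \<and>
       vars s2 ''z'' = length (kept r m) \<and> (\<forall>y<length (kept r m). arrs s2 ''cd'' y = kept r m ! y)"
      and so2: "frame keep_prog s1 s2"
    have so2': "in_phase s2" using so1 so2 by (auto simp: same_off_def)
    have c2: "vars s2 ''c'' = c" using so2 c by (simp add: same_off_def s1_def)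
    show "wp w pad_prog (\<lambda>t'. wp w (Cond (Eq (Var ''ok'') (Const 1)) insert_prog Skip)
       (\<lambda>t'' s'. t1 + (t' + t'') + 2 \<le> cand_time \<and> phase_inv (if extendable i r c then insert (next_row i r c) S else S) s')) s2"
    proof (rule wp_use[OF wp_pad[OF so2' c2 _ _ r(1) len]])
      fix t2 s3
      assume 3: "t2 \<le> m2 * 3 + 2 \<and> (\<forall>y<m2. arrs s3 ''cd'' y = next_row i r c ! y)"
        and so3: "frame pad_prog s2 s3"
      have so3': "in_phase s3" using so2' so3 by (auto simp: same_off_def)
      have I3: "phase_inv S s3"
        by (rule phase_inv_cong[OF I1]) (use so2 so3 in \<open>simp_all add: same_off_def\<close>)
      have ok3: "vars s3 ''ok'' = (if extendable i r c then 1 else 0)" using 2 so3 by (simp add: same_off_def)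
      show "wp w (Cond (Eq (Var ''ok'') (Const 1)) insert_prog Skip)
         (\<lambda>t'' s'. t1 + (t2 + t'') + 2 \<le> cand_time \<and> phase_inv (if extendable i r c then insert (next_row i r c) S else S) s') s3"
      proof (cases "extendable i r c")
        case False
        then show ?thesis using ok3 I3 2 3 w1 by (simp add: wp_simps cand_time_def insert_time_def)
      next
        case True
        have "wp w insert_prog (\<lambda>t'' s'. t1 + (t2 + (t'' + 1)) + 2 \<le> cand_time \<and> phase_inv (insert (next_row i r c) S) s') s3"
        proof (rule wp_mono[OF wp_insert[OF so3' I3 len _ nh]])
          show "arrs s3 ''cd'' j = next_row i r c ! j" if "j < m2" for j using 3 that by blast
          show "t1 + (t2 + (t'' + 1)) + 2 \<le> cand_time \<and> phase_inv (insert (next_row i r c) S) s'"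
            if "t'' \<le> insert_time \<and> phase_inv (insert (next_row i r c) S) s'" for t'' s'
            using that 2 3 unfolding cand_time_def by simp
        qed
        then show ?thesis using True ok3 w1 by (simp add: wp_Cond)
      qed
    qed (use 2 in simp_all)
  qed (use q c r(1) rh in \<open>simp_all add: s1_def\<close>)
  show ?thesis
    unfolding cand_prog_def wp_Seq[of w "Assign a b" for a b] wp_Assign
    using main w1 by (cases "extendable i (R ! q) c") (simp_all add: s1_def r_def)
qed

text \<open>The candidates that precede the pair \<open>(q, c)\<close> in lexicographic order, which
  is the invariant of the two nested loops.\<close>

definition cands :: "nat \<Rightarrow> nat \<Rightarrow> nat list set" where
  "cands q c = {next_row i (R ! q') c' |q' c'. (q' < q \<or> q' = q \<and> c' < c) \<and> q' < length R \<and> c' < h \<and> extendable i (R ! q') c'}"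

lemma cands_Suc:
  assumes "q < length R" "c < h"
  shows "cands q (Suc c) = (if extendable i (R ! q) c then insert (next_row i (R ! q) c) (cands q c) else cands q c)"
  using assms unfolding cands_def by (auto simp: less_Suc_eq)

lemma cands_next: "cands q h = cands (Suc q) 0"
  unfolding cands_def by (auto simp: less_Suc_eq)

lemma cands_0: "cands 0 0 = {}"
  unfolding cands_def by auto

lemma cands_all: "cands (length R) 0 = candidates i R"
proof
  show "cands (length R) 0 \<subseteq> candidates i R" unfolding cands_def candidates_def
    using nth_mem[of _ R] by blast
  show "candidates i R \<subseteq> cands (length R) 0"
  proof
    fix x assume "x \<in> candidates i R"
    then obtain r c where x: "x = next_row i r c" "r \<in> set R" "c < h" "extendable i r c"
      unfolding candidates_def by blast
    then obtain q where "q < length R" "r = R ! q" by (metis in_set_conv_nth)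
    then show "x \<in> cands (length R) 0" using x unfolding cands_def by blast
  qed
qed

lemma wp_phase:
  assumes so: "in_phase s" and I: "phase_inv {} s"
  shows "wp w phase_prog
    (\<lambda>t s'. t \<le> length R * (h * (cand_time + 2) + 4) + 2 \<and> phase_inv (candidates i R) s') s"
proof -
  let ?C = "For ''c'' (Const 0) (Var ''h'') cand_prog"
  have cong: "phase_inv S (set_var v k s') \<longleftrightarrow> phase_inv S s'" if "v \<noteq> ''ct''" "v \<noteq> ''rc''" for S v k s'
    unfolding phase_inv_def tstate_def using that by simp
  have inner: "wp w ?C (\<lambda>t s''. t \<le> (h - 0) * (cand_time + 2) + 2 \<and> phase_inv (cands q h) s'' \<and> vars s'' ''c'' = h) s'"
    if so': "in_phase s'" and I': "phase_inv (cands q 0) s'" and q: "vars s' ''q1'' = q" "q < length R" for s' q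
  proof (rule wp_For_Var[where I = "\<lambda>c. phase_inv (cands q c)"])
    fix c and s'' :: state
    assume c: "c < h" "phase_inv (cands q c) s''" "vars s'' ''c'' = c"
      and so'': "loop_frame ''c'' cand_prog s' s''"
    have so2: "in_phase s''" using so' so'' by (auto simp: same_off_def)
    have q2: "vars s'' ''q1'' = q" using so'' q by (simp add: same_off_def)
    show "wp w cand_prog (\<lambda>t s'''. t \<le> cand_time \<and> phase_inv (cands q (Suc c)) (set_var ''c'' (Suc c) s''')) s''"
      unfolding cands_Suc[OF q(2) c(1)]
      using wp_cand[OF so2 c(2) q2 q(2) c(3,1)] by (simp add: cong)
  next
    show "vars s' ''h'' = h"
      using so' vars0 by (simp add: same_off_def)
  qed (use w0 w(10) I' in \<open>simp_all add: cong\<close>)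
  have "wp w (For ''q1'' (Const 0) (Var ''nr'') ?C)
    (\<lambda>t s'. t \<le> (length R - 0) * (h * (cand_time + 2) + 2 + 2) + 2 \<and> phase_inv (cands (length R) 0) s' \<and> vars s' ''q1'' = length R) s"
  proof (rule wp_For_Var[where I = "\<lambda>q. phase_inv (cands q 0)"])
    fix q and s' :: state
    assume q: "q < length R" "phase_inv (cands q 0) s'" "vars s' ''q1'' = q"
      and so': "loop_frame ''q1'' ?C s s'"
    have so2: "in_phase s'" using so so' by (auto simp: same_off_def)
    show "wp w ?C (\<lambda>t s''. t \<le> h * (cand_time + 2) + 2 \<and> phase_inv (cands (Suc q) 0) (set_var ''q1'' (Suc q) s'')) s'"
      by (rule wp_mono[OF inner[OF so2 q(2,3,1)]]) (simp add: cong cands_next)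
  next
    show "vars s ''nr'' = length R"
      using so vars0 by (simp add: same_off_def)
    show "length R < 2 ^ w" using R(2) w(8) by linarith
  qed (use w0 I in \<open>simp_all add: cong cands_0\<close>)
  then show ?thesis
    unfolding phase_prog_def cands_all by (rule wp_mono) (auto simp: algebra_simps)
qed

lemma phase_result:
  assumes "phase_inv (candidates i R) s"
  obtains R' where "represents (Suc i) R'" "length R' \<le> Rm" "vars s ''rc'' = length R'"
    "\<And>q j. q < length R' \<Longrightarrow> j < m2 \<Longrightarrow> arrs s ''rw'' (l2 + (q * m2 + j)) = R' ! q ! j"
    "\<And>p. arrs s ''fl'' p \<le> Suc i"
proof -
  from assms obtain R' where t: "tstate (candidates i R) s R'" unfolding phase_inv_def by blast
  note T = tstateD[OF t]
  have "represents (Suc i) R'"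
  proof (rule represents_Suc[OF i R(1) tree_invD(1)[OF T(1)]])
    fix r y assume r: "r \<in> candidates i R" "compat adjH r y"
    show "\<exists>r'\<in>set R'. compat adjH r' y"
      by (rule tree_inv_represents[OF T(1) _ r(1) T(5)[OF r(1)] r(2)])
        (use assms adjH_lt in \<open>auto simp: phase_inv_def\<close>)
  qed
  then show thesis
    using that tstate_bounds(1)[OF t] T(2,3,6) by blast
qed

end

section \<open>From one cut to the next, and the sweep over all vertices\<close>

abbreviation old_cut_body :: "com" where
  "old_cut_body \<equiv>
     Cond (Eq (Elem ''ce'' (Add (Var ''cb'') (Var ''j''))) (Var ''v'')) Skip
         (Seq (Store ''ce'' (Add (Var ''c2'') (Var ''M'')) (Elem ''ce'' (Add (Var ''cb'') (Var ''j''))))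
           (Assign ''M'' (Add (Var ''M'') (Const 1))))"

definition old_cut_prog :: com where
  "old_cut_prog =
     For ''j'' (Const 0) (Var ''m'')
       old_cut_body"

text \<open>The new vertex is marked in \<open>vis\<close> beforehand, so the unmarked neighbours
  are exactly \<open>later i\<close>, met in the same order.\<close>

abbreviation new_cut_body :: "com" where
  "new_cut_body \<equiv>
     Cond (Eq (Elem ''vis'' (Elem ''nbr'' (Var ''j''))) (Const 0))
         (Seq (Store ''ce'' (Add (Var ''c2'') (Var ''M'')) (Elem ''nbr'' (Var ''j'')))
           (Assign ''M'' (Add (Var ''M'') (Const 1)))) Skip"

definition new_cut_prog :: com where
  "new_cut_prog =
     For ''j'' (Elem ''off'' (Var ''v'')) (Elem ''off'' (Add (Var ''v'') (Const 1)))
       new_cut_body"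

abbreviation init_tree_body :: "com" where
  "init_tree_body \<equiv>
     Store ''av'' (Var ''x'') (Const 1)"

definition init_tree_prog :: com where
  "init_tree_prog = For ''x'' (Const 0) (Var ''g'') init_tree_body"

definition dp_step :: com where
  "dp_step =
     Seq (Assign ''v'' (Elem ''ord'' (Var ''i'')))
     (Seq (Store ''vis'' (Var ''v'') (Const 1))
     (Seq (Assign ''M'' (Const 0))
     (Seq (Assign ''c2'' (Add (Var ''cb'') (Var ''m'')))
     (Seq old_cut_prog
     (Seq new_cut_prog
     (Seq (Assign ''g'' (Mul (Var ''M'') (Var ''h'')))
     (Seq (Assign ''ct'' (Const 1))
     (Seq init_tree_prog
     (Seq (Assign ''rc'' (Const 0))
     (Seq (Assign ''l2'' (Add (Var ''lb'') (Mul (Var ''nr'') (Var ''m''))))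
     (Seq phase_prog
     (Seq (Assign ''lb'' (Var ''l2''))
     (Seq (Assign ''nr'' (Var ''rc''))
     (Seq (Assign ''cb'' (Var ''c2''))
       (Assign ''m'' (Var ''M''))))))))))))))))"

definition dp_prog :: com where
  "dp_prog =
     Seq (Assign ''m'' (Const 0)) (Seq (Assign ''lb'' (Const 0)) (Seq (Assign ''cb'' (Const 0)) (Seq (Assign ''nr'' (Const 1))
     (Seq (For ''i'' (Const 0) (Var ''n'') dp_step)
       (Cond (Eq (Var ''nr'') (Const 0)) Skip (Assign ''out'' (Const 1)))))))"

abbreviation step_vars :: "vname set" where
  "step_vars \<equiv> phase_vars \<union> {''v'', ''M'', ''c2'', ''g'', ''l2'', ''lb'', ''nr'', ''cb'', ''m''}"

abbreviation step_arrs :: "vname set" where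
  "step_arrs \<equiv> phase_arrs \<union> {''vis'', ''ce''}"

lemma written_by_step [simp]:
  "wvars old_cut_prog = {''j'', ''M''}" "warrs old_cut_prog = {''ce''}"
  "wvars new_cut_prog = {''j'', ''M''}" "warrs new_cut_prog = {''ce''}"
  "wvars init_tree_prog = {''x''}" "warrs init_tree_prog = {''av''}"
  "wvars dp_step = step_vars" "warrs dp_step = step_arrs"
  by (auto simp: old_cut_prog_def new_cut_prog_def init_tree_prog_def dp_step_def)

locale dp_input = dp_problem +
  fixes s0 :: state and L :: "nat \<Rightarrow> nat"
  assumes hn: "vars s0 ''h'' = h" "vars s0 ''n'' = length vs"
    and ord_arr: "\<And>i. i < length vs \<Longrightarrow> arrs s0 ''ord'' i = vs ! i"
    and off_arr: "\<And>u. u \<le> length adj \<Longrightarrow> arrs s0 ''off'' u = L u"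
    and L_Suc: "\<And>u. u < length adj \<Longrightarrow> L (Suc u) = L u + length (adj ! u)"
    and L_fits: "\<And>u. u \<le> length adj \<Longrightarrow> L u < 2 ^ w"
    and nbr_arr: "\<And>u j. u < length adj \<Longrightarrow> j < length (adj ! u) \<Longrightarrow> arrs s0 ''nbr'' (L u + j) = adj ! u ! j"
    and H_arr: "\<And>a b. a < h \<Longrightarrow> b < h \<Longrightarrow> arrs s0 ''H'' (a * h + b) = (if adjH a b then 1 else 0)"
begin

declare cut.simps [simp del]

text \<open>The bounds on \<open>lb\<close> and \<open>cb\<close> say that every phase has used at
  most one block of size \<open>Rm * K\<close> or \<open>K\<close>. The bound on \<open>fl\<close>
  makes all old flags differ from the mark \<open>i + 1\<close> of the coming phase.\<close>

definition dp_inv :: "nat \<Rightarrow> state \<Rightarrow> bool" where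
  "dp_inv i s \<longleftrightarrow> (\<exists>R. represents i R \<and> length R \<le> Rm \<and> vars s ''nr'' = length R \<and>
      (\<forall>q<length R. \<forall>j<length (cut i). arrs s ''rw'' (vars s ''lb'' + (q * length (cut i) + j)) = R ! q ! j)) \<and>
     vars s ''lb'' \<le> i * (Rm * K) \<and> vars s ''cb'' \<le> i * K \<and> vars s ''m'' = length (cut i) \<and>
     (\<forall>j<length (cut i). arrs s ''ce'' (vars s ''cb'' + j) = snd (cut i ! j)) \<and>
     (\<forall>u<length adj. arrs s ''vis'' u = (if u \<in> set (take i vs) then 1 else 0)) \<and>
     (\<forall>p. arrs s ''fl'' p \<le> i)"

lemma input_w0: "w > 0"
  using w(1) by (cases w) auto

lemma old_cut_fits:
  assumes "i < length vs" "cb \<le> i * K"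
  shows "cb + length (cut i) + length (cut (Suc i)) < 2 ^ w"
proof -
  have "length (cut i) \<le> K" "length (cut (Suc i)) \<le> K"
    using length_cut_le[of i] length_cut_le[of "Suc i"] assms K by simp_all
  moreover have "Suc (Suc i) * K \<le> (length vs + 2) * K" using assms by (intro mult_le_mono1) simp
  then have "K + (K + i * K) \<le> (length vs + 2) * K" by simp
  ultimately show ?thesis using assms(2) w(3) by linarith
qed

lemma wp_old_cut:
  assumes i: "i < length vs" and s: "vars s ''m'' = length (cut i)" "vars s ''v'' = vs ! i" "vars s ''cb'' = cb"
      "vars s ''c2'' = cb + length (cut i)" "vars s ''M'' = 0" "cb \<le> i * K"
    and ce: "\<And>j. j < length (cut i) \<Longrightarrow> arrs s ''ce'' (cb + j) = snd (cut i ! j)"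
  defines "xs \<equiv> map snd (filter (\<lambda>e. snd e \<noteq> vs ! i) (cut i))"
  shows "wp w old_cut_prog
    (\<lambda>t s'. t \<le> K * 5 + 2 \<and> vars s' ''M'' = length xs \<and>
       (\<forall>y<length xs. arrs s' ''ce'' (cb + length (cut i) + y) = xs ! y) \<and>
       (\<forall>y<cb + length (cut i). arrs s' ''ce'' y = arrs s ''ce'' y)) s"
proof -
  let ?m = "length (cut i)"
  let ?B = "old_cut_body"
  define ys where "ys j = map snd (filter (\<lambda>e. snd e \<noteq> vs ! i) (take j (cut i)))" for j
  define J where "J j (s' :: state) \<longleftrightarrow> vars s' ''M'' = length (ys j) \<and>
      (\<forall>y<length (ys j). arrs s' ''ce'' (cb + ?m + y) = ys j ! y) \<and>
      (\<forall>y<cb + ?m. arrs s' ''ce'' y = arrs s ''ce'' y)" for j s'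
  have mK: "?m \<le> K" using length_cut_le[of i] i K by simp
  have "wp w (For ''j'' (Const 0) (Var ''m'') ?B)
      (\<lambda>t s'. t \<le> (?m - 0) * (3 + 2) + 2 \<and> J ?m s' \<and> vars s' ''j'' = ?m) s"
  proof (rule wp_For_Var)
    fix j and s' :: state assume j: "j < ?m" "vars s' ''j'' = j" and J: "J j s'"
      and so': "loop_frame ''j'' ?B s s'"
    have v: "vars s' ''cb'' = cb" "vars s' ''c2'' = cb + ?m" "vars s' ''v'' = vs ! i"
      using so' s by (auto simp: same_off_def)
    have cej: "arrs s' ''ce'' (cb + j) = snd (cut i ! j)" using J j ce[OF j(1)] unfolding J_def by simp
    have yl: "length (ys j) \<le> j" unfolding ys_def by (simp, rule order.trans[OF length_filter_le]) simp
    have Suc: "ys (Suc j) = ys j @ (if snd (cut i ! j) = vs ! i then [] else [snd (cut i ! j)])"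
      using j by (simp add: ys_def take_Suc_conv_app_nth)
    have bound: "cb + ?m + j < 2 ^ w" "j + 1 < 2 ^ w"
    proof -
      have "Suc (Suc i) * K \<le> (length vs + 2) * K" using i by (intro mult_le_mono1) simp
      then have "K + (K + i * K) \<le> (length vs + 2) * K" by simp
      then show "cb + ?m + j < 2 ^ w" using s(6) j mK w(3) by linarith
      show "j + 1 < 2 ^ w" using j mK w(11) by linarith
    qed
    show "wp w ?B (\<lambda>t s''. t \<le> 3 \<and> J (Suc j) (set_var ''j'' (Suc j) s'')) s'"
    proof (cases "snd (cut i ! j) = vs ! i")
      case True
      then show ?thesis using v cej J j bound Suc by (simp add: wp_simps J_def)
    next
      case False
      then show ?thesis using v cej J j bound yl Suc by (auto simp: wp_simps J_def nth_append less_Suc_eq)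
    qed
  next
    show "vars s ''m'' = ?m"
      using s by (simp add: same_off_def)
    show "?m < 2 ^ w" using mK w(11) by linarith
  qed (use input_w0 s in \<open>simp_all add: J_def ys_def\<close>)
  then show ?thesis
    unfolding old_cut_prog_def
  proof (rule wp_mono)
    fix t s' assume "t \<le> (?m - 0) * (3 + 2) + 2 \<and> J ?m s' \<and> vars s' ''j'' = ?m"
    then show "t \<le> K * 5 + 2 \<and> vars s' ''M'' = length xs \<and>
       (\<forall>y<length xs. arrs s' ''ce'' (cb + length (cut i) + y) = xs ! y) \<and>
       (\<forall>y<cb + length (cut i). arrs s' ''ce'' y = arrs s ''ce'' y)"
      using mK unfolding J_def ys_def xs_def by simp
  qed
qed

lemma wp_new_cut:
  assumes i: "i < length vs" and s: "vars s ''v'' = vs ! i" "vars s ''c2'' = c2" "vars s ''M'' = length xs"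
    and xs: "xs = map snd (filter (\<lambda>e. snd e \<noteq> vs ! i) (cut i))"
    and ce: "\<forall>y<length xs. arrs s ''ce'' (c2 + y) = xs ! y"
    and fit: "c2 + length (cut (Suc i)) < 2 ^ w"
    and vis: "\<And>u. u < length adj \<Longrightarrow> arrs s ''vis'' u = (if u \<in> set (take (Suc i) vs) then 1 else 0)"
    and arr: "arrs s ''off'' = arrs s0 ''off''" "arrs s ''nbr'' = arrs s0 ''nbr''"
  shows "wp w new_cut_prog
    (\<lambda>t s'. t \<le> K * 10 + 2 \<and> vars s' ''M'' = length (cut (Suc i)) \<and>
       (\<forall>y<length (cut (Suc i)). arrs s' ''ce'' (c2 + y) = snd (cut (Suc i) ! y)) \<and>
       (\<forall>y<c2. arrs s' ''ce'' y = arrs s ''ce'' y)) s"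
proof -
  let ?v = "vs ! i"
  let ?B = "new_cut_body"
  have vn: "?v < length adj" using nth_vs_lt[of i] i length_vs by simp
  define P where "P u \<longleftrightarrow> u \<notin> set (take (Suc i) vs)" for u
  define ys where "ys j = xs @ filter P (take (j - L ?v) (adj ! ?v))" for j
  define J where "J j (s' :: state) \<longleftrightarrow> vars s' ''M'' = length (ys j) \<and>
      (\<forall>y<length (ys j). arrs s' ''ce'' (c2 + y) = ys j ! y) \<and>
      (\<forall>y<c2. arrs s' ''ce'' y = arrs s ''ce'' y)" for j s'
  have cutS: "map snd (cut (Suc i)) = xs @ filter P (adj ! ?v)"
    by (simp add: cut.simps xs o_def) (rule filter_cong, simp_all add: P_def)
  have ysl: "length (ys j) \<le> length (cut (Suc i))" for j
  proof -
    have "filter P (adj ! ?v) = filter P (take (j - L ?v) (adj ! ?v)) @ filter P (drop (j - L ?v) (adj ! ?v))"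
      by (metis append_take_drop_id filter_append)
    then have "length (ys j) \<le> length (map snd (cut (Suc i)))" unfolding cutS ys_def by simp
    then show ?thesis by simp
  qed
  have offv: "arrs s0 ''off'' ?v = L ?v" "arrs s0 ''off'' (Suc ?v) = L (Suc ?v)" using off_arr vn by simp_all
  have vw: "?v + 1 < 2 ^ w" using vn length_vs w(1) by linarith
  have "wp w (For ''j'' (Elem ''off'' (Var ''v'')) (Elem ''off'' (Add (Var ''v'') (Const 1))) ?B)
      (\<lambda>t s'. t \<le> (L (Suc ?v) - L ?v) * (3 + 2) + 2 \<and> J (L (Suc ?v)) s' \<and> vars s' ''j'' = L (Suc ?v)) s"
  proof (rule wp_For)
    fix j and s' :: state assume j: "L ?v \<le> j" "j < L (Suc ?v)" "vars s' ''j'' = j" and J: "J j s'"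
      and so': "loop_frame ''j'' ?B s s'"
    have v: "vars s' ''c2'' = c2" "arrs s' ''vis'' = arrs s ''vis''" "arrs s' ''nbr'' = arrs s0 ''nbr''"
      using so' s arr by (auto simp: same_off_def)
    obtain k where k: "j = L ?v + k" "k < length (adj ! ?v)" using j L_Suc[OF vn] le_Suc_ex[OF j(1)] by auto
    define u where "u = adj ! ?v ! k"
    have nb: "arrs s0 ''nbr'' j = u" using nbr_arr[OF vn k(2)] k(1) by (simp add: u_def)
    have "u \<in> set (adj ! ?v)" using k(2) by (simp add: u_def)
    then have un: "u < length adj" using adj_nth[OF vn] adjG_lt by blast
    have Suc: "ys (Suc j) = ys j @ (if P u then [u] else [])"
      using k by (simp add: ys_def take_Suc_conv_app_nth u_def Suc_diff_le)
    have "length (cut (Suc i)) \<le> K" using length_cut_le[of "Suc i"] i K by simp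
    then have bound: "c2 + length (ys j) < 2 ^ w" "P u \<Longrightarrow> length (ys j) + 1 < 2 ^ w"
      using fit ysl[of j] ysl[of "Suc j"] Suc w(11) by simp_all
    show "wp w ?B (\<lambda>t s''. t \<le> 3 \<and> J (Suc j) (set_var ''j'' (Suc j) s'')) s'"
    proof (cases "P u")
      case True
      then have "arrs s ''vis'' u = 0" using vis[OF un] by (simp add: P_def)
      then show ?thesis using True v J j nb bound Suc input_w0 by (auto simp: wp_simps J_def nth_append less_Suc_eq)
    next
      case False
      then have "arrs s ''vis'' u = 1" using vis[OF un] by (simp add: P_def)
      then show ?thesis using False v J j nb Suc by (simp add: wp_simps J_def)
    qed
  next
    show "fits w (Elem ''off'' (Add (Var ''v'') (Const 1))) s' \<and> eval (Elem ''off'' (Add (Var ''v'') (Const 1))) s' = L (Suc ?v)"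
      if "loop_frame ''j'' ?B s s'" for s'
      using that s arr offv vw by (simp add: same_off_def)
    show "L (Suc ?v) < 2 ^ w" using L_fits vn by simp
    show "L ?v \<le> L (Suc ?v)" using L_Suc[OF vn] by simp
    show "J (L ?v) (set_var ''j'' (L ?v) s)" using s ce by (simp add: J_def ys_def)
  qed (use input_w0 s arr offv in simp_all)
  then show ?thesis
    unfolding new_cut_prog_def
  proof (rule wp_mono)
    fix t s' assume a: "t \<le> (L (Suc ?v) - L ?v) * (3 + 2) + 2 \<and> J (L (Suc ?v)) s' \<and> vars s' ''j'' = L (Suc ?v)"
    have l: "L (Suc ?v) - L ?v = length (adj ! ?v)" using L_Suc[OF vn] by simp
    \<comment> \<open>A vertex has at most twice as many neighbours as the width, hence 5 steps for
      each of at most \<open>2 * K\<close> entries.\<close>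
    have "length (adj ! ?v) \<le> 2 * K" using length_adj_le[OF vn] K by simp
    then have "t \<le> K * 10 + 2" using a l by simp
    moreover have "ys (L (Suc ?v)) = map snd (cut (Suc i))" unfolding ys_def cutS l by simp
    ultimately show "t \<le> K * 10 + 2 \<and> vars s' ''M'' = length (cut (Suc i)) \<and>
       (\<forall>y<length (cut (Suc i)). arrs s' ''ce'' (c2 + y) = snd (cut (Suc i) ! y)) \<and>
       (\<forall>y<c2. arrs s' ''ce'' y = arrs s ''ce'' y)"
      using a unfolding J_def by simp
  qed
qed

lemma wp_init_tree:
  assumes "vars s ''g'' = g" "g < 2 ^ w"
  shows "wp w init_tree_prog (\<lambda>t s'. t \<le> g * 3 + 2 \<and> (\<forall>y<g. arrs s' ''av'' y = 1)) s"
proof -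
  let ?B = "init_tree_body"
  have "wp w (For ''x'' (Const 0) (Var ''g'') ?B)
      (\<lambda>t s'. t \<le> (g - 0) * (1 + 2) + 2 \<and> (\<forall>y<g. arrs s' ''av'' y = 1) \<and> vars s' ''x'' = g) s"
  proof (rule wp_For_Var[where I = "\<lambda>x s'. \<forall>y<x. arrs s' ''av'' y = 1"])
    fix x and s' :: state assume "\<forall>y<x. arrs s' ''av'' y = 1" "vars s' ''x'' = x"
    then show "wp w ?B (\<lambda>t s''. t \<le> 1 \<and> (\<forall>y<Suc x. arrs (set_var ''x'' (Suc x) s'') ''av'' y = 1)) s'"
      using input_w0 w(1) by (auto simp: wp_simps less_Suc_eq)
  next
    show "vars s ''g'' = g"
      using assms by (simp add: same_off_def)
  qed (use input_w0 assms in simp_all)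
  then show ?thesis unfolding init_tree_prog_def by (rule wp_mono) auto
qed

end

lemma wp_Seq_Assign:
  "wp w (Seq (Assign x e) P) Q s \<longleftrightarrow> fits w e s \<and> wp w P (\<lambda>t. Q (1 + t)) (set_var x (eval e s) s)"
  by (simp add: wp_simps)

lemma wp_Seq_Store:
  "wp w (Seq (Store a i e) P) Q s \<longleftrightarrow> fits w i s \<and> fits w e s \<and>
     wp w P (\<lambda>t. Q (1 + t)) (s\<lparr>arrs := (arrs s)(a := (arrs s a)(eval i s := eval e s))\<rparr>)"
  by (simp add: wp_simps)

lemma wp_SeqI:
  assumes "wp w P Q' s"
    and "\<And>t s'. Q' t s' \<Longrightarrow> frame P s s' \<Longrightarrow> wp w R (\<lambda>t'. Q (t + t')) s'"
  shows "wp w (Seq P R) Q s"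
  unfolding wp_Seq using assms by (rule wp_use)

section \<open>Cost bounds that are uniform in the phase\<close>

context dp_problem
begin

definition node_bound :: nat where
  "node_bound = K * (K * h) * 4 + K * 3 + K * (4 * h + 7) + 12"

definition cand_bound :: nat where
  "cand_bound = K * 8 + (1 + K * Rm) * (node_bound + 2) + 10"

definition step_bound :: nat where
  "step_bound = K * 15 + K * h * 3 + Rm * (h * (cand_bound + 2) + 4) + 30"

end

context dp_phase
begin

lemma cand_time_le: "cand_time \<le> cand_bound"
proof -
  have "node_time \<le> node_bound"
    unfolding node_time_def node_bound_def using m_le by (intro add_mono mult_le_mono) auto
  then have "(1 + K * Rm) * (node_time + 2) \<le> (1 + K * Rm) * (node_bound + 2)" by (intro mult_le_mono2) simp
  then show ?thesis unfolding cand_time_def insert_time_def cand_bound_def using m_le by linarith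
qed

lemma phase_time_le: "length R * (h * (cand_time + 2) + 4) \<le> Rm * (h * (cand_bound + 2) + 4)"
  using R(2) cand_time_le by (intro mult_le_mono add_mono) auto

lemma phase_inv_init:
  assumes "vars s ''ct'' = 1" "vars s ''rc'' = 0" "\<And>y. y < m2 * h \<Longrightarrow> arrs s ''av'' y = 1"
    and "\<And>p. arrs s ''fl'' p \<le> i"
    and "\<And>q j. q < length R \<Longrightarrow> j < m \<Longrightarrow> arrs s ''rw'' (lb + (q * m + j)) = R ! q ! j"
  shows "phase_inv {} s"
proof -
  have "tree_inv adjH h m2 {} 1 (\<lambda>p. arrs s ''fl'' p = Suc i) (avail (arrs s ''av'')) []"
  proof (rule tree_inv_init)
    show "avail (arrs s ''av'') 0 j = {..<h}" if "j < m2" for j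
      unfolding avail_def using assms(3) index_lt[OF that] by auto
    show "arrs s ''fl'' 0 \<noteq> Suc i" using assms(4)[of 0] by simp
  qed
  then have "tstate {} s []"
    unfolding tstate_def using assms(1,2,4,5) by (simp add: le_SucI)
  then show ?thesis unfolding phase_inv_def by auto
qed

end

context dp_input
begin

lemma wp_dp_step:
  assumes so: "same_off (insert ''i'' step_vars) step_arrs s0 s" and I: "dp_inv i s"
    and i: "i < length vs" "vars s ''i'' = i"
  shows "wp w dp_step (\<lambda>t s'. t \<le> step_bound \<and> dp_inv (Suc i) s') s"
proof -
  define lb cb where "lb = vars s ''lb''" and "cb = vars s ''cb''"
  let ?m = "length (cut i)" and ?m2 = "length (cut (Suc i))" and ?v = "vs ! i"
  obtain R where R: "represents i R" "length R \<le> Rm" "vars s ''nr'' = length R"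
      "\<And>q j. q < length R \<Longrightarrow> j < ?m \<Longrightarrow> arrs s ''rw'' (lb + (q * ?m + j)) = R ! q ! j"
    using I unfolding dp_inv_def lb_def by blast
  have lb: "lb \<le> i * (Rm * K)" and cb: "cb \<le> i * K" and m: "vars s ''m'' = ?m"
    and ce: "\<And>j. j < ?m \<Longrightarrow> arrs s ''ce'' (cb + j) = snd (cut i ! j)"
    and vis: "\<And>u. u < length adj \<Longrightarrow> arrs s ''vis'' u = (if u \<in> set (take i vs) then 1 else 0)"
    and fl: "\<And>p. arrs s ''fl'' p \<le> i"
    using I unfolding dp_inv_def lb_def cb_def by blast+
  have mK: "?m \<le> K" "?m2 \<le> K" using length_cut_le[of i] length_cut_le[of "Suc i"] i K by simp_all
  note fit = old_cut_fits[OF i(1) cb]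
  have arr: "arrs s ''ord'' = arrs s0 ''ord''" "arrs s ''off'' = arrs s0 ''off''" "arrs s ''nbr'' = arrs s0 ''nbr''"
      "arrs s ''H'' = arrs s0 ''H''" "vars s ''h'' = h" "vars s ''n'' = length vs"
    using so hn by (simp_all add: same_off_def)
  have gfit: "?m2 * h < 2 ^ w"
  proof -
    have "?m2 * h \<le> K * h" using mK by simp
    then show ?thesis using w(9) by linarith
  qed
  have l2: "lb + length R * ?m \<le> Suc i * (Rm * K)" "lb + length R * ?m < 2 ^ w" "length R * ?m < 2 ^ w"
  proof -
    have "length R * ?m \<le> Rm * K" using R(2) mK by (intro mult_le_mono) auto
    then show 1: "lb + length R * ?m \<le> Suc i * (Rm * K)" using lb by simp
    have "Suc i * (Rm * K) \<le> (length vs + 2) * (Rm * K)" using i by (intro mult_le_mono1) simp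
    then show "lb + length R * ?m < 2 ^ w" "length R * ?m < 2 ^ w" using 1 w(2) by linarith+
  qed
  define s1 where "s1 = s\<lparr>arrs := (arrs s)(''vis'' := (arrs s ''vis'')(?v := 1)),
      vars := (vars s)(''v'' := ?v, ''M'' := 0, ''c2'' := cb + ?m)\<rparr>"
  define xs where "xs = map snd (filter (\<lambda>e. snd e \<noteq> ?v) (cut i))"
  let ?P5 = "Seq (Assign ''lb'' (Var ''l2'')) (Seq (Assign ''nr'' (Var ''rc'')) (Seq (Assign ''cb'' (Var ''c2'')) (Assign ''m'' (Var ''M''))))"
  let ?P4 = "Seq (Assign ''rc'' (Const 0)) (Seq (Assign ''l2'' (Add (Var ''lb'') (Mul (Var ''nr'') (Var ''m'')))) (Seq phase_prog ?P5))"
  let ?P3 = "Seq (Assign ''g'' (Mul (Var ''M'') (Var ''h''))) (Seq (Assign ''ct'' (Const 1)) (Seq init_tree_prog ?P4))"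
  \<comment> \<open>The argument \<open>T\<close> accumulates the steps spent before the remaining
    program starts; the initial 4 are the three assignments and the store at the front.\<close>
  let ?Q = "\<lambda>T t s'. t + T \<le> step_bound \<and> dp_inv (Suc i) s'"
  have main: "wp w (Seq old_cut_prog (Seq new_cut_prog ?P3)) (?Q 4) s1"
  proof (rule wp_SeqI[OF wp_old_cut[OF i(1), of s1 cb]])
    fix t2 s2
    assume 2: "t2 \<le> K * 5 + 2 \<and> vars s2 ''M'' = length (map snd (filter (\<lambda>e. snd e \<noteq> ?v) (cut i))) \<and>
        (\<forall>y<length (map snd (filter (\<lambda>e. snd e \<noteq> ?v) (cut i))). arrs s2 ''ce'' (cb + ?m + y) = map snd (filter (\<lambda>e. snd e \<noteq> ?v) (cut i)) ! y) \<and>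
        (\<forall>y<cb + ?m. arrs s2 ''ce'' y = arrs s1 ''ce'' y)"
      and so2: "frame old_cut_prog s1 s2"
    note 2 = 2[folded xs_def]
    show "wp w (Seq new_cut_prog ?P3) (\<lambda>t'. ?Q 4 (t2 + t')) s2"
    proof (rule wp_SeqI[OF wp_new_cut[OF i(1) _ _ _ xs_def, of s2 "cb + ?m"]])
      show "vars s2 ''v'' = ?v" "vars s2 ''c2'' = cb + ?m" "arrs s2 ''off'' = arrs s0 ''off''" "arrs s2 ''nbr'' = arrs s0 ''nbr''"
        using so2 arr by (simp_all add: same_off_def s1_def)
      show "vars s2 ''M'' = length xs" "\<forall>y<length xs. arrs s2 ''ce'' (cb + ?m + y) = xs ! y" using 2 by blast+
      show "cb + ?m + ?m2 < 2 ^ w" by (rule fit)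
      show "arrs s2 ''vis'' u = (if u \<in> set (take (Suc i) vs) then 1 else 0)" if "u < length adj" for u
        using so2 vis[OF that] set_take_Suc[OF i(1)] by (simp add: same_off_def s1_def)
      fix t3 s3
      assume 3: "t3 \<le> K * 10 + 2 \<and> vars s3 ''M'' = ?m2 \<and> (\<forall>y<?m2. arrs s3 ''ce'' (cb + ?m + y) = snd (cut (Suc i) ! y)) \<and>
        (\<forall>y<cb + ?m. arrs s3 ''ce'' y = arrs s2 ''ce'' y)"
        and so3: "frame new_cut_prog s2 s3"
      have so13: "same_off {''j'', ''M''} {''ce''} s1 s3" using so2 so3 by (auto simp: same_off_def)
      define s4 where "s4 = s3\<lparr>vars := (vars s3)(''g'' := ?m2 * h, ''ct'' := 1)\<rparr>"
      have main4: "wp w (Seq init_tree_prog ?P4) (?Q (t2 + t3 + 6)) s4"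
      proof (rule wp_SeqI[OF wp_init_tree[OF _ gfit]])
        show "vars s4 ''g'' = ?m2 * h" by (simp add: s4_def)
        fix t5 s5
        assume 5: "t5 \<le> ?m2 * h * 3 + 2 \<and> (\<forall>y<?m2 * h. arrs s5 ''av'' y = 1)"
          and so5: "frame init_tree_prog s4 s5"
        define s6 where "s6 = s5\<lparr>vars := (vars s5)(''rc'' := 0, ''l2'' := lb + length R * ?m)\<rparr>"
        have v6: "vars s6 ''h'' = h" "vars s6 ''i'' = i" "vars s6 ''v'' = ?v" "vars s6 ''m'' = ?m" "vars s6 ''M'' = ?m2"
            "vars s6 ''g'' = ?m2 * h" "vars s6 ''nr'' = length R" "vars s6 ''lb'' = lb" "vars s6 ''l2'' = lb + length R * ?m"
            "vars s6 ''cb'' = cb" "vars s6 ''c2'' = cb + ?m" "vars s6 ''ct'' = 1" "vars s6 ''rc'' = 0"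
          using so13 so5 3 i(2) m R(3) arr
          by (simp_all add: same_off_def s6_def s4_def s1_def lb_def cb_def)
        have a6: "arrs s6 ''H'' = arrs s0 ''H''" "arrs s6 ''ce'' = arrs s3 ''ce''" "arrs s6 ''rw'' = arrs s ''rw''"
            "arrs s6 ''fl'' = arrs s ''fl''" "arrs s6 ''vis'' = (arrs s ''vis'')(?v := 1)" "arrs s6 ''av'' = arrs s5 ''av''"
          using so13 so5 arr by (simp_all add: same_off_def s6_def s4_def s1_def)
        have ce6: "arrs s6 ''ce'' (cb + j) = snd (cut i ! j)" if "j < ?m" for j
          using 2 3 ce[OF that] that unfolding a6 by (simp add: s1_def)
        \<comment> \<open>The phase is entered in \<open>s6\<close>, where the next cut and the root
          of the tree are in place; \<open>s6\<close> becomes the reference state for its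
          frame.\<close>
        interpret P: dp_phase G vs adj H h w K d Rm i lb cb R s6
          by unfold_locales (use i R lb cb v6 a6 H_arr ce6 in simp_all)
        have main6: "wp w (Seq phase_prog ?P5) (?Q (t2 + t3 + t5 + 8)) s6"
        proof (rule wp_SeqI[OF P.wp_phase])
          show "same_off phase_vars phase_arrs s6 s6" by (simp add: same_off_def)
          show "P.phase_inv {} s6"
            by (rule P.phase_inv_init) (use v6 a6 5 fl R(4) in simp_all)
          fix t7 s7
          assume 7: "t7 \<le> length R * (h * (P.cand_time + 2) + 4) + 2 \<and> P.phase_inv (candidates i R) s7"
            and so7: "frame phase_prog s6 s7"
          obtain R' where R': "represents (Suc i) R'" "length R' \<le> Rm" "vars s7 ''rc'' = length R'"
              "\<And>q j. q < length R' \<Longrightarrow> j < ?m2 \<Longrightarrow> arrs s7 ''rw'' (lb + length R * ?m + (q * ?m2 + j)) = R' ! q ! j"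
              "\<And>p. arrs s7 ''fl'' p \<le> Suc i"
            using P.phase_result[OF conjunct2[OF 7]] by blast
          define s8 where "s8 = s7\<lparr>vars := (vars s7)(''lb'' := lb + length R * ?m, ''nr'' := length R', ''cb'' := cb + ?m, ''m'' := ?m2)\<rparr>"
          have v7: "vars s7 ''l2'' = lb + length R * ?m" "vars s7 ''c2'' = cb + ?m" "vars s7 ''M'' = ?m2"
              "arrs s7 ''ce'' = arrs s3 ''ce''" "arrs s7 ''vis'' = (arrs s ''vis'')(?v := 1)"
            using so7 v6 a6 by (simp_all add: same_off_def)
          have "cb + ?m \<le> Suc i * K" using cb mK by simp
          then have "dp_inv (Suc i) s8"
            unfolding dp_inv_def using R' v7 l2 3 vis set_take_Suc[OF i(1)]
            by (auto simp: s8_def)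
          moreover have "t2 + t3 + t5 + t7 + 12 \<le> step_bound"
          proof -
            have "?m2 * h * 3 \<le> K * h * 3" using mK by simp
            then show ?thesis using 2 3 5 7 P.phase_time_le unfolding step_bound_def by linarith
          qed
          ultimately show "wp w ?P5 (\<lambda>t'. ?Q (t2 + t3 + t5 + 8) (t7 + t')) s7"
            using v7 R'(3) by (simp add: wp_simps s8_def)
        qed
        have "vars s5 ''lb'' = lb" "vars s5 ''nr'' = length R" "vars s5 ''m'' = ?m"
          using v6 by (simp_all add: s6_def)
        then show "wp w ?P4 (\<lambda>t'. ?Q (t2 + t3 + 6) (t5 + t')) s5"
          unfolding wp_Seq_Assign using main6 l2 by (simp add: s6_def add_ac)
      qed
      have "vars s3 ''M'' = ?m2" "vars s3 ''h'' = h" using 3 so13 arr by (simp_all add: same_off_def s1_def)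
      then show "wp w ?P3 (\<lambda>t'. ?Q 4 (t2 + (t3 + t'))) s3"
        unfolding wp_Seq_Assign using main4 gfit w(1) by (simp add: s4_def add_ac)
    qed
  qed (use m cb ce in \<open>simp_all add: s1_def cb_def\<close>)
  have main': "wp w (Seq old_cut_prog (Seq new_cut_prog ?P3))
      (\<lambda>t s'. 1 + (1 + (1 + (1 + t))) \<le> step_bound \<and> dp_inv (Suc i) s') s1"
    by (rule wp_mono[OF main]) simp
  have "i < 2 ^ w" "(1::nat) < 2 ^ w" using i w(1) by linarith+
  then show ?thesis
    unfolding dp_step_def wp_Seq_Assign wp_Seq_Store using main' i arr ord_arr[OF i(1)] m fit
    by (simp add: s1_def cb_def[symmetric] add_ac)
qed

lemma Rm_ge_1: "1 \<le> Rm"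
proof -
  have "K ^ 0 \<le> (\<Sum>t\<le>K * (d - 1). K ^ t)" by (rule member_le_sum) auto
  then show ?thesis by (simp add: Rm)
qed

lemma wp_dp:
  assumes zero: "\<And>a x. a \<in> {''vis'', ''fl''} \<Longrightarrow> arrs s0 a x = 0" and out: "vars s0 ''out'' = 0"
  shows "wp w dp_prog (\<lambda>t s'. t \<le> length vs * (step_bound + 2) + 8 \<and> (vars s' ''out'' = 1 \<longleftrightarrow> (\<exists>\<phi>. graph_hom G H \<phi>))) s0"
proof -
  define s1 where "s1 = s0\<lparr>vars := (vars s0)(''m'' := 0, ''lb'' := 0, ''cb'' := 0, ''nr'' := 1)\<rparr>"
  let ?L = "For ''i'' (Const 0) (Var ''n'') dp_step"
  have cong: "dp_inv i (set_var ''i'' v s) \<longleftrightarrow> dp_inv i s" for i v s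
    unfolding dp_inv_def by simp
  have L: "wp w ?L (\<lambda>t s'. t \<le> (length vs - 0) * (step_bound + 2) + 2 \<and> dp_inv (length vs) s' \<and> vars s' ''i'' = length vs) s1"
  proof (rule wp_For_Var[where I = dp_inv])
    fix i and s :: state assume i: "i < length vs" "dp_inv i s" "vars s ''i'' = i"
      and so: "loop_frame ''i'' dp_step s1 s"
    have so': "same_off (insert ''i'' step_vars) step_arrs s0 s"
      using so by (auto simp: same_off_def s1_def)
    show "wp w dp_step (\<lambda>t s''. t \<le> step_bound \<and> dp_inv (Suc i) (set_var ''i'' (Suc i) s'')) s"
      unfolding cong by (rule wp_dp_step[OF so' i(2,1,3)])
  next
    show "dp_inv 0 (set_var ''i'' 0 s1)"
      unfolding cong unfolding dp_inv_def
      using represents_0 Rm_ge_1 zero by (auto simp: s1_def cut.simps intro!: exI[of _ "[[]]"])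
    show "vars s1 ''n'' = length vs"
      using hn by (simp add: same_off_def s1_def)
    show "length vs < 2 ^ w" using w(1) by linarith
  qed (use input_w0 in simp_all)
  have main: "wp w (Seq ?L (Cond (Eq (Var ''nr'') (Const 0)) Skip (Assign ''out'' (Const 1))))
      (\<lambda>t s'. 1 + (1 + (1 + (1 + t))) \<le> length vs * (step_bound + 2) + 8 \<and> (vars s' ''out'' = 1 \<longleftrightarrow> (\<exists>\<phi>. graph_hom G H \<phi>))) s1"
  proof (rule wp_SeqI[OF L])
    fix t s
    assume a: "t \<le> (length vs - 0) * (step_bound + 2) + 2 \<and> dp_inv (length vs) s \<and> vars s ''i'' = length vs"
      and so: "frame ?L s1 s"
    obtain R where R: "represents (length vs) R" "vars s ''nr'' = length R"
      using a unfolding dp_inv_def by blast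
    have o: "vars s ''out'' = 0" using so out by (simp add: same_off_def s1_def)
    show "wp w (Cond (Eq (Var ''nr'') (Const 0)) Skip (Assign ''out'' (Const 1)))
        (\<lambda>t' s'. 1 + (1 + (1 + (1 + (t + t')))) \<le> length vs * (step_bound + 2) + 8 \<and> (vars s' ''out'' = 1 \<longleftrightarrow> (\<exists>\<phi>. graph_hom G H \<phi>))) s"
      using a o R(2) represents_full[OF R(1)] w(1) by (auto simp: wp_simps)
  qed
  have "(1::nat) < 2 ^ w" using w(1) by linarith
  then show ?thesis
    unfolding dp_prog_def wp_Seq_Assign using main by (simp add: s1_def)
qed

end

section \<open>The complete algorithm\<close>

abbreviation edge_test_body :: "com" where
  "edge_test_body \<equiv>
     Cond (Eq (Elem ''H'' (Var ''x'')) (Const 1)) (Assign ''ex'' (Const 1)) Skip"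

definition edge_test_prog :: com where
  "edge_test_prog =
     For ''x'' (Const 0) (Mul (Var ''h'') (Var ''h''))
       edge_test_body"

abbreviation bfs_H :: com where
  "bfs_H \<equiv> bfs ''h'' (Const 0) (Var ''h'')
     (Eq (Elem ''H'' (Add (Mul (Var ''u'') (Var ''h'')) (Var ''j''))) (Const 1)) (Var ''j'') ''colH'' ''qH''"

abbreviation bfs_G :: com where
  "bfs_G \<equiv> bfs ''n'' (Elem ''off'' (Var ''u'')) (Elem ''off'' (Add (Var ''u'') (Const 1)))
     (Eq (Const 0) (Const 0)) (Elem ''nbr'' (Var ''j'')) ''colG'' ''qG''"

text \<open>The value \<open>off[n]\<close> is the total length of the adjacency lists, so comparing
  it with 0 tests whether \<open>G\<close> is edgeless.\<close>

definition bipartite_prog :: com where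
  "bipartite_prog =
     Seq edge_test_prog
       (Cond (Eq (Var ''ex'') (Const 1))
         (Seq bfs_G (Cond (Eq (Var ''ok'') (Const 1)) (Assign ''out'' (Const 1)) Skip))
         (Cond (Eq (Elem ''off'' (Var ''n'')) (Const 0)) (Assign ''out'' (Const 1)) Skip))"

definition main_prog :: com where
  "main_prog =
     Cond (Eq (Var ''n'') (Const 0)) (Assign ''out'' (Const 1))
       (Cond (Eq (Var ''h'') (Const 0)) Skip
         (Seq bfs_H (Cond (Eq (Var ''ok'') (Const 1)) bipartite_prog dp_prog)))"

lemma wvars_edge_test [simp]: "wvars edge_test_prog = {''x'', ''ex''}" "warrs edge_test_prog = {}"
  by (auto simp: edge_test_prog_def)

section \<open>Facts about \<open>H\<close> and the input encoding\<close>

context hom_problem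
begin

text \<open>For \<open>i < j\<close> the vertex \<open>b j\<close> is adjacent to \<open>a j\<close>
  but not to \<open>a i\<close>, so the \<open>a i\<close> are distinct vertices of
  \<open>H\<close>. This makes a largest half-induced matching available.\<close>

lemma half_induced_le: "half_induced adjH l Y \<Longrightarrow> l \<le> h"
proof -
  assume "half_induced adjH l Y"
  then obtain a b where ab: "\<forall>i<l. adjH (a i) (b i)" "\<forall>i j. i < j \<longrightarrow> j < l \<longrightarrow> \<not> adjH (a i) (b j)"
    unfolding half_induced_def by (elim exE conjE)
  have "inj_on a {..<l}"
  proof (rule linorder_inj_onI')
    fix i j assume ij: "i \<in> {..<l}" "j \<in> {..<l}" "i < j"
    then have "\<not> adjH (a i) (b j)" "adjH (a j) (b j)" using ab by blast+
    then show "a i \<noteq> a j" by auto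
  qed
  moreover have "a ` {..<l} \<subseteq> {..<h}" using ab(1) adjH_lt by blast
  ultimately have "card {..<l} \<le> card {..<h}" by (rule card_inj_on_le) simp
  then show ?thesis by simp
qed

lemma half_induced_number:
  obtains d where "half_induced adjH d {}" "\<And>l. half_induced adjH l {} \<Longrightarrow> l \<le> d" "d \<le> h"
proof -
  let ?S = "{l. half_induced adjH l {}}"
  have "?S \<subseteq> {..h}" using half_induced_le by blast
  then have fin: "finite ?S" by (rule finite_subset) simp
  have "0 \<in> ?S" by (simp add: half_induced_0)
  then have "Max ?S \<in> ?S" using Max_in[OF fin] by blast
  then show thesis using that[of "Max ?S"] Max_ge[OF fin] half_induced_le by blast
qed

lemma bipartitionD:
  assumes "bipartition H X Y"
  shows "X \<inter> Y = {}" "adjH a b \<Longrightarrow> \<exists>x\<in>X. \<exists>y\<in>Y. {a, b} = {x, y}"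
  using assms by (simp_all add: bipartition_def adjH_def)

lemma colourable_iff_bipartite: "colourable adjH \<longleftrightarrow> bipartite H"
proof
  assume "colourable adjH"
  then obtain f :: "nat \<Rightarrow> nat" where f: "\<And>v. f v = 1 \<or> f v = 2" "\<And>u v. adjH u v \<Longrightarrow> f u \<noteq> f v"
    unfolding colourable_def proper_def by blast
  have "bipartition H {v. v < h \<and> f v = 1} {v. v < h \<and> f v = 2}"
    unfolding bipartition_def
  proof (intro conjI ballI)
    show "{v. v < h \<and> f v = 1} \<union> {v. v < h \<and> f v = 2} = verts H" using f(1) by (auto simp: verts_H)
    fix e assume "e \<in> edges H"
    moreover then obtain u v where uv: "e = {u, v}" using H unfolding simple_graph_def by (auto simp: card_2_iff)
    ultimately have a: "adjH u v" by (simp add: adjH_def)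
    show "\<exists>x\<in>{v. v < h \<and> f v = 1}. \<exists>y\<in>{v. v < h \<and> f v = 2}. e = {x, y}"
    proof (cases "f u = 1")
      case True
      then have "f v = 2" using f(1)[of v] f(2)[OF a] by auto
      then show ?thesis using True adjH_lt[OF a] uv by blast
    next
      case False
      then have "f u = 2" "f v = 1" using f(1)[of u] f(1)[of v] f(2)[OF a] by auto
      moreover have "e = {v, u}" using uv by blast
      ultimately show ?thesis using adjH_lt[OF a] by blast
    qed
  qed auto
  then show "bipartite H" unfolding bipartite_def by blast
next
  assume "bipartite H"
  then obtain X Y where "bipartition H X Y" unfolding bipartite_def by (elim exE)
  note XY = bipartitionD[OF this]
  have "proper adjH (\<lambda>v. if v \<in> X then 1 else 2)"
    unfolding proper_def
  proof (intro conjI allI impI)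
    fix u v assume "adjH u v"
    from XY(2)[OF this] obtain x y where "x \<in> X" "y \<in> Y" "{u, v} = {x, y}" by (elim bexE)
    then show "(if u \<in> X then 1 else 2 :: nat) \<noteq> (if v \<in> X then 1 else 2)"
      using XY(1) by (auto simp: doubleton_eq_iff)
  qed simp
  then show "colourable adjH" unfolding colourable_def by blast
qed

text \<open>Three uses of \<open>mimsup_ge\<close>: the empty matching, a single edge, and a
  half-induced matching of size \<open>d\<close>. The first two work for every choice of
  bipartition; the last needs the adjacency matrix and hence a non-bipartite
  \<open>H\<close>.\<close>

lemma mimsup_bounds:
  assumes \<mu>: "mimsup_graph H \<mu>"
  shows "0 \<le> \<mu>" and "adjH a b \<Longrightarrow> 1 \<le> \<mu>"
    and "\<not> colourable adjH \<Longrightarrow> half_induced adjH d {} \<Longrightarrow> real d \<le> \<mu>"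
proof -
  have finH: "finite (verts H)" by (simp add: verts_H)
  have gen: "real d \<le> mimsup (adj_matrix H)" if "half_induced adjH d {}" for d
  proof -
    from that obtain a b where ab: "\<forall>i<d. adjH (a i) (b i)" "\<forall>i j. i < j \<longrightarrow> j < d \<longrightarrow> \<not> adjH (a i) (b j)"
      unfolding half_induced_def by (elim exE conjE)
    show ?thesis
    proof (rule mimsup_ge[where a = a and b = b])
      fix i assume "i < d"
      then have "adjH (a i) (b i)" using ab by blast
      then show "a i \<in> rows (adj_matrix H) \<and> b i \<in> cols (adj_matrix H) \<and> entry (adj_matrix H) (a i) (b i) = 1"
        using adjH_lt by (auto simp: adj_matrix_def adjH_def verts_H)
    qed (use ab finH in \<open>simp_all add: adj_matrix_def adjH_def\<close>)
  qed
  show "\<not> colourable adjH \<Longrightarrow> half_induced adjH d {} \<Longrightarrow> real d \<le> \<mu>"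
    using gen \<mu> colourable_iff_bipartite unfolding mimsup_graph_def by simp
  have "0 \<le> \<mu> \<and> (adjH a b \<longrightarrow> 1 \<le> \<mu>)"
  proof (cases "bipartite H")
    case False
    then have \<mu>: "\<mu> = mimsup (adj_matrix H)" using \<mu> unfolding mimsup_graph_def by simp
    have "half_induced adjH 1 {}" if "adjH a b"
      unfolding half_induced_def using that by (intro exI[of _ "\<lambda>_. a"] exI[of _ "\<lambda>_. b"]) simp
    then show ?thesis using gen[of 0] gen[of 1] half_induced_0 \<mu> by auto
  next
    case True
    then obtain X Y where XY: "bipartition H X Y" and \<mu>: "\<mu> = mimsup (biadj_matrix H X Y)"
      using \<mu> unfolding mimsup_graph_def by auto
    have fin: "finite (rows (biadj_matrix H X Y))"
      using XY finH unfolding bipartition_def by (auto simp: biadj_matrix_def intro: finite_subset)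
    have "real 0 \<le> mimsup (biadj_matrix H X Y)"
      by (rule mimsup_ge[OF fin]) simp_all
    moreover have "real 1 \<le> mimsup (biadj_matrix H X Y)" if ab: "adjH a b"
    proof -
      obtain x y where xy: "x \<in> X" "y \<in> Y" "{a, b} = {x, y}"
        using bipartitionD(2)[OF XY ab] by (elim bexE)
      show ?thesis
        by (rule mimsup_ge[OF fin, of 1 "\<lambda>_. x" "\<lambda>_. y"])
          (use xy ab in \<open>auto simp: biadj_matrix_def adjH_def\<close>)
    qed
    ultimately show ?thesis using \<mu> by auto
  qed
  then show "0 \<le> \<mu>" and "adjH a b \<Longrightarrow> 1 \<le> \<mu>" by blast+
qed

text \<open>A homomorphism pulls a 2-colouring of \<open>H\<close> back to \<open>G\<close>;
  conversely, a 2-colouring of \<open>G\<close> maps onto the edge \<open>ab\<close>.\<close>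

lemma hom_iff_colourable:
  assumes "colourable adjH" "adjH a b"
  shows "(\<exists>\<phi>. graph_hom G H \<phi>) \<longleftrightarrow> colourable adjG"
proof
  assume "\<exists>\<phi>. graph_hom G H \<phi>"
  then obtain \<phi> where \<phi>: "\<And>u v. adjG u v \<Longrightarrow> adjH (\<phi> u) (\<phi> v)"
    unfolding graph_hom_def adjG_def adjH_def by blast
  obtain f where "proper adjH f" using assms(1) unfolding colourable_def by blast
  then have "proper adjG (\<lambda>v. f (\<phi> v))" using \<phi> unfolding proper_def by blast
  then show "colourable adjG" unfolding colourable_def by blast
next
  assume "colourable adjG"
  then obtain f :: "nat \<Rightarrow> nat" where f: "\<And>v. f v = 1 \<or> f v = 2" "\<And>u v. adjG u v \<Longrightarrow> f u \<noteq> f v"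
    unfolding colourable_def proper_def by blast
  have "graph_hom G H (\<lambda>v. if f v = 1 then a else b)"
    unfolding graph_hom_def
  proof (intro conjI allI impI)
    show "(\<lambda>v. if f v = 1 then a else b) ` verts G \<subseteq> verts H" using adjH_lt[OF assms(2)] by (auto simp: verts_H)
    fix u v assume "{u, v} \<in> edges G"
    then have "f u \<noteq> f v" using f(2) by (simp add: adjG_def)
    then have "f u = 1 \<and> f v \<noteq> 1 \<or> f u \<noteq> 1 \<and> f v = 1" using f(1)[of u] f(1)[of v] by auto
    then have "adjH (if f u = 1 then a else b) (if f v = 1 then a else b)"
      using assms(2) adjH_sym[OF assms(2)] by auto
    then show "{if f u = 1 then a else b, if f v = 1 then a else b} \<in> edges H" by (simp add: adjH_def)
  qed
  then show "\<exists>\<phi>. graph_hom G H \<phi>" by blast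
qed

lemma hom_iff_edgeless:
  assumes "\<And>a b. \<not> adjH a b" "h > 0"
  shows "(\<exists>\<phi>. graph_hom G H \<phi>) \<longleftrightarrow> length (concat adj) = 0"
proof -
  have "(\<exists>\<phi>. graph_hom G H \<phi>) \<longleftrightarrow> (\<forall>u v. \<not> adjG u v)"
  proof
    assume "\<exists>\<phi>. graph_hom G H \<phi>"
    then show "\<forall>u v. \<not> adjG u v" using assms(1) unfolding graph_hom_def adjG_def adjH_def by blast
  next
    assume "\<forall>u v. \<not> adjG u v"
    then have "graph_hom G H (\<lambda>_. 0)" using assms(2) unfolding graph_hom_def adjG_def by (auto simp: verts_H)
    then show "\<exists>\<phi>. graph_hom G H \<phi>" by blast
  qed
  also have "\<dots> \<longleftrightarrow> (\<forall>u<length adj. adj ! u = [])"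
  proof -
    have "adj ! u = [] \<longleftrightarrow> (\<forall>v. \<not> adjG u v)" if "u < length adj" for u
      using adj_nth[OF that] by (metis Collect_empty_eq set_empty)
    then show ?thesis using adjG_lt by blast
  qed
  also have "\<dots> \<longleftrightarrow> length (concat adj) = 0" by (simp add: all_set_conv_all_nth)
  finally show ?thesis .
qed

definition offset :: "nat \<Rightarrow> nat" where
  "offset u = length (concat (take u adj))"

lemma offset_Suc: "u < length adj \<Longrightarrow> offset (Suc u) = offset u + length (adj ! u)"
  by (simp add: offset_def take_Suc_conv_app_nth)

lemma offset_le: "offset u \<le> length (concat adj)"
proof -
  have "concat adj = concat (take u adj) @ concat (drop u adj)"
    by (metis append_take_drop_id concat_append)
  then have "length (concat adj) = offset u + length (concat (drop u adj))"
    by (simp add: offset_def)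
  then show ?thesis by simp
qed

lemma concat_nth: "u < length adj \<Longrightarrow> j < length (adj ! u) \<Longrightarrow> concat adj ! (offset u + j) = adj ! u ! j"
proof -
  assume a: "u < length adj" "j < length (adj ! u)"
  have "concat adj = concat (take u adj) @ adj ! u @ concat (drop (Suc u) adj)"
    using a(1) by (metis append_take_drop_id concat.simps(2) concat_append Cons_nth_drop_Suc)
  then show ?thesis using a(2) unfolding offset_def by (simp add: nth_append)
qed

abbreviation s0 :: state where
  "s0 \<equiv> input_state adj vs H"

lemma card_H: "card (verts H) = h"
  by (simp add: verts_H)

lemma input_vars: "vars s0 ''n'' = length adj" "vars s0 ''h'' = h" "vars s0 ''out'' = 0" "vars s0 ''ex'' = 0"
  by (simp_all add: input_state_def Let_def card_H)

lemma input_zero: "a \<notin> {''off'', ''nbr'', ''ord'', ''H''} \<Longrightarrow> arrs s0 a = (\<lambda>_. 0)"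
  by (simp add: input_state_def Let_def)

lemma input_off: "u \<le> length adj \<Longrightarrow> arrs s0 ''off'' u = offset u"
  by (simp add: input_state_def Let_def array_of_def offset_def del: upt_Suc)

lemma input_nbr: "u < length adj \<Longrightarrow> j < length (adj ! u) \<Longrightarrow> arrs s0 ''nbr'' (offset u + j) = adj ! u ! j"
proof -
  assume a: "u < length adj" "j < length (adj ! u)"
  have "offset u + j < length (concat adj)" using offset_Suc[OF a(1)] offset_le[of "Suc u"] a(2) by linarith
  then show ?thesis using concat_nth[OF a] by (simp add: input_state_def Let_def array_of_def)
qed

lemma input_ord: "i < length vs \<Longrightarrow> arrs s0 ''ord'' i = vs ! i"
  by (simp add: input_state_def Let_def array_of_def)

lemma input_H: "x < h * h \<Longrightarrow> arrs s0 ''H'' x = (if adjH (x div h) (x mod h) then 1 else 0)"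
  by (simp add: input_state_def Let_def adjH_def card_H)

lemma input_H_pair:
  assumes "a < h" "b < h"
  shows "a * h + b < h * h" "arrs s0 ''H'' (a * h + b) = (if adjH a b then 1 else 0)"
proof -
  have "a * h + b < Suc a * h" using assms by simp
  also have "\<dots> \<le> h * h" using assms by (intro mult_le_mono1) simp
  finally show "a * h + b < h * h" .
  then show "arrs s0 ''H'' (a * h + b) = (if adjH a b then 1 else 0)"
    using assms by (simp add: input_H)
qed

lemma wp_edge_test:
  assumes s: "vars s ''h'' = h" "vars s ''ex'' = 0" "arrs s ''H'' = arrs s0 ''H''" and w: "h * h < 2 ^ w" "4 < (2::nat) ^ w"
  shows "wp w edge_test_prog (\<lambda>t s'. t \<le> h * h * 4 + 2 \<and> vars s' ''ex'' = (if \<exists>a b. adjH a b then 1 else 0)) s"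
proof -
  let ?B = "edge_test_body"
  define ex where "ex x \<longleftrightarrow> (\<exists>y<x. adjH (y div h) (y mod h))" for x
  have w0: "w > 0" using w by (cases w) auto
  have "wp w (For ''x'' (Const 0) (Mul (Var ''h'') (Var ''h'')) ?B)
    (\<lambda>t s'. t \<le> (h * h - 0) * (2 + 2) + 2 \<and> vars s' ''ex'' = (if ex (h * h) then 1 else 0) \<and> vars s' ''x'' = h * h) s"
  proof (rule wp_For[where I = "\<lambda>x s'. vars s' ''ex'' = (if ex x then 1 else 0)"])
    fix x and s' :: state
    assume x: "x < h * h" "vars s' ''ex'' = (if ex x then 1 else 0)" "vars s' ''x'' = x"
      and so: "loop_frame ''x'' ?B s s'"
    have "arrs s' ''H'' x = (if adjH (x div h) (x mod h) then 1 else 0)"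
      using so s input_H[OF x(1)] by (simp add: same_off_def)
    moreover have "ex (Suc x) \<longleftrightarrow> ex x \<or> adjH (x div h) (x mod h)" by (auto simp: ex_def less_Suc_eq)
    ultimately show "wp w ?B (\<lambda>t s''. t \<le> 2 \<and> vars (set_var ''x'' (Suc x) s'') ''ex'' = (if ex (Suc x) then 1 else 0)) s'"
      using x w by (simp add: wp_simps)
  next
    show "fits w (Mul (Var ''h'') (Var ''h'')) s' \<and> eval (Mul (Var ''h'') (Var ''h'')) s' = h * h"
      if "loop_frame ''x'' ?B s s'" for s'
      using that s w by (simp add: same_off_def)
  qed (use w0 w s in \<open>simp_all add: ex_def\<close>)
  moreover have "ex (h * h) \<longleftrightarrow> (\<exists>a b. adjH a b)"
  proof
    assume "\<exists>a b. adjH a b"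
    then obtain a b where ab: "adjH a b" by blast
    then have "a * h + b < h * h" "(a * h + b) div h = a" "(a * h + b) mod h = b"
      using adjH_lt[OF ab] input_H_pair(1) by simp_all
    then show "ex (h * h)" unfolding ex_def using ab by metis
  qed (auto simp: ex_def)
  ultimately show ?thesis unfolding edge_test_prog_def by (elim wp_mono) simp
qed

lemma bfs_H_program:
  assumes w: "h + h + 4 < 2 ^ w" "h * h < 2 ^ w"
  shows "bfs_program adjH h h w ''h'' ''colH'' ''qH'' (Const 0) (Var ''h'') (Var ''j'')
    (Eq (Elem ''H'' (Add (Mul (Var ''u'') (Var ''h'')) (Var ''j''))) (Const 1))
    (\<lambda>_. 0) (\<lambda>_. h) adjH (\<lambda>_ j. j) s0"
proof
  fix s u assume so: "same_off bfs_vars {''colH'', ''qH''} s0 s" and u: "vars s ''u'' = u" "u < h"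
  have sh: "vars s ''h'' = h" "arrs s ''H'' = arrs s0 ''H''"
    using so input_vars by (simp_all add: same_off_def)
  then show "fits w (Const 0) s \<and> eval (Const 0) s = 0 \<and> fits w (Var ''h'') s \<and> eval (Var ''h'') s = h" by simp
  fix j assume j: "vars s ''j'' = j" "0 \<le> j" "j < h"
  show "bfits w (Eq (Elem ''H'' (Add (Mul (Var ''u'') (Var ''h'')) (Var ''j''))) (Const 1)) s \<and>
      beval (Eq (Elem ''H'' (Add (Mul (Var ''u'') (Var ''h'')) (Var ''j''))) (Const 1)) s = adjH u j \<and>
      fits w (Var ''j'') s \<and> eval (Var ''j'') s = j"
    using input_H_pair[OF u(2) j(3)] u j sh w by simp
qed (use w adjH_sym adjH_lt input_vars in auto)

lemma bfs_G_program:
  assumes w: "length adj + length adj + 4 < 2 ^ w" "length (concat adj) < 2 ^ w" and K: "width G vs \<le> K"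
    and s: "same_off (insert ''x'' (insert ''ex'' bfs_vars)) {''colH'', ''qH''} s0 s1"
  shows "bfs_program adjG (length adj) (2 * K) w ''n'' ''colG'' ''qG'' (Elem ''off'' (Var ''u''))
    (Elem ''off'' (Add (Var ''u'') (Const 1))) (Elem ''nbr'' (Var ''j'')) (Eq (Const 0) (Const 0))
    offset (\<lambda>u. offset (Suc u)) (\<lambda>_ _. True) (\<lambda>u j. adj ! u ! (j - offset u)) s1"
proof
  fix s u assume so: "same_off bfs_vars {''colG'', ''qG''} s1 s" and u: "vars s ''u'' = u" "u < length adj"
  have sh: "arrs s ''off'' = arrs s0 ''off''" "arrs s ''nbr'' = arrs s0 ''nbr''"
    using so s by (simp_all add: same_off_def)
  then show "fits w (Elem ''off'' (Var ''u'')) s \<and> eval (Elem ''off'' (Var ''u'')) s = offset u \<and>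
      fits w (Elem ''off'' (Add (Var ''u'') (Const 1))) s \<and> eval (Elem ''off'' (Add (Var ''u'') (Const 1))) s = offset (Suc u)"
    using u input_off w by simp
  fix j assume j: "vars s ''j'' = j" "offset u \<le> j" "j < offset (Suc u)"
  then have "j - offset u < length (adj ! u)" using offset_Suc[OF u(2)] by linarith
  from input_nbr[OF u(2) this]
  show "bfits w (Eq (Const 0) (Const 0)) s \<and> beval (Eq (Const 0) (Const 0)) s = True \<and>
      fits w (Elem ''nbr'' (Var ''j'')) s \<and> eval (Elem ''nbr'' (Var ''j'')) s = adj ! u ! (j - offset u)"
    using j sh by simp
next
  fix u v assume u: "u < length adj"
  show "adjG u v \<longleftrightarrow> (\<exists>j\<ge>offset u. j < offset (Suc u) \<and> True \<and> v = adj ! u ! (j - offset u))"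
  proof
    assume "adjG u v"
    then obtain j where "j < length (adj ! u)" "adj ! u ! j = v"
      using adj_nth[OF u] by (metis in_set_conv_nth mem_Collect_eq)
    then show "\<exists>j\<ge>offset u. j < offset (Suc u) \<and> True \<and> v = adj ! u ! (j - offset u)"
      using offset_Suc[OF u] by (intro exI[of _ "offset u + j"]) auto
  next
    assume "\<exists>j\<ge>offset u. j < offset (Suc u) \<and> True \<and> v = adj ! u ! (j - offset u)"
    then obtain j where j: "offset u \<le> j" "j < offset (Suc u)" "v = adj ! u ! (j - offset u)" by blast
    then have "v \<in> set (adj ! u)" using offset_Suc[OF u] by (auto intro!: nth_mem)
    then show "adjG u v" using adj_nth[OF u] by simp
  qed
next
  fix u assume u: "u < length adj"
  have "offset (Suc u) < 2 ^ w" using offset_le[of "Suc u"] w by linarith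
  then show "offset u \<le> offset (Suc u) \<and> offset (Suc u) - offset u \<le> 2 * K \<and> offset (Suc u) < 2 ^ w"
    using offset_Suc[OF u] length_adj_le[OF u] K by simp
qed (use w adjG_sym adjG_lt input_vars s in \<open>auto simp: same_off_def\<close>)

end

section \<open>Running time\<close>

lemma cube_le_power_double: "K ^ 3 \<le> K ^ (2 * K)" if "1 \<le> K" for K :: nat
proof (cases "K = 1")
  case False
  then show ?thesis using that by (intro power_increasing) auto
qed simp

text \<open>The exponent \<open>2 * K * (d - 1)\<close> of the number of tree nodes times the number of rows leaves
  a factor \<open>K ^ (2 * K)\<close>, which absorbs all polynomial factors in K.\<close>

lemma time_budget:
  fixes k d :: nat and \<mu> :: real
  assumes "1 \<le> d" "real d \<le> \<mu>"
  defines "K \<equiv> max 1 k"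
  shows "real (K ^ 3 * (K ^ (K * (d - 1))) ^ 2) \<le> (if k = 0 then 1 else real k powr (2 * real k * \<mu>))"
proof (cases "k = 0")
  case False
  then have K: "K = k" "1 \<le> k" by (simp_all add: K_def)
  have "k ^ 3 * (k ^ (k * (d - 1))) ^ 2 \<le> k ^ (2 * k) * (k ^ (k * (d - 1))) ^ 2"
    using cube_le_power_double[OF K(2)] by (rule mult_le_mono1)
  also have "\<dots> = k ^ (2 * k * d)"
  proof -
    \<comment> \<open>The only use of \<open>1 \<le> d\<close>: with truncated subtraction the
      exponents would not add up for \<open>d = 0\<close>.\<close>
    have "2 * k + k * (d - 1) * 2 = 2 * k * d" using assms(1) by (cases d) (simp_all add: algebra_simps)
    then show ?thesis by (metis power_add power_mult)
  qed
  finally have "real (k ^ 3 * (k ^ (k * (d - 1))) ^ 2) \<le> real (k ^ (2 * k * d))"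
    by (simp only: of_nat_le_iff)
  also have "\<dots> = real k powr real (2 * k * d)" using K(2) by (simp add: powr_realpow[symmetric])
  also have "\<dots> \<le> real k powr (2 * real k * \<mu>)"
    using K(2) assms(2) by (intro powr_mono) (auto simp: mult_left_mono)
  finally show ?thesis using K by simp
qed (simp add: K_def)

context dp_problem
begin

text \<open>The monomial is rows times colours times tree nodes times work per node, with orders
  \<open>h * Q\<close>, \<open>h\<close>, \<open>K * h * Q\<close> and \<open>K * K * h\<close>. One
  of the four factors \<open>h\<close> is the choice of a colour, one is the scan of colours at a
  node, and two come from the bound on \<open>Rm\<close>.\<close>

lemma step_bound_le:
  assumes h: "1 \<le> h" and Q: "1 \<le> Q" "Rm \<le> 2 * h * Q"
  shows "1 + K * Rm \<le> 3 * (K * h * Q)" "step_bound \<le> 288 * (K ^ 3 * h ^ 4 * Q ^ 2)"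
proof -
  have K1: "1 \<le> K" by (rule K(2))
  have "K * Rm \<le> K * (2 * h * Q)" using Q(2) by (rule mult_le_mono2)
  moreover have "1 \<le> K * h * Q" using K1 h Q by simp
  moreover have "K * (2 * h * Q) = 2 * (K * h * Q)" by simp
  ultimately show r: "1 + K * Rm \<le> 3 * (K * h * Q)" by linarith
  have e: "K \<le> K * K * h" "K * h \<le> K * K * h" "1 \<le> K * K * h" using K1 h by simp_all
  have "node_bound \<le> 30 * (K * K * h)"
  proof -
    have "K * (K * h) * 4 = 4 * (K * K * h)" "K * (4 * h + 7) = 4 * (K * h) + 7 * K"
      by (simp_all add: algebra_simps)
    then show ?thesis using e unfolding node_bound_def by linarith
  qed
  then have "node_bound + 2 \<le> 32 * (K * K * h)" using e by linarith
  with r have "(1 + K * Rm) * (node_bound + 2) \<le> 3 * (K * h * Q) * (32 * (K * K * h))" by (rule mult_le_mono)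
  also have "\<dots> = 96 * (K * K * K * h * h * Q)" by (simp add: algebra_simps)
  finally have "(1 + K * Rm) * (node_bound + 2) \<le> 96 * (K * K * K * h * h * Q)" .
  moreover have e2: "K \<le> K * K * K * h * h * Q" "1 \<le> K * K * K * h * h * Q"
  proof -
    have "K * 1 \<le> K * (K * K * h * h * Q)" using K1 h Q by (intro mult_le_mono2) simp
    then show "K \<le> K * K * K * h * h * Q" by (simp add: algebra_simps)
    then show "1 \<le> K * K * K * h * h * Q" using K1 by linarith
  qed
  ultimately have c: "cand_bound + 2 \<le> 116 * (K * K * K * h * h * Q)"
    unfolding cand_bound_def by linarith
  have "h * (cand_bound + 2) \<le> h * (116 * (K * K * K * h * h * Q))" using c by (rule mult_le_mono2)
  moreover have "1 \<le> h * (K * K * K * h * h * Q)" using K1 h Q by simp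
  ultimately have "h * (cand_bound + 2) + 4 \<le> 120 * (h * (K * K * K * h * h * Q))" by linarith
  with Q(2) have "Rm * (h * (cand_bound + 2) + 4) \<le> (2 * h * Q) * (120 * (h * (K * K * K * h * h * Q)))"
    by (rule mult_le_mono)
  also have "\<dots> = 240 * (K ^ 3 * h ^ 4 * Q ^ 2)" by (simp add: algebra_simps eval_nat_numeral)
  finally have a: "Rm * (h * (cand_bound + 2) + 4) \<le> 240 * (K ^ 3 * h ^ 4 * Q ^ 2)" .
  have "K * 1 * 1 \<le> K ^ 3 * h ^ 4 * Q ^ 2" "K * h * 1 \<le> K ^ 3 * h ^ 4 * Q ^ 2"
    using K1 h Q by (intro mult_le_mono self_le_power; simp)+
  \<comment> \<open>Here \<open>240 + 15 + 3 + 30 = 288\<close>.\<close>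
  then show "step_bound \<le> 288 * (K ^ 3 * h ^ 4 * Q ^ 2)"
    using a K1 unfolding step_bound_def by linarith
qed

end

section \<open>The two cases within the time budget\<close>

context hom_problem
begin

text \<open>The cost of searching \<open>G\<close> arises only if \<open>H\<close> has an edge. This
  matters because without an edge there is no bound \<open>1 \<le> \<mu>\<close>, so the budget
  could not be charged for a factor \<open>K\<close>.\<close>

lemma wp_bipartite:
  assumes K: "width G vs \<le> K" "1 \<le> K" and n: "1 \<le> length adj" and h: "1 \<le> h"
    and w: "4 < (2::nat) ^ w" "h * h < 2 ^ w" "length adj + length adj + 4 < 2 ^ w" "length (concat adj) < 2 ^ w"
    and so: "same_off bfs_vars {''colH'', ''qH''} s0 s" and col: "colourable adjH"
  shows "wp w bipartite_prog
    (\<lambda>t s'. t \<le> 4 * (h * h) + (if \<exists>a b. adjH a b then 62 * (length adj * K) else 0) + 6 \<and>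
      (vars s' ''out'' = 1 \<longleftrightarrow> (\<exists>\<phi>. graph_hom G H \<phi>))) s"
  unfolding bipartite_prog_def
proof (rule wp_SeqI[OF wp_edge_test[OF _ _ _ w(2,1)]])
  show "vars s ''h'' = h" "vars s ''ex'' = 0" "arrs s ''H'' = arrs s0 ''H''"
    using so input_vars by (simp_all add: same_off_def)
  fix t1 s1
  assume 1: "t1 \<le> h * h * 4 + 2 \<and> vars s1 ''ex'' = (if \<exists>a b. adjH a b then 1 else 0)"
    and so1: "frame edge_test_prog s s1"
  let ?n = "length adj"
  have v1: "vars s1 ''n'' = ?n" "vars s1 ''out'' = 0" "arrs s1 ''off'' ?n = length (concat adj)" "arrs s1 ''colG'' = (\<lambda>_. 0)"
    using so so1 input_vars input_off[of ?n] by (simp_all add: same_off_def offset_def input_zero)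
  have so01: "same_off (insert ''x'' (insert ''ex'' bfs_vars)) {''colH'', ''qH''} s0 s1"
    using so so1 by (auto simp: same_off_def)
  let ?B = "\<lambda>t. t \<le> 4 * (h * h) + (if \<exists>a b. adjH a b then 62 * (?n * K) else 0) + 6"
  let ?R = "\<lambda>s. vars s ''out'' = 1 \<longleftrightarrow> (\<exists>\<phi>. graph_hom G H \<phi>)"
  show "wp w (Cond (Eq (Var ''ex'') (Const 1))
      (Seq bfs_G (Cond (Eq (Var ''ok'') (Const 1)) (Assign ''out'' (Const 1)) Skip))
      (Cond (Eq (Elem ''off'' (Var ''n'')) (Const 0)) (Assign ''out'' (Const 1)) Skip))
    (\<lambda>t s'. ?B (t1 + t) \<and> ?R s') s1"
  proof (cases "\<exists>a b. adjH a b")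
    case False
    have eq: "(\<exists>\<phi>. graph_hom G H \<phi>) \<longleftrightarrow> length (concat adj) = 0"
      by (rule hom_iff_edgeless) (use False h in auto)
    show ?thesis unfolding eq using 1 v1 False w(1) by (auto simp: wp_simps)
  next
    case True
    then obtain a b where ab: "adjH a b" by blast
    have "wp w (Seq bfs_G (Cond (Eq (Var ''ok'') (Const 1)) (Assign ''out'' (Const 1)) Skip))
      (\<lambda>t s'. ?B (t1 + (t + 1)) \<and> ?R s') s1"
    proof (rule wp_SeqI[OF bfs_program.wp_bfs[OF bfs_G_program[OF w(3,4) K(1) so01] v1(4)]])
      fix t2 s2
      assume 2: "t2 \<le> 2 * ?n * (2 * K * 8 + 12) + 6 \<and> (vars s2 ''ok'' = 1 \<longleftrightarrow> colourable adjG)"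
        and so2: "frame bfs_G s1 s2"
      \<comment> \<open>Bounding 1 and \<open>n\<close> by \<open>n * K\<close> gives the constant
        \<open>62 = 32 + 24 + 6\<close>.\<close>
      have "1 * 1 \<le> ?n * K" "?n * 1 \<le> ?n * K" using n K by (intro mult_le_mono; simp)+
      moreover have "2 * ?n * (2 * K * 8 + 12) + 6 = 32 * (?n * K) + 24 * ?n + 6" by (simp add: algebra_simps)
      ultimately have "t2 \<le> 62 * (?n * K)" using 2 by linarith
      moreover have "vars s2 ''out'' = 0" using so2 v1 by (simp add: same_off_def)
      ultimately show "wp w (Cond (Eq (Var ''ok'') (Const 1)) (Assign ''out'' (Const 1)) Skip)
        (\<lambda>t s'. ?B (t1 + (t2 + t + 1)) \<and> ?R s') s2"
        unfolding hom_iff_colourable[OF col ab] using 1 2 True w(1) by (auto simp: wp_simps)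
    qed
    then show ?thesis using True 1 w(1) by (simp add: wp_Cond)
  qed
qed

lemma wp_non_bipartite:
  fixes K d w :: nat and s :: state
  assumes K: "width G vs \<le> K" "1 \<le> K" and d: "\<And>l. half_induced adjH l {} \<Longrightarrow> l \<le> d" "1 \<le> d" "d \<le> h"
    and n: "1 \<le> length adj" and so: "same_off bfs_vars {''colH'', ''qH''} s0 s"
    and w: "length adj + 4 < 2 ^ w" "h * h < 2 ^ w" "h < 2 ^ w" "length (concat adj) < 2 ^ w"
  defines "B \<equiv> length adj * (K ^ 3 * h ^ 4 * (K ^ (K * (d - 1))) ^ 2)"
  assumes wB: "\<And>x. x \<le> 16 * B \<Longrightarrow> x < 2 ^ w"
  shows "wp w dp_prog (\<lambda>t s'. t \<le> 298 * B \<and> (vars s' ''out'' = 1 \<longleftrightarrow> (\<exists>\<phi>. graph_hom G H \<phi>))) s"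
proof -
  define n where "n = length adj"
  define Q where "Q = K ^ (K * (d - 1))"
  define Rm where "Rm = (\<Sum>t\<le>K * (d - 1). K ^ t)"
  have lv: "length vs = n" using length_vs by (simp add: n_def)
  have n1: "1 \<le> n" and h1: "1 \<le> h" and Q1: "1 \<le> Q" using n d K by (simp_all add: n_def Q_def)
  have RQ: "Rm \<le> 2 * h * Q" unfolding Rm_def Q_def by (rule geometric_sum_le[OF K(2) d(2,3)])
  have B_eq: "B = n * (K ^ 3 * h ^ 4 * Q ^ 2)" by (simp add: B_def n_def Q_def)
  \<comment> \<open>\<open>B\<close> is a product of four factors, so anything dominated factor by
    factor lies below it; each word-size condition becomes a comparison of exponents.\<close>
  have mono: "n' * (K' * h' * Q') \<le> B" if "n' \<le> n" "K' \<le> K ^ 3" "h' \<le> h ^ 4" "Q' \<le> Q ^ 2" for n' K' h' Q'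
    unfolding B_eq using that by (intro mult_le_mono)
  have pw: "1 \<le> K ^ 3" "K \<le> K ^ 3" "K * K \<le> K ^ 3" "1 \<le> h ^ 4" "h \<le> h ^ 4" "h * h \<le> h ^ 4" "1 \<le> Q ^ 2" "Q \<le> Q ^ 2"
    using K h1 Q1 power_increasing[of 2 3 K] power_increasing[of 2 4 h]
    by (simp_all add: self_le_power power2_eq_square)
  have B: "n \<le> B" "n * (K * h * Q) \<le> B" "n * K \<le> B" "K * K * (h * h) * Q \<le> B" "K * K * h \<le> B" "K * h * Q \<le> B" "1 \<le> B"
    using mono[of n 1 1 1] mono[of n K h Q] mono[of n K 1 1] mono[of 1 "K * K" "h * h" Q] mono[of 1 "K * K" h 1] mono[of 1 K h Q]
      mono[of 1 1 1 1] n1 pw by simp_all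
  have n3: "n + 2 \<le> 3 * n" using n1 by simp
  have KRm: "1 + K * Rm \<le> 3 * (K * h * Q)"
  proof -
    have "K * Rm \<le> K * (2 * h * Q)" using RQ by (rule mult_le_mono2)
    moreover have "1 \<le> K * h * Q" using K h1 Q1 by simp
    moreover have "K * (2 * h * Q) = 2 * (K * h * Q)" by simp
    ultimately show ?thesis by linarith
  qed
  have W1: "(n + 2) * (Rm * K) \<le> 16 * B"
  proof -
    have "(n + 2) * (Rm * K) \<le> 3 * n * (2 * h * Q * K)" using n3 RQ by (intro mult_le_mono) auto
    also have "\<dots> = 6 * (n * (K * h * Q))" by (simp add: algebra_simps)
    finally show ?thesis using B by linarith
  qed
  have W2: "(n + 2) * K \<le> 16 * B"
  proof -
    have "(n + 2) * K \<le> 3 * n * K" using n3 by (rule mult_le_mono1)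
    then show ?thesis using B(3) by linarith
  qed
  have W3: "(1 + K * Rm) * (K * h) \<le> 16 * B"
  proof -
    have "(1 + K * Rm) * (K * h) \<le> 3 * (K * h * Q) * (K * h)" using KRm by (rule mult_le_mono1)
    also have "\<dots> = 3 * (K * K * (h * h) * Q)" by (simp add: algebra_simps)
    finally show ?thesis using B by linarith
  qed
  have W4: "K * (K * h) \<le> 16 * B" "K * h \<le> 16 * B" "K \<le> 16 * B" "Rm + 1 \<le> 16 * B"
  proof -
    show "K * (K * h) \<le> 16 * B" using B(5) by (simp add: algebra_simps)
    have "1 * (K * h) \<le> K * (K * h)" "K * 1 \<le> K * h" using K h1 by (intro mult_le_mono; simp)+
    then show "K * h \<le> 16 * B" "K \<le> 16 * B" using \<open>K * (K * h) \<le> 16 * B\<close> by linarith+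
    have "1 * Rm \<le> K * Rm" using K by (intro mult_le_mono) auto
    then show "Rm + 1 \<le> 16 * B" using KRm B by linarith
  qed
  interpret D: dp_problem G vs adj H h w K d Rm
  proof unfold_locales
    show "1 + K * Rm < 2 ^ w" by (rule wB) (use KRm B in linarith)
  qed (use K d(1) Rm_def lv wB W1 W2 W3 W4 w n_def in simp_all)
  have v: "vars s ''n'' = n" "vars s ''h'' = h" "vars s ''out'' = 0"
      "arrs s ''H'' = arrs s0 ''H''" "arrs s ''off'' = arrs s0 ''off''" "arrs s ''nbr'' = arrs s0 ''nbr''"
      "arrs s ''ord'' = arrs s0 ''ord''" "arrs s ''vis'' = (\<lambda>_. 0)" "arrs s ''fl'' = (\<lambda>_. 0)"
    using so input_vars by (simp_all add: same_off_def n_def input_zero)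
  interpret D: dp_input G vs adj H h w K d Rm s offset
  proof unfold_locales
    show "offset u < 2 ^ w" for u using offset_le[of u] w(4) by linarith
  qed (use v lv input_ord input_off offset_Suc input_nbr input_H_pair in simp_all)
  have dp: "wp w dp_prog (\<lambda>t s'. t \<le> n * (D.step_bound + 2) + 8 \<and> (vars s' ''out'' = 1 \<longleftrightarrow> (\<exists>\<phi>. graph_hom G H \<phi>))) s"
    by (rule D.wp_dp[unfolded lv]) (use v in auto)
  have "n * D.step_bound \<le> n * (288 * (K ^ 3 * h ^ 4 * Q ^ 2))"
    by (intro mult_le_mono2 D.step_bound_le[OF h1 Q1 RQ])
  moreover have "n * (288 * (K ^ 3 * h ^ 4 * Q ^ 2)) = 288 * B" by (simp add: B_eq)
  moreover have "n * (D.step_bound + 2) + 8 = n * D.step_bound + 2 * n + 8" by (simp add: algebra_simps)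
  \<comment> \<open>The constant is \<open>298 = 288 + 2 + 8\<close>, since \<open>n\<close> and 1
    are at most \<open>B\<close>.\<close>
  ultimately have bound: "n * (D.step_bound + 2) + 8 \<le> 298 * B" using B by linarith
  show ?thesis
    by (rule wp_mono[OF dp], elim conjE) (rule conjI, erule order.trans, rule bound)
qed

lemma wp_trivial:
  assumes w: "4 < (2::nat) ^ w" and triv: "length adj = 0 \<or> h = 0"
  shows "wp w main_prog (\<lambda>t s. t \<le> 3 \<and> (vars s ''out'' = 1 \<longleftrightarrow> (\<exists>\<phi>. graph_hom G H \<phi>))) s0"
proof (cases "length adj = 0")
  case True
  have "set vs = {}" using set_vs True by simp
  then have "graph_hom G H (\<lambda>_. 0)"
    unfolding part_hom_full[symmetric] part_hom_def by simp
  then have "\<exists>\<phi>. graph_hom G H \<phi>" by blast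
  then show ?thesis unfolding main_prog_def using True w input_vars by (simp add: wp_simps)
next
  case n: False
  have "\<not> graph_hom G H \<phi>" for \<phi>
  proof
    assume "graph_hom G H \<phi>"
    then have "\<phi> (vs ! 0) < h"
      unfolding part_hom_full[symmetric] part_hom_def using n length_vs by simp
    then show False using triv n by simp
  qed
  then show ?thesis unfolding main_prog_def using triv n w input_vars by (simp add: wp_simps)
qed

lemma wp_main:
  fixes k w :: nat and \<mu> T :: real
  assumes k: "width G vs = k" and \<mu>: "mimsup_graph H \<mu>"
    and T: "T = max 1 ((if k = 0 then 1 else real k powr (2 * real k * \<mu>)) * real h ^ 4 * real (length adj))"
    and word: "\<And>x. real x \<le> 16 * (real (input_length adj H) + T) \<Longrightarrow> x < 2 ^ w"
  shows "wp w main_prog (\<lambda>t s. real t \<le> 1000 * T \<and> (vars s ''out'' = 1 \<longleftrightarrow> (\<exists>\<phi>. graph_hom G H \<phi>))) s0"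
proof -
  define n where "n = length adj"
  define K where "K = max 1 k"
  define p where "p = (if k = 0 then 1 else real k powr (2 * real k * \<mu>))"
  have K: "width G vs \<le> K" "1 \<le> K" using k by (simp_all add: K_def)
  have T1: "1 \<le> T" "p * real h ^ 4 * real n \<le> T" unfolding T p_def n_def by simp_all
  have X: "length (concat adj) + n + h * h + 3 \<le> input_length adj H"
    by (simp add: input_length_def n_def card_H power2_eq_square)
  have wsmall: "x < 2 ^ w" if "x \<le> 16 * input_length adj H" for x
  proof (rule word)
    have "real x \<le> real (16 * input_length adj H)" using that by (simp only: of_nat_le_iff)
    then show "real x \<le> 16 * (real (input_length adj H) + T)" using T1 by simp
  qed
  have w4: "4 < (2::nat) ^ w" by (rule wsmall) (use X in linarith)
  show ?thesis
  proof (cases "n = 0 \<or> h = 0")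
    case True
    show ?thesis by (rule wp_mono[OF wp_trivial[OF w4]]) (use True T1 in \<open>auto simp: n_def\<close>)
  next
    case False
    then have n: "1 \<le> n" and h: "1 \<le> h" by simp_all
    have p1: "1 \<le> p"
      unfolding p_def using mimsup_bounds(1)[OF \<mu>] by (auto intro!: ge_one_powr_ge_zero)
    \<comment> \<open>Scanning the matrix of \<open>H\<close> has to be paid for in every case;
      \<open>p\<close>, \<open>h\<close> and \<open>n\<close> are at least 1 here, so
      \<open>h * h\<close> is within the budget.\<close>
    have "real (h * h) * 1 \<le> real h ^ 4 * real n"
    proof (rule mult_mono)
      have "h ^ 2 \<le> h ^ 4" using h by (intro power_increasing) auto
      then show "real (h * h) \<le> real h ^ 4" by (metis of_nat_le_iff of_nat_power power2_eq_square)
    qed (use n in auto)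
    also have "\<dots> \<le> p * (real h ^ 4 * real n)" using p1 mult_right_mono[of 1 p "real h ^ 4 * real n"] by simp
    finally have hT: "real (h * h) \<le> T" using T1(2) by simp
    have hh: "h \<le> h * h" using h by simp
    have w1: "h + h + 4 < 2 ^ w" "h * h < 2 ^ w" "n + n + 4 < 2 ^ w" "length (concat adj) < 2 ^ w"
      "n + 4 < 2 ^ w" "h < 2 ^ w"
      by (rule wsmall, use X hh in linarith)+
    let ?R = "\<lambda>t s. real t \<le> 1000 * T \<and> (vars s ''out'' = 1 \<longleftrightarrow> (\<exists>\<phi>. graph_hom G H \<phi>))"
    have main: "wp w (Seq bfs_H (Cond (Eq (Var ''ok'') (Const 1)) bipartite_prog dp_prog)) (\<lambda>t. ?R (t + 2)) s0"
    proof (rule wp_SeqI[OF bfs_program.wp_bfs[OF bfs_H_program[OF w1(1,2)]]])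
      show "arrs s0 ''colH'' = (\<lambda>_. 0)" by (rule input_zero) simp
      fix t1 s1
      assume 1: "t1 \<le> 2 * h * (h * 8 + 12) + 6 \<and> (vars s1 ''ok'' = 1 \<longleftrightarrow> colourable adjH)"
        and "frame bfs_H s0 s1"
      then have so1: "same_off bfs_vars {''colH'', ''qH''} s0 s1" by simp
      have "2 * h * (h * 8 + 12) + 6 = 16 * (h * h) + 24 * h + 6" by (simp add: algebra_simps)
      then have "t1 \<le> 46 * (h * h)" using 1 h hh by linarith
      then have "real t1 \<le> real (46 * (h * h))" by (simp only: of_nat_le_iff)
      then have t1: "real t1 \<le> 46 * T" using hT by simp
      show "wp w (Cond (Eq (Var ''ok'') (Const 1)) bipartite_prog dp_prog) (\<lambda>t'. ?R (t1 + t' + 2)) s1"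
      proof (cases "colourable adjH")
        case col: True
        let ?e = "if \<exists>a b. adjH a b then 62 * (n * K) else 0"
        have e: "real ?e \<le> 62 * T"
        proof (cases "\<exists>a b. adjH a b")
          case True
          then have "1 \<le> \<mu>" using mimsup_bounds(2)[OF \<mu>] by blast
          \<comment> \<open>With \<open>d = 1\<close> the budget inequality reduces to a bound on
            \<open>K ^ 3\<close>, which covers the single factor \<open>K\<close> needed for
            searching \<open>G\<close>.\<close>
          then have "real (K ^ 3 * (K ^ (K * (1 - 1))) ^ 2) \<le> p"
            unfolding p_def K_def by (intro time_budget) simp_all
          then have "real K ^ 3 \<le> p" by simp
          moreover have "real K \<le> real K ^ 3" using K by (intro self_le_power) auto
          ultimately have "real K \<le> p" by linarith
          moreover have "1 \<le> real h ^ 4" using h by simp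
          ultimately have "real K * 1 * real n \<le> p * real h ^ 4 * real n"
            using p1 by (intro mult_mono) auto
          then show ?thesis using T1(2) True by (simp add: mult.commute)
        qed (use T1 in simp)
        have "wp w bipartite_prog (\<lambda>t. ?R (t1 + (t + 1) + 2)) s1"
        proof (rule wp_mono[OF wp_bipartite[OF K n[unfolded n_def] h w4 w1(2) w1(3,4)[unfolded n_def] so1 col, folded n_def]])
          fix t s' assume a: "t \<le> 4 * (h * h) + ?e + 6 \<and> (vars s' ''out'' = 1 \<longleftrightarrow> (\<exists>\<phi>. graph_hom G H \<phi>))"
          then have "real t \<le> real (4 * (h * h) + ?e + 6)" by (simp only: of_nat_le_iff)
          then have "real t \<le> 4 * real (h * h) + real ?e + 6" by simp
          then have "real t \<le> 72 * T" using hT e T1 by linarith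
          then show "?R (t1 + (t + 1) + 2) s'" using a t1 T1 by simp
        qed
        then show ?thesis using 1 col w4 by (simp add: wp_Cond)
      next
        case False
        have "\<exists>a b. adjH a b"
        proof (rule ccontr)
          assume "\<not> ?thesis"
          then have "proper adjH (\<lambda>_. 1)" by (simp add: proper_def)
          then show False using False unfolding colourable_def by blast
        qed
        then obtain a b where ab: "adjH a b" by blast
        obtain d where d: "half_induced adjH d {}" "\<And>l. half_induced adjH l {} \<Longrightarrow> l \<le> d" "d \<le> h"
          using half_induced_number by blast
        have "half_induced adjH 1 {}"
          unfolding half_induced_def using ab by (intro exI[of _ "\<lambda>_. a"] exI[of _ "\<lambda>_. b"]) simp
        then have d1: "1 \<le> d" by (rule d(2))
        define B where "B = n * (K ^ 3 * h ^ 4 * (K ^ (K * (d - 1))) ^ 2)"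
        have "real (K ^ 3 * (K ^ (K * (d - 1))) ^ 2) \<le> p"
          unfolding p_def K_def using d1 mimsup_bounds(3)[OF \<mu> False d(1)] by (intro time_budget)
        then have "real (K ^ 3 * (K ^ (K * (d - 1))) ^ 2) * (real h ^ 4 * real n) \<le> p * (real h ^ 4 * real n)"
          by (rule mult_right_mono) simp
        then have BT: "real B \<le> T" using T1(2) by (simp add: B_def algebra_simps)
        have wB: "x < 2 ^ w" if "x \<le> 16 * B" for x
        proof (rule word)
          have "real x \<le> real (16 * B)" using that by (simp only: of_nat_le_iff)
          then show "real x \<le> 16 * (real (input_length adj H) + T)" using BT by simp
        qed
        have "wp w dp_prog (\<lambda>t. ?R (t1 + (t + 1) + 2)) s1"
        proof (rule wp_mono[OF wp_non_bipartite[OF K d(2) d1 d(3) n[unfolded n_def] so1 w1(5)[unfolded n_def] w1(2,6,4), folded n_def, folded B_def, OF _ wB]])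
          fix t s' assume a: "t \<le> 298 * B \<and> (vars s' ''out'' = 1 \<longleftrightarrow> (\<exists>\<phi>. graph_hom G H \<phi>))"
          then have "real t \<le> real (298 * B)" by (simp only: of_nat_le_iff)
          then show "?R (t1 + (t + 1) + 2) s'" using a BT t1 T1 by simp
        qed
        then show ?thesis using 1 False w4 by (simp add: wp_Cond)
      qed
    qed
    show ?thesis
      unfolding main_prog_def using main False w4 input_vars by (simp add: wp_Cond n_def)
  qed
qed

end

text \<open>Already \<open>4 * log 2 X\<close> bits give \<open>2 ^ w\<close> at least
  \<open>X ^ 4\<close>, and this is at least \<open>64 * X\<close> because \<open>4 \<le> X\<close>.
  So numbers up to \<open>16 * X\<close> fit.\<close>

lemma word_size:
  fixes X :: real and w c x :: nat
  assumes w: "real w \<ge> real c * log 2 X" and X: "4 \<le> X" and c: "4 \<le> c" and x: "real x \<le> 16 * X"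
  shows "x < 2 ^ w"
proof -
  have "0 \<le> log 2 X" using X by (intro zero_le_log_cancel_iff[THEN iffD2]) auto
  then have "4 * log 2 X \<le> real w" using w c mult_right_mono[of 4 "real c" "log 2 X"] by simp
  then have "2 powr (4 * log 2 X) \<le> 2 powr real w" by simp
  moreover have "2 powr (4 * log 2 X) = X ^ 4"
  proof -
    have "2 powr (4 * log 2 X) = (2 powr log 2 X) powr 4" by (simp add: powr_powr mult.commute)
    also have "\<dots> = X powr 4" using X by simp
    also have "\<dots> = X ^ 4" using X by (simp add: powr_numeral)
    finally show ?thesis .
  qed
  moreover have "64 * X \<le> X ^ 4"
  proof -
    have "4 ^ 3 \<le> X ^ 3" using X by (intro power_mono) auto
    then have "4 ^ 3 * X \<le> X ^ 3 * X" using X by (intro mult_right_mono) auto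
    then show ?thesis by (simp add: eval_nat_numeral)
  qed
  ultimately have "real x < 2 powr real w" using x X by linarith
  also have "\<dots> = real (2 ^ w)" by (simp add: powr_realpow)
  finally show ?thesis by (simp only: of_nat_less_iff)
qed

theorem theorem4:
  shows "\<exists>(P :: com) (c :: nat).
    \<forall>(G :: nat graph) (H :: nat graph) (vs :: nat list) (adj :: nat list list) (k :: nat) (\<mu> :: real) (T :: real) (w :: nat).
      simple_graph G \<longrightarrow> simple_graph H \<longrightarrow>
      linear_ordering G vs \<longrightarrow> width G vs = k \<longrightarrow>
      mimsup_graph H \<mu> \<longrightarrow>
      adj_lists G adj \<longrightarrow> verts H = {0..<card (verts H)} \<longrightarrow>
      \<comment> \<open>the time bound, with \<open>0 ^ 0 = 1\<close>, and at least one step even for graphs without vertices\<close>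
      T = max 1 ((if k = 0 then 1 else real k powr (2 * real k * \<mu>))
            * real (card (verts H)) ^ 4 * real (card (verts G))) \<longrightarrow>
      \<comment> \<open>word length logarithmic in the input length and the time bound\<close>
      real w \<ge> real c * log 2 (real (input_length adj H) + T) \<longrightarrow>
      (\<exists>t s. exec w P (input_state adj vs H) t s \<and> real t \<le> real c * T \<and>
             (vars s ''out'' = 1 \<longleftrightarrow> (\<exists>\<phi>. graph_hom G H \<phi>)))"
\<comment> \<open>One constant serves both bounds: the running time adds up to less than
  \<open>1000 * T\<close>, and the word length only needs a factor of at least 4.\<close>
proof (rule exI[of _ main_prog], rule exI[of _ 1000], intro allI impI)
  fix G H :: "nat graph" and vs adj k and \<mu> T :: real and w
  assume A: "simple_graph G" "simple_graph H" "linear_ordering G vs" "width G vs = k" "mimsup_graph H \<mu>"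
    "adj_lists G adj" "verts H = {0..<card (verts H)}"
    and T: "T = max 1 ((if k = 0 then 1 else real k powr (2 * real k * \<mu>))
            * real (card (verts H)) ^ 4 * real (card (verts G)))"
    and w: "real w \<ge> real 1000 * log 2 (real (input_length adj H) + T)"
  interpret hom_problem G vs adj H "card (verts H)"
    using A by unfold_locales
  have "card (verts G) = length adj" using A(6) by (simp add: adj_lists_def)
  with T have T': "T = max 1 ((if k = 0 then 1 else real k powr (2 * real k * \<mu>)) * real (card (verts H)) ^ 4 * real (length adj))"
    by simp
  have "4 \<le> real (input_length adj H) + T"
  proof -
    have "1 \<le> T" unfolding T by (rule max.cobounded1)
    moreover have "3 \<le> input_length adj H" by (simp add: input_length_def)
    ultimately show ?thesis by linarith
  qed
  then have "x < 2 ^ w" if "real x \<le> 16 * (real (input_length adj H) + T)" for x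
    using word_size[OF w] that by simp
  from wp_main[OF A(4,5) T' this]
  show "\<exists>t s. exec w main_prog (input_state adj vs H) t s \<and> real t \<le> real 1000 * T \<and>
             (vars s ''out'' = 1 \<longleftrightarrow> (\<exists>\<phi>. graph_hom G H \<phi>))"
    unfolding wp_def by simp
qed

end
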